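(* Let $S$ be a path connected, locally path connected and locally simply connected topological space and let $\mathcal{U}=\{U_1,\dots,U_n\}$ be a locally simply connected finite open covering of $S$, i.e., for each $s\in S$ the intersection $\bigcap_{s\in U_i}U_i$ is simply connected. Let $X$ be the finite topological space associated to $S$ and $\mathcal{U}$, and let $\pi\colon S\to X$ be the natural continuous map. Then: 1. For any locally constant sheaf $\mathcal{L}$ (of abelian groups) on $S$, $\pi_*\mathcal{L}$ is a locally constant sheaf on $X$. 2. The functors $\pi^*$ and $\pi_*$ establish an equivalence between the category of locally constant sheaves (of abelian groups) on $S$ and the category of locally constant sheaves (of abelian groups) on $X$. In other words, the homomorphism $\pi_1(S)\to\pi_1(X)$ induced by $\pi$ is an isomorphism.
   Context: For a finite open covering $\mathcal{U}=\{U_1,\dots,U_n\}$ of a topological space $S$, let $S_{\mathcal{U}}$ be the set $S$ with the (finite) topology generated by $\mathcal{U}$. The finite topological space $X$ associated to $S$ and $\mathcal{U}$ is the associated $T_0$-space of $S_{\mathcal{U}}$: the quotient of $S_{\mathcal{U}}$ by the relation $s\sim t$ iff $s$ and $t$ have the same closure in $S_{\mathcal{U}}$ (equivalently, $s$ and $t$ belong to the same $U_i$'s). The natural map $\pi\colon S\to X$, $s\mapsto[s]$, is continuous for the original topology of $S$. Here $\pi^*$ and $\pi_*$ are the inverse and direct image of sheaves of abelian groups. Simply connected means path connected with trivial fundamental group. *)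

theory Defs
  imports "HOL-Analysis.Analysis" "HOL-Algebra.Elementary_Groups"
begin

section \<open>Fundamental groups of abstract topological spaces\<close>

definition loops :: "'a topology \<Rightarrow> 'a \<Rightarrow> (real \<Rightarrow> 'a) set" where
  "loops X x = {p. pathin X p \<and> p 0 = x \<and> p 1 = x}"

definition loop_class :: "'a topology \<Rightarrow> 'a \<Rightarrow> (real \<Rightarrow> 'a) \<Rightarrow> (real \<Rightarrow> 'a) set" where
  "loop_class X x p =
     {q. homotopic_with (\<lambda>r. r 0 = x \<and> r 1 = x) (top_of_set {0..1}) X p q}"

text \<open>The library concatenation \<open>+++\<close> is restricted to types of class
  \<^class>\<open>topological_space\<close>, hence this version.\<close>

definition loop_join :: "(real \<Rightarrow> 'a) \<Rightarrow> (real \<Rightarrow> 'a) \<Rightarrow> real \<Rightarrow> 'a" where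
  "loop_join p q = (\<lambda>t. if t \<le> 1/2 then p (2 * t) else q (2 * t - 1))"

text \<open>In the product, and in the induced map below, all members of the union coincide; the union
  only avoids a choice of representatives.\<close>

definition fundamental_group :: "'a topology \<Rightarrow> 'a \<Rightarrow> (real \<Rightarrow> 'a) set monoid" where
  "fundamental_group X x =
     \<lparr>carrier = loop_class X x ` loops X x,
      mult = (\<lambda>A B. \<Union>p\<in>A. \<Union>q\<in>B. loop_class X x (loop_join p q)),
      one = loop_class X x (\<lambda>_. x)\<rparr>"

definition fundamental_group_map ::
    "'b topology \<Rightarrow> ('a \<Rightarrow> 'b) \<Rightarrow> 'a \<Rightarrow> (real \<Rightarrow> 'a) set \<Rightarrow> (real \<Rightarrow> 'b) set" where
  "fundamental_group_map Y f x = (\<lambda>A. \<Union>p\<in>A. loop_class Y (f x) (f \<circ> p))"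

definition simply_connected_space :: "'a topology \<Rightarrow> bool" where
  "simply_connected_space X \<longleftrightarrow>
     path_connected_space X \<and> (\<forall>x\<in>topspace X. trivial_group (fundamental_group X x))"

definition locally_simply_connected_space :: "'a topology \<Rightarrow> bool" where
  "locally_simply_connected_space X \<longleftrightarrow>
     neighbourhood_base_of (\<lambda>V. simply_connected_space (subtopology X V)) X"


section \<open>The finite space associated to a finite open covering\<close>

definition T0_class :: "'a topology \<Rightarrow> 'a \<Rightarrow> 'a set" where
  "T0_class T s = {t \<in> topspace T. T closure_of {t} = T closure_of {s}}"

definition T0_quotient :: "'a topology \<Rightarrow> 'a set topology" where
  "T0_quotient T =
     topology (\<lambda>V. V \<subseteq> T0_class T ` topspace T \<and> openin T {s \<in> topspace T. T0_class T s \<in> V})"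

definition finite_open_covering :: "'a topology \<Rightarrow> 'a set set \<Rightarrow> bool" where
  "finite_open_covering S \<U> \<longleftrightarrow> finite \<U> \<and> (\<forall>U\<in>\<U>. openin S U) \<and> \<Union>\<U> = topspace S"

definition locally_simply_connected_covering :: "'a topology \<Rightarrow> 'a set set \<Rightarrow> bool" where
  "locally_simply_connected_covering S \<U> \<longleftrightarrow>
     (\<forall>s\<in>topspace S. simply_connected_space (subtopology S (\<Inter>{U \<in> \<U>. s \<in> U})))"

text \<open>For a covering \<open>\<U>\<close> of \<open>S\<close>, the space \<open>topology_generated_by \<U>\<close> has the points of \<open>S\<close>.\<close>

definition associated_space :: "'a set set \<Rightarrow> 'a set topology" where
  "associated_space \<U> = T0_quotient (topology_generated_by \<U>)"

definition associated_map :: "'a set set \<Rightarrow> 'a \<Rightarrow> 'a set" where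
  "associated_map \<U> = T0_class (topology_generated_by \<U>)"


section \<open>Sheaves of abelian groups\<close>

text \<open>Abelian groups are the (multiplicatively written) \<^const>\<open>comm_group\<close>s. The fields of a
  (pre)sheaf on \<open>X\<close> matter only at open sets of \<open>X\<close>. Hence, for \<open>U\<close> open in \<open>X\<close>, the restriction
  of \<open>F\<close> to \<open>U\<close> is \<open>F\<close> itself, regarded as a sheaf on \<open>subtopology X U\<close>.\<close>

record ('a, 'g) presheaf =
  Sec :: "'a set \<Rightarrow> 'g monoid"
  Res :: "'a set \<Rightarrow> 'a set \<Rightarrow> 'g \<Rightarrow> 'g"  \<comment> \<open>\<open>Res F U V\<close> maps \<open>Sec F U\<close> to \<open>Sec F V\<close>\<close>

definition is_presheaf :: "'a topology \<Rightarrow> ('a, 'g) presheaf \<Rightarrow> bool" where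
  "is_presheaf X F \<longleftrightarrow>
     (\<forall>U. openin X U \<longrightarrow> comm_group (Sec F U)) \<and>
     (\<forall>U V. openin X U \<longrightarrow> openin X V \<longrightarrow> V \<subseteq> U \<longrightarrow> Res F U V \<in> hom (Sec F U) (Sec F V)) \<and>
     (\<forall>U. openin X U \<longrightarrow> (\<forall>s\<in>carrier (Sec F U). Res F U U s = s)) \<and>
     (\<forall>U V W. openin X U \<longrightarrow> openin X V \<longrightarrow> openin X W \<longrightarrow> V \<subseteq> U \<longrightarrow> W \<subseteq> V \<longrightarrow>
        (\<forall>s\<in>carrier (Sec F U). Res F V W (Res F U V s) = Res F U W s))"

definition is_sheaf :: "'a topology \<Rightarrow> ('a, 'g) presheaf \<Rightarrow> bool" where
  "is_sheaf X F \<longleftrightarrow> is_presheaf X F \<and>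
     (\<forall>\<V> \<sigma>. (\<forall>V\<in>\<V>. openin X V \<and> \<sigma> V \<in> carrier (Sec F V)) \<longrightarrow>
        (\<forall>V\<in>\<V>. \<forall>W\<in>\<V>. Res F V (V \<inter> W) (\<sigma> V) = Res F W (V \<inter> W) (\<sigma> W)) \<longrightarrow>
        (\<exists>!s. s \<in> carrier (Sec F (\<Union>\<V>)) \<and> (\<forall>V\<in>\<V>. Res F (\<Union>\<V>) V s = \<sigma> V)))"

text \<open>Morphisms are extensional, so that they form honest hom-sets. The section types of source and
  target may differ.\<close>

definition sheaf_hom ::
    "'a topology \<Rightarrow> ('a, 'g) presheaf \<Rightarrow> ('a, 'h) presheaf \<Rightarrow> ('a set \<Rightarrow> 'g \<Rightarrow> 'h) set" where
  "sheaf_hom X F G =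
     {\<phi> \<in> extensional {U. openin X U}.
        (\<forall>U. openin X U \<longrightarrow>
           \<phi> U \<in> extensional (carrier (Sec F U)) \<and> \<phi> U \<in> hom (Sec F U) (Sec G U)) \<and>
        (\<forall>U V. openin X U \<longrightarrow> openin X V \<longrightarrow> V \<subseteq> U \<longrightarrow>
           (\<forall>s\<in>carrier (Sec F U). \<phi> V (Res F U V s) = Res G U V (\<phi> U s)))}"

definition sheaf_iso ::
    "'a topology \<Rightarrow> ('a, 'g) presheaf \<Rightarrow> ('a, 'h) presheaf \<Rightarrow> ('a set \<Rightarrow> 'g \<Rightarrow> 'h) set" where
  "sheaf_iso X F G =
     {\<phi> \<in> sheaf_hom X F G. \<forall>U. openin X U \<longrightarrow> \<phi> U \<in> iso (Sec F U) (Sec G U)}"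

definition sheaf_id :: "'a topology \<Rightarrow> ('a, 'g) presheaf \<Rightarrow> 'a set \<Rightarrow> 'g \<Rightarrow> 'g" where
  "sheaf_id X F = (\<lambda>U\<in>{U. openin X U}. \<lambda>s\<in>carrier (Sec F U). s)"

definition sheaf_comp ::
    "'a topology \<Rightarrow> ('a, 'g) presheaf \<Rightarrow> ('a set \<Rightarrow> 'h \<Rightarrow> 'k) \<Rightarrow> ('a set \<Rightarrow> 'g \<Rightarrow> 'h) \<Rightarrow>
       'a set \<Rightarrow> 'g \<Rightarrow> 'k" where
  "sheaf_comp X F \<psi> \<phi> = (\<lambda>U\<in>{U. openin X U}. compose (carrier (Sec F U)) (\<psi> U) (\<phi> U))"

definition constant_sheaf :: "'a topology \<Rightarrow> 'g monoid \<Rightarrow> ('a, 'a \<Rightarrow> 'g) presheaf" where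
  "constant_sheaf X A =
     \<lparr>Sec = (\<lambda>U. \<lparr>carrier = {f \<in> extensional U.
                     continuous_map (subtopology X U) (discrete_topology (carrier A)) f},
                  mult = (\<lambda>f g. \<lambda>x\<in>U. f x \<otimes>\<^bsub>A\<^esub> g x),
                  one = (\<lambda>x\<in>U. \<one>\<^bsub>A\<^esub>)\<rparr>),
      Res = (\<lambda>U V f. restrict f V)\<rparr>"

text \<open>It is no restriction to take the group \<open>A\<close> on the section type \<open>'g\<close>: since \<open>U\<close> is
  nonempty, \<open>A\<close> embeds into \<open>Sec F U\<close> as the constant sections.\<close>

definition locally_constant_sheaf :: "'a topology \<Rightarrow> ('a, 'g) presheaf \<Rightarrow> bool" where
  "locally_constant_sheaf X F \<longleftrightarrow> is_sheaf X F \<and>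
     (\<forall>x\<in>topspace X. \<exists>U (A :: 'g monoid). openin X U \<and> x \<in> U \<and> comm_group A \<and>
        sheaf_iso (subtopology X U) F (constant_sheaf (subtopology X U) A) \<noteq> {})"


section \<open>Stalks, direct image and inverse image\<close>

type_synonym ('a, 'g) germ = "('a set \<times> 'g) set"

definition germ ::
    "'a topology \<Rightarrow> ('a, 'g) presheaf \<Rightarrow> 'a \<Rightarrow> 'a set \<Rightarrow> 'g \<Rightarrow> ('a, 'g) germ" where
  "germ X F x U s =
     {(V, t). openin X V \<and> x \<in> V \<and> t \<in> carrier (Sec F V) \<and>
        (\<exists>W. openin X W \<and> x \<in> W \<and> W \<subseteq> U \<inter> V \<and> Res F U W s = Res F V W t)}"

text \<open>Again, the unions below only avoid choosing representatives.\<close>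

definition stalk :: "'a topology \<Rightarrow> ('a, 'g) presheaf \<Rightarrow> 'a \<Rightarrow> ('a, 'g) germ monoid" where
  "stalk X F x =
     \<lparr>carrier = {germ X F x U s | U s. openin X U \<and> x \<in> U \<and> s \<in> carrier (Sec F U)},
      mult = (\<lambda>a b. \<Union>(U, s)\<in>a. \<Union>(V, t)\<in>b.
                germ X F x (U \<inter> V) (Res F U (U \<inter> V) s \<otimes>\<^bsub>Sec F (U \<inter> V)\<^esub> Res F V (U \<inter> V) t)),
      one = germ X F x (topspace X) \<one>\<^bsub>Sec F (topspace X)\<^esub>\<rparr>"

definition stalk_map ::
    "'a topology \<Rightarrow> ('a, 'h) presheaf \<Rightarrow> ('a set \<Rightarrow> 'g \<Rightarrow> 'h) \<Rightarrow> 'a \<Rightarrow>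
       ('a, 'g) germ \<Rightarrow> ('a, 'h) germ" where
  "stalk_map X G \<phi> x = (\<lambda>a. \<Union>(U, s)\<in>a. germ X G x U (\<phi> U s))"

definition preimg :: "'a topology \<Rightarrow> ('a \<Rightarrow> 'b) \<Rightarrow> 'b set \<Rightarrow> 'a set" where
  "preimg S f V = {s \<in> topspace S. f s \<in> V}"

definition direct_image ::
    "'a topology \<Rightarrow> ('a \<Rightarrow> 'b) \<Rightarrow> ('a, 'g) presheaf \<Rightarrow> ('b, 'g) presheaf" where
  "direct_image S f F =
     \<lparr>Sec = (\<lambda>V. Sec F (preimg S f V)),
      Res = (\<lambda>V W. Res F (preimg S f V) (preimg S f W))\<rparr>"

definition direct_image_map ::
    "'a topology \<Rightarrow> 'b topology \<Rightarrow> ('a \<Rightarrow> 'b) \<Rightarrow> ('a set \<Rightarrow> 'g \<Rightarrow> 'h) \<Rightarrow> 'b set \<Rightarrow> 'g \<Rightarrow> 'h" where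
  "direct_image_map S X f \<phi> = (\<lambda>V\<in>{V. openin X V}. \<phi> (preimg S f V))"

text \<open>The sheafification of the presheaf sending \<open>V\<close> to the colimit of \<open>Sec F W\<close> over the open
  sets \<open>W\<close> that contain the image of \<open>V\<close>: its stalk at \<open>s\<close> is the stalk of \<open>F\<close> at \<open>f s\<close>, and its
  sections are the families of stalk elements that are locally induced by sections of \<open>F\<close>.\<close>

definition inverse_image ::
    "'a topology \<Rightarrow> 'b topology \<Rightarrow> ('a \<Rightarrow> 'b) \<Rightarrow> ('b, 'g) presheaf \<Rightarrow>
       ('a, 'a \<Rightarrow> ('b, 'g) germ) presheaf" where
  "inverse_image S X f F =
     \<lparr>Sec = (\<lambda>V.
        \<lparr>carrier = {\<sigma> \<in> (\<Pi>\<^sub>E s\<in>V. carrier (stalk X F (f s))).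
            \<forall>s\<in>V. \<exists>V' W t. openin S V' \<and> s \<in> V' \<and> V' \<subseteq> V \<and> openin X W \<and> f ` V' \<subseteq> W \<and>
              t \<in> carrier (Sec F W) \<and> (\<forall>s'\<in>V'. \<sigma> s' = germ X F (f s') W t)},
         mult = (\<lambda>\<sigma> \<tau>. \<lambda>s\<in>V. \<sigma> s \<otimes>\<^bsub>stalk X F (f s)\<^esub> \<tau> s),
         one = (\<lambda>s\<in>V. \<one>\<^bsub>stalk X F (f s)\<^esub>)\<rparr>),
      Res = (\<lambda>U V \<sigma>. restrict \<sigma> V)\<rparr>"

definition inverse_image_map ::
    "'a topology \<Rightarrow> 'b topology \<Rightarrow> ('a \<Rightarrow> 'b) \<Rightarrow> ('b, 'g) presheaf \<Rightarrow> ('b, 'h) presheaf \<Rightarrow>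
       ('b set \<Rightarrow> 'g \<Rightarrow> 'h) \<Rightarrow> 'a set \<Rightarrow> ('a \<Rightarrow> ('b, 'g) germ) \<Rightarrow> 'a \<Rightarrow> ('b, 'h) germ" where
  "inverse_image_map S X f F G \<phi> =
     (\<lambda>V\<in>{V. openin S V}. \<lambda>\<sigma>\<in>carrier (Sec (inverse_image S X f F) V).
        \<lambda>s\<in>V. stalk_map X G \<phi> (f s) (\<sigma> s))"


section \<open>Categories of locally constant sheaves\<close>

record ('o, 'm) cat =
  Obj :: "'o set"
  Hom :: "'o \<Rightarrow> 'o \<Rightarrow> 'm set"
  Id :: "'o \<Rightarrow> 'm"
  Comp :: "'o \<Rightarrow> 'm \<Rightarrow> 'm \<Rightarrow> 'm"  \<comment> \<open>\<open>Comp C a g f\<close> is \<open>g\<close> after \<open>f\<close>, where \<open>f\<close> has source \<open>a\<close>\<close>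

definition is_category :: "('o, 'm) cat \<Rightarrow> bool" where
  "is_category C \<longleftrightarrow>
     (\<forall>a\<in>Obj C. Id C a \<in> Hom C a a) \<and>
     (\<forall>a\<in>Obj C. \<forall>b\<in>Obj C. \<forall>c\<in>Obj C. \<forall>f\<in>Hom C a b. \<forall>g\<in>Hom C b c. Comp C a g f \<in> Hom C a c) \<and>
     (\<forall>a\<in>Obj C. \<forall>b\<in>Obj C. \<forall>f\<in>Hom C a b. Comp C a f (Id C a) = f \<and> Comp C a (Id C b) f = f) \<and>
     (\<forall>a\<in>Obj C. \<forall>b\<in>Obj C. \<forall>c\<in>Obj C. \<forall>d\<in>Obj C.
        \<forall>f\<in>Hom C a b. \<forall>g\<in>Hom C b c. \<forall>h\<in>Hom C c d.
          Comp C a h (Comp C a g f) = Comp C a (Comp C b h g) f)"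

definition is_functor ::
    "('o, 'm) cat \<Rightarrow> ('p, 'n) cat \<Rightarrow> ('o \<Rightarrow> 'p) \<Rightarrow> ('o \<Rightarrow> 'o \<Rightarrow> 'm \<Rightarrow> 'n) \<Rightarrow> bool" where
  "is_functor C D T T' \<longleftrightarrow> is_category C \<and> is_category D \<and>
     (\<forall>a\<in>Obj C. T a \<in> Obj D) \<and>
     (\<forall>a\<in>Obj C. \<forall>b\<in>Obj C. \<forall>f\<in>Hom C a b. T' a b f \<in> Hom D (T a) (T b)) \<and>
     (\<forall>a\<in>Obj C. T' a a (Id C a) = Id D (T a)) \<and>
     (\<forall>a\<in>Obj C. \<forall>b\<in>Obj C. \<forall>c\<in>Obj C. \<forall>f\<in>Hom C a b. \<forall>g\<in>Hom C b c.
        T' a c (Comp C a g f) = Comp D (T a) (T' b c g) (T' a b f))"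

definition LC :: "'a topology \<Rightarrow> (('a, 'g) presheaf, 'a set \<Rightarrow> 'g \<Rightarrow> 'g) cat" where
  "LC X = \<lparr>Obj = {F. locally_constant_sheaf X F}, Hom = sheaf_hom X,
           Id = sheaf_id X, Comp = sheaf_comp X\<rparr>"

text \<open>Natural isomorphism between two functors \<open>T\<close>, \<open>R\<close> from \<open>C\<close> to sheaves on \<open>X\<close>, where the
  values of \<open>T\<close> and of \<open>R\<close> may have different section types.\<close>

definition natural_sheaf_iso ::
    "('o, 'm) cat \<Rightarrow> 'a topology \<Rightarrow>
       ('o \<Rightarrow> ('a, 'g) presheaf) \<Rightarrow> ('o \<Rightarrow> 'o \<Rightarrow> 'm \<Rightarrow> 'a set \<Rightarrow> 'g \<Rightarrow> 'g) \<Rightarrow>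
       ('o \<Rightarrow> ('a, 'h) presheaf) \<Rightarrow> ('o \<Rightarrow> 'o \<Rightarrow> 'm \<Rightarrow> 'a set \<Rightarrow> 'h \<Rightarrow> 'h) \<Rightarrow>
       ('o \<Rightarrow> 'a set \<Rightarrow> 'g \<Rightarrow> 'h) \<Rightarrow> bool" where
  "natural_sheaf_iso C X T T' R R' \<eta> \<longleftrightarrow>
     (\<forall>a\<in>Obj C. \<eta> a \<in> sheaf_iso X (T a) (R a)) \<and>
     (\<forall>a\<in>Obj C. \<forall>b\<in>Obj C. \<forall>f\<in>Hom C a b.
        sheaf_comp X (T a) (\<eta> b) (T' a b f) = sheaf_comp X (T a) (R' a b f) (\<eta> a))"

text \<open>The inverse and direct image functors along \<open>f\<close> are quasi-inverse equivalences between the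
  categories of locally constant sheaves. Sections of an inverse image are families of germs, so
  that \<open>inverse_image\<close> changes the section type; this is why the composites of the two functors,
  starting from sheaves with sections in \<open>'g\<close>, are compared with the identity by means of
  isomorphisms between sheaves with different section types.\<close>

definition images_establish_equivalence ::
    "'a topology \<Rightarrow> 'b topology \<Rightarrow> ('a \<Rightarrow> 'b) \<Rightarrow> 'g itself \<Rightarrow> bool" where
  "images_establish_equivalence S X f (_ :: 'g itself) \<longleftrightarrow>
     is_functor (LC X :: (('b, 'g) presheaf, _) cat) (LC S)
       (inverse_image S X f) (inverse_image_map S X f) \<and>
     is_functor (LC S :: (('a, 'g) presheaf, _) cat) (LC X)
       (direct_image S f) (\<lambda>_ _. direct_image_map S X f) \<and>
     (\<exists>\<eta>. natural_sheaf_iso (LC X :: (('b, 'g) presheaf, _) cat) X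
        (\<lambda>M. M) (\<lambda>_ _ \<phi>. \<phi>)
        (\<lambda>M. direct_image S f (inverse_image S X f M))
        (\<lambda>M N \<phi>. direct_image_map S X f (inverse_image_map S X f M N \<phi>)) \<eta>) \<and>
     (\<exists>\<epsilon>. natural_sheaf_iso (LC S :: (('a, 'g) presheaf, _) cat) S
        (\<lambda>L. inverse_image S X f (direct_image S f L))
        (\<lambda>L K \<phi>. inverse_image_map S X f (direct_image S f L) (direct_image S f K)
                    (direct_image_map S X f \<phi>))
        (\<lambda>L. L) (\<lambda>_ _ \<phi>. \<phi>) \<epsilon>)"

end

theory Submission
  imports Defs
begin

text \<open>
  The only property of the finite space that matters is that each of its points \<open>x\<close> has a least open
  neighbourhood \<open>Um x\<close>, and that the preimage \<open>Us x\<close> of this neighbourhood is simply connected.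

  By monodromy, a locally constant sheaf \<open>L\<close> on \<open>S\<close> satisfies \<open>L(W) = L\<^sub>s\<close> for all simply connected
  open \<open>W\<close> and \<open>s\<close> in \<open>W\<close>. With \<open>W = Us x\<close> this shows that the direct image of \<open>L\<close> is constant on
  \<open>Um x\<close> and that its stalk at \<open>\<pi> s\<close> is \<open>L\<^sub>s\<close>, which makes the counit bijective. Conversely, if
  \<open>M\<close> is locally constant on the finite space, then a section over \<open>Us x\<close> of the inverse image of
  \<open>M\<close> is a locally constant function with values in \<open>M(Um x)\<close>. It is constant because \<open>Us x\<close> is
  connected, which makes the unit bijective.

  On fundamental groups, surjectivity is obtained by cutting a path in the finite space into pieces
  that lie in sets \<open>Um x\<close> and replacing each piece by the image of a path in \<open>Us x\<close>. This does not
  change the homotopy class, since \<open>Um x\<close> contracts to \<open>x\<close>. Injectivity is monodromy again, now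
  applied on the finite space to the direct image of the universal covering of \<open>S\<close>.
\<close>


section \<open>Path homotopies in abstract topological spaces\<close>

text \<open>The finite space is in general not Hausdorff, so that arguments on it can use a metric
  on the domain of a path only. Compactness of the unit interval therefore enters through the
  bisection principle \<open>Bolzano\<close>: a relation between the ends of an interval holds on
  the whole interval if it passes to unions of adjacent intervals and holds on all short intervals
  around each point. Path lifting, its uniqueness, monodromy and the replacement of paths are all
  proved in this way. Monodromy is used over two very different bases, with germs over
  \<open>S\<close> and with homotopy classes of paths over \<open>X\<close>. It is therefore proved
  for fibres with transport maps over the sets of a base, and no total space is ever topologized.
  That \<open>Um x\<close> contracts to \<open>x\<close> means that a path in it may take the value
  \<open>x\<close> at a single time: any open set that notices this value contains the whole path.
  The direct image is constant on \<open>Um x\<close> because, for \<open>y\<close> in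
  \<open>Um x\<close>, the set \<open>Us y\<close> lies in \<open>Us x\<close> and both are simply
  connected. Sections over either are then the stalk at any point above \<open>y\<close>, and
  restriction between them is bijective.\<close>

definition path_homotopic ::
    "'a topology \<Rightarrow> 'a \<Rightarrow> 'a \<Rightarrow> (real \<Rightarrow> 'a) \<Rightarrow> (real \<Rightarrow> 'a) \<Rightarrow> bool" where
  "path_homotopic X x y p q \<longleftrightarrow>
     homotopic_with (\<lambda>r. r 0 = x \<and> r 1 = y) (top_of_set {0..1}) X p q"

lemma loop_class_eq: "loop_class X x p = {q. path_homotopic X x x p q}"
  by (simp add: loop_class_def path_homotopic_def)

text \<open>Turns a homotopy into a map on the square in the Euclidean plane, so that every change
  of its domain is an ordinary continuous real function. The first coordinate is the homotopy
  parameter, the second is time.\<close>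

lemma path_homotopic_iff:
  "path_homotopic X x y p q \<longleftrightarrow>
     (\<exists>h :: real \<times> real \<Rightarrow> 'a. continuous_map (top_of_set ({0..1} \<times> {0..1})) X h \<and>
        (\<forall>t\<in>{0..1}. h (0, t) = p t \<and> h (1, t) = q t) \<and>
        (\<forall>s\<in>{0..1}. h (s, 0) = x \<and> h (s, 1) = y))"
proof -
  have eq: "prod_topology (top_of_set {0..1::real}) (top_of_set {0..1::real})
      = top_of_set ({0..1} \<times> {0..1})"
    by (simp add: prod_topology_subtopology euclidean_product_topology subtopology_subtopology
        Times_Int_Times)
  show ?thesis
    unfolding path_homotopic_def
    by (subst homotopic_with) (simp, simp add: eq ball_conj_distrib conj_assoc)
qed

lemma path_homotopicI:
  fixes h :: "real \<times> real \<Rightarrow> 'a"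
  assumes "continuous_map (top_of_set ({0..1} \<times> {0..1})) X h"
    and "\<And>t. t \<in> {0..1} \<Longrightarrow> h (0, t) = p t" "\<And>t. t \<in> {0..1} \<Longrightarrow> h (1, t) = q t"
    and "\<And>s. s \<in> {0..1} \<Longrightarrow> h (s, 0) = x" "\<And>s. s \<in> {0..1} \<Longrightarrow> h (s, 1) = y"
  shows "path_homotopic X x y p q"
  unfolding path_homotopic_iff using assms by (intro exI[of _ h]) simp

lemma path_homotopicE:
  assumes "path_homotopic X x y p q"
  obtains h :: "real \<times> real \<Rightarrow> 'a"
  where "continuous_map (top_of_set ({0..1} \<times> {0..1})) X h"
    and "\<And>t. t \<in> {0..1} \<Longrightarrow> h (0, t) = p t" "\<And>t. t \<in> {0..1} \<Longrightarrow> h (1, t) = q t"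
    and "\<And>s. s \<in> {0..1} \<Longrightarrow> h (s, 0) = x" "\<And>s. s \<in> {0..1} \<Longrightarrow> h (s, 1) = y"
  using assms unfolding path_homotopic_iff by metis

lemma path_homotopic_refl: "pathin X p \<Longrightarrow> path_homotopic X (p 0) (p 1) p p"
  by (simp add: path_homotopic_def pathin_def)

lemma path_homotopic_sym: "path_homotopic X x y p q \<Longrightarrow> path_homotopic X x y q p"
  by (simp add: path_homotopic_def homotopic_with_sym)

lemma path_homotopic_trans [trans]:
  "\<lbrakk>path_homotopic X x y p q; path_homotopic X x y q r\<rbrakk> \<Longrightarrow> path_homotopic X x y p r"
  unfolding path_homotopic_def by (rule homotopic_with_trans)

lemma path_homotopic_imp_pathin:
  assumes "path_homotopic X x y p q"
  shows "pathin X p" "pathin X q" "p 0 = x" "p 1 = y" "q 0 = x" "q 1 = y"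
  using homotopic_with_imp_continuous_maps[OF assms[unfolded path_homotopic_def]]
    homotopic_with_imp_property[OF assms[unfolded path_homotopic_def]]
  by (auto simp: pathin_def)

lemma path_homotopic_compose:
  assumes "path_homotopic X x y p q" "continuous_map X Y f"
  shows "path_homotopic Y (f x) (f y) (f \<circ> p) (f \<circ> q)"
  using assms(1)
proof (rule path_homotopicE)
  fix h :: "real \<times> real \<Rightarrow> 'a"
  assume h: "continuous_map (top_of_set ({0..1} \<times> {0..1})) X h"
    "\<And>t. t \<in> {0..1} \<Longrightarrow> h (0, t) = p t" "\<And>t. t \<in> {0..1} \<Longrightarrow> h (1, t) = q t"
    "\<And>s. s \<in> {0..1} \<Longrightarrow> h (s, 0) = x" "\<And>s. s \<in> {0..1} \<Longrightarrow> h (s, 1) = y"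
  show ?thesis
    by (rule path_homotopicI[OF continuous_map_compose[OF h(1) assms(2)]]) (simp_all add: h)
qed

lemma path_homotopic_subtopologyD:
  "path_homotopic (subtopology X U) x y p q \<Longrightarrow> path_homotopic X x y p q"
  unfolding path_homotopic_def homotopic_with_def
  by (meson continuous_map_into_fulltopology)

section \<open>Continuity on Euclidean domains, reparametrization and joining of paths\<close>

text \<open>Separates the inner map between Euclidean sets, whose continuity
  \<open>continuous_intros\<close> can settle, from the outer map into an abstract space.\<close>

lemma continuous_map_compose_euclidean:
  assumes "continuous_map (top_of_set B) X h" "continuous_on A f" "f ` A \<subseteq> B"
  shows "continuous_map (top_of_set A) X (\<lambda>z. h (f z))"
proof -
  have "continuous_map (top_of_set A) (top_of_set B) f"
    using assms by (auto simp: continuous_map_in_subtopology)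
  from continuous_map_compose[OF this assms(1)] show ?thesis
    by (simp add: o_def)
qed

text \<open>The preimage of a closed set is a union of two sets, each closed in the whole space
  because \<open>A\<close> and \<open>B\<close> are.\<close>

lemma continuous_map_paste_closed:
  assumes "continuous_map (top_of_set A) X f" "continuous_map (top_of_set B) X g"
    and "closed A" "closed B" and "\<And>z. z \<in> A \<inter> B \<Longrightarrow> f z = g z"
  shows "continuous_map (top_of_set (A \<union> B)) X (\<lambda>z. if z \<in> A then f z else g z)"
    (is "continuous_map _ _ ?h")
proof -
  have "closedin (top_of_set (A \<union> B)) {z \<in> A \<union> B. ?h z \<in> C}" if C: "closedin X C" for C
  proof -
    have "closed {z \<in> A. f z \<in> C}" "closed {z \<in> B. g z \<in> C}"
      using assms C by (auto simp: continuous_map_closedin closedin_closed_eq)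
    moreover have "{z \<in> A \<union> B. ?h z \<in> C} = {z \<in> A. f z \<in> C} \<union> {z \<in> B. g z \<in> C}"
      using assms(5) by auto
    ultimately show ?thesis
      using assms(3,4) by (simp only: closedin_closed_eq closed_Un) auto
  qed
  then show ?thesis
    using assms(1,2) by (auto simp: continuous_map_closedin Pi_iff)
qed

text \<open>The segment from \<open>\<phi> t\<close> to \<open>\<psi> t\<close> stays in the unit
  interval by convexity and is constant at both ends of time; \<open>p\<close> carries it into
  \<open>X\<close>.\<close>

lemma path_homotopic_reparam:
  assumes p: "pathin X p" and c: "continuous_on {0..1} \<phi>" "continuous_on {0..1} \<psi>"
    and i: "\<phi> ` {0..1} \<subseteq> {0..1}" "\<psi> ` {0..1} \<subseteq> {0..1}"
    and e: "\<phi> 0 = a" "\<psi> 0 = a" "\<phi> 1 = b" "\<psi> 1 = b"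
  shows "path_homotopic X (p a) (p b) (\<lambda>t. p (\<phi> t)) (\<lambda>t. p (\<psi> t))"
proof -
  have "continuous_map (top_of_set ({0..1} \<times> {0..1})) X
          (\<lambda>z. p ((1 - fst z) * \<phi> (snd z) + fst z * \<psi> (snd z)))"
  proof (rule continuous_map_compose_euclidean[OF p[unfolded pathin_def]])
    have "continuous_on ({0..1} \<times> {0..1}) (\<lambda>z::real \<times> real. \<phi> (snd z))"
      by (rule continuous_on_compose2[OF c(1)]) (auto intro!: continuous_intros)
    moreover have "continuous_on ({0..1} \<times> {0..1}) (\<lambda>z::real \<times> real. \<psi> (snd z))"
      by (rule continuous_on_compose2[OF c(2)]) (auto intro!: continuous_intros)
    ultimately show "continuous_on ({0..1} \<times> {0..1})
        (\<lambda>z. (1 - fst z) * \<phi> (snd z) + fst z * \<psi> (snd z))"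
      by (intro continuous_intros)
    show "(\<lambda>z. (1 - fst z) * \<phi> (snd z) + fst z * \<psi> (snd z)) ` ({0..1} \<times> {0..1}) \<subseteq> {0..1}"
    proof safe
      fix s t :: real assume st: "s \<in> {0..1}" "t \<in> {0..1}"
      then have "\<phi> t \<in> {0..1}" "\<psi> t \<in> {0..1}" using i by blast+
      then have "(1 - s) *\<^sub>R \<phi> t + s *\<^sub>R \<psi> t \<in> {0..1}"
        using st by (intro convexD[OF convex_real_interval(5)]) auto
      then show "(1 - fst (s, t)) * \<phi> (snd (s, t)) + fst (s, t) * \<psi> (snd (s, t)) \<in> {0..1}"
        by simp
    qed
  qed
  then show ?thesis
    by (rule path_homotopicI) (auto simp: e algebra_simps)
qed

lemma loop_join_0 [simp]: "loop_join p q 0 = p 0" and loop_join_1 [simp]: "loop_join p q 1 = q 1"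
  by (auto simp: loop_join_def)

text \<open>The two homotopies are placed side by side in the time direction. They fit at time 1/2,
  where both are constantly \<open>y\<close>.\<close>

lemma path_homotopic_join:
  assumes "path_homotopic X x y p p'" "path_homotopic X y z q q'"
  shows "path_homotopic X x z (loop_join p q) (loop_join p' q')"
  using assms(1)
proof (rule path_homotopicE)
  fix h :: "real \<times> real \<Rightarrow> 'a"
  assume h: "continuous_map (top_of_set ({0..1} \<times> {0..1})) X h"
    "\<And>t. t \<in> {0..1} \<Longrightarrow> h (0, t) = p t" "\<And>t. t \<in> {0..1} \<Longrightarrow> h (1, t) = p' t"
    "\<And>s. s \<in> {0..1} \<Longrightarrow> h (s, 0) = x" "\<And>s. s \<in> {0..1} \<Longrightarrow> h (s, 1) = y"
  obtain k :: "real \<times> real \<Rightarrow> 'a" where k: "continuous_map (top_of_set ({0..1} \<times> {0..1})) X k"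
    "\<And>t. t \<in> {0..1} \<Longrightarrow> k (0, t) = q t" "\<And>t. t \<in> {0..1} \<Longrightarrow> k (1, t) = q' t"
    "\<And>s. s \<in> {0..1} \<Longrightarrow> k (s, 0) = y" "\<And>s. s \<in> {0..1} \<Longrightarrow> k (s, 1) = z"
    using assms(2) by (rule path_homotopicE) blast
  define A B where "A = {0..1::real} \<times> {0..1/2::real}" and "B = {0..1::real} \<times> {1/2..1::real}"
  have "continuous_map (top_of_set (A \<union> B)) X
     (\<lambda>w. if w \<in> A then h (fst w, 2 * snd w) else k (fst w, 2 * snd w - 1))"
  proof (rule continuous_map_paste_closed)
    show "continuous_map (top_of_set A) X (\<lambda>w. h (fst w, 2 * snd w))"
      by (rule continuous_map_compose_euclidean[OF h(1)])
        (auto simp: A_def intro!: continuous_intros)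
    show "continuous_map (top_of_set B) X (\<lambda>w. k (fst w, 2 * snd w - 1))"
      by (rule continuous_map_compose_euclidean[OF k(1)])
        (auto simp: B_def intro!: continuous_intros)
    show "closed A" "closed B"
      by (auto simp: A_def B_def intro!: closed_Times)
    fix w assume "w \<in> A \<inter> B"
    then have "2 * snd w = 1" "fst w \<in> {0..1}" by (auto simp: A_def B_def)
    then show "h (fst w, 2 * snd w) = k (fst w, 2 * snd w - 1)"
      using h(5)[of "fst w"] k(4)[of "fst w"] by simp
  qed
  moreover have "A \<union> B = {0..1} \<times> {0..1}"
    by (auto simp: A_def B_def)
  ultimately show ?thesis
    by (intro path_homotopicI[where h = "\<lambda>w. if w \<in> A then h (fst w, 2 * snd w) else k (fst w, 2 * snd w - 1)"])
      (auto simp: loop_join_def A_def h k)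
qed

text \<open>Joining the constant homotopies of \<open>p\<close> and \<open>q\<close> yields a
  homotopy that starts at the joined path, and continuity of its start comes for free.\<close>

lemma pathin_join:
  assumes "pathin X p" "pathin X q" "p 1 = q 0"
  shows "pathin X (loop_join p q)"
  using path_homotopic_join[OF path_homotopic_refl[OF assms(1)], of "q 1" q q]
    path_homotopic_refl[OF assms(2)] assms(3) path_homotopic_imp_pathin(1) by fastforce

lemma loop_join_comp: "f \<circ> loop_join p q = loop_join (f \<circ> p) (f \<circ> q)"
  by (auto simp: loop_join_def)

section \<open>Pieces of a path and associativity up to homotopy\<close>

text \<open>No order between \<open>a\<close> and \<open>b\<close> is fixed: for
  \<open>b < a\<close> the piece is run backwards, so that times on both sides of a given time are
  treated alike.\<close>

definition subpath_of :: "(real \<Rightarrow> 'a) \<Rightarrow> real \<Rightarrow> real \<Rightarrow> real \<Rightarrow> 'a" where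
  "subpath_of p a b = (\<lambda>t. p (a + (b - a) * t))"

lemma subpath_of_0 [simp]: "subpath_of p a b 0 = p a"
  and subpath_of_1 [simp]: "subpath_of p a b 1 = p b"
  and subpath_of_0_1 [simp]: "subpath_of p 0 1 = p"
  by (auto simp: subpath_of_def)

lemma linear_in_Icc:
  assumes "a \<in> {c..d}" "b \<in> {c..d}" "t \<in> {0..1::real}"
  shows "a + (b - a) * t \<in> {c..d}"
proof -
  have "(1 - t) *\<^sub>R a + t *\<^sub>R b \<in> {c..d}"
    using assms by (intro convexD[OF convex_real_interval(5)]) auto
  then show ?thesis by (simp add: algebra_simps)
qed

lemma pathin_subpath_of:
  assumes "pathin X p" "a \<in> {0..1}" "b \<in> {0..1}"
  shows "pathin X (subpath_of p a b)"
  unfolding pathin_def subpath_of_def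
proof (rule continuous_map_compose_euclidean[OF assms(1)[unfolded pathin_def]])
  show "(\<lambda>t. a + (b - a) * t) ` {0..1} \<subseteq> {0..1}"
    using linear_in_Icc[OF assms(2,3)] by blast
qed (intro continuous_intros)

text \<open>Both sides are \<open>p\<close> after a parameter that runs from \<open>a\<close> to
  \<open>c\<close>, once along a broken line through \<open>b\<close> and once straight.\<close>

lemma path_homotopic_subpath_join:
  assumes p: "pathin X p" and abc: "a \<in> {0..1}" "b \<in> {0..1}" "c \<in> {0..1}"
  shows "path_homotopic X (p a) (p c)
           (loop_join (subpath_of p a b) (subpath_of p b c)) (subpath_of p a c)"
proof -
  \<comment> \<open>The broken line through \<open>a\<close>, \<open>b\<close>, \<open>c\<close>,
    written with \<open>min\<close> and \<open>max\<close> so that its continuity needs no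
    cases.\<close>
  define \<phi> where "\<phi> t = a + (b - a) * min 1 (2 * t) + (c - b) * max 0 (2 * t - 1)" for t
  have \<phi>: "\<phi> t = (if t \<le> 1/2 then a + (b - a) * (2 * t) else b + (c - b) * (2 * t - 1))" for t
    by (cases "t \<le> 1/2") (simp_all add: \<phi>_def)
  have "path_homotopic X (p a) (p c) (\<lambda>t. p (\<phi> t)) (\<lambda>t. p (a + (c - a) * t))"
  proof (rule path_homotopic_reparam[OF p])
    show "continuous_on {0..1} \<phi>"
      unfolding \<phi>_def by (intro continuous_intros)
    show "\<phi> ` {0..1} \<subseteq> {0..1}"
    proof safe
      fix t :: real assume "t \<in> {0..1}"
      then show "\<phi> t \<in> {0..1}"
        using linear_in_Icc[OF abc(1,2), of "2 * t"] linear_in_Icc[OF abc(2,3), of "2 * t - 1"]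
        by (auto simp: \<phi>)
    qed
    show "(\<lambda>t. a + (c - a) * t) ` {0..1} \<subseteq> {0..1}"
      using linear_in_Icc[OF abc(1,3)] by blast
  qed (auto simp: \<phi> intro!: continuous_intros)
  moreover have "(\<lambda>t. p (\<phi> t)) = loop_join (subpath_of p a b) (subpath_of p b c)"
    by (auto simp: \<phi> loop_join_def subpath_of_def)
  ultimately show ?thesis
    by (simp add: subpath_of_def)
qed

text \<open>Both bracketings cut one path \<open>u\<close> at the times 1/2 and 3/4. Merging the
  pieces from the left gives back \<open>u\<close>, which is the right-hand bracketing
  itself.\<close>

lemma path_homotopic_assoc:
  assumes p: "pathin X p" "p 0 = x" "p 1 = y" and q: "pathin X q" "q 0 = y" "q 1 = z"
    and r: "pathin X r" "r 0 = z" "r 1 = w"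
  shows "path_homotopic X x w (loop_join (loop_join p q) r) (loop_join p (loop_join q r))"
proof -
  define u where "u = loop_join p (loop_join q r)"
  have u: "pathin X u"
    unfolding u_def using assms by (intro pathin_join) auto
  have [simp]: "u 0 = x" "u (1/2) = y" "u (3/4) = z" "u 1 = w"
    using assms by (auto simp: u_def loop_join_def)
  have eqs: "p t = subpath_of u 0 (1/2) t" "q t = subpath_of u (1/2) (3/4) t"
    "r t = subpath_of u (3/4) 1 t" if "t \<in> {0..1}" for t
    using that assms by (auto simp: u_def loop_join_def subpath_of_def)
  \<comment> \<open>Paths are functions on all reals; \<open>p\<close>, \<open>q\<close>,
    \<open>r\<close> agree with the pieces of \<open>u\<close> only on the unit interval, which
    suffices up to homotopy.\<close>
  have same: "path_homotopic X (f 0) (f 1) f g" if "pathin X f" "\<And>t. t \<in> {0..1} \<Longrightarrow> f t = g t" for f g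
    using that unfolding path_homotopic_def pathin_def
    by (intro homotopic_with_equal) auto
  have P: "path_homotopic X x y p (subpath_of u 0 (1/2))"
    and Q: "path_homotopic X y z q (subpath_of u (1/2) (3/4))"
    and R: "path_homotopic X z w r (subpath_of u (3/4) 1)"
    using same[OF p(1) eqs(1)] same[OF q(1) eqs(2)] same[OF r(1) eqs(3)] assms by simp_all
  have "path_homotopic X x z (loop_join p q) (subpath_of u 0 (3/4))"
    using path_homotopic_trans[OF path_homotopic_join[OF P Q]]
      path_homotopic_subpath_join[OF u, of 0 "1/2" "3/4"] by simp
  from path_homotopic_join[OF this R]
  have "path_homotopic X x w (loop_join (loop_join p q) r) (subpath_of u 0 1)"
    using path_homotopic_subpath_join[OF u, of 0 "3/4" 1]
    by (auto intro: path_homotopic_trans)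
  then show ?thesis by (simp add: u_def)
qed

lemma pathin_const: "x \<in> topspace X \<Longrightarrow> pathin X (\<lambda>_. x)"
  by (simp add: pathin_def)

lemma pathin_reversed: "pathin X p \<Longrightarrow> pathin X (\<lambda>t. p (1 - t))"
  unfolding pathin_def
  by (rule continuous_map_compose_euclidean) (auto intro!: continuous_intros)

text \<open>A null homotopy of the loop \<open>p\<close> followed by the reverse of \<open>q\<close> is a map on the square that is
  constant on all edges but one. Moving a point from one end of that edge to the other along the
  three constant edges and joining it by segments to the midpoint of the edge deforms \<open>p\<close>
  into \<open>q\<close>.\<close>

lemma path_homotopic_of_null_homotopic:
  assumes pq: "p 0 = x" "p 1 = y" "q 0 = x" "q 1 = y"
    and null: "path_homotopic X x x (loop_join p (\<lambda>t. q (1 - t))) (\<lambda>_. x)"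
  shows "path_homotopic X x y p q"
  using null
proof (rule path_homotopicE)
  fix h :: "real \<times> real \<Rightarrow> 'a"
  assume h: "continuous_map (top_of_set ({0..1} \<times> {0..1})) X h"
    "\<And>t. t \<in> {0..1} \<Longrightarrow> h (0, t) = loop_join p (\<lambda>t. q (1 - t)) t"
    "\<And>t. t \<in> {0..1} \<Longrightarrow> h (1, t) = x"
    "\<And>s. s \<in> {0..1} \<Longrightarrow> h (s, 0) = x" "\<And>s. s \<in> {0..1} \<Longrightarrow> h (s, 1) = x"
  \<comment> \<open>The point \<open>(\<gamma> s, \<delta> s)\<close> spends one third of its time
    on each edge of the way from (0, 0) over (1, 0) and (1, 1) to (0, 1).\<close>
  define \<gamma> \<delta> :: "real \<Rightarrow> real" where
    "\<gamma> s = min 1 (min (3 * s) (3 - 3 * s))" and "\<delta> s = max 0 (min 1 (3 * s - 1))" for s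
  have in01: "\<gamma> s \<in> {0..1}" "\<delta> s \<in> {0..1}" if "s \<in> {0..1}" for s
    using that by (auto simp: \<gamma>_def \<delta>_def)
  have edge: "\<delta> s = 0 \<or> \<delta> s = 1 \<or> \<gamma> s = 1" if "s \<in> {0..1}" for s
    using that by (auto simp: \<gamma>_def \<delta>_def min_def max_def)
  have "continuous_map (top_of_set ({0..1} \<times> {0..1})) X
      (\<lambda>z. h ((1 - snd z) * \<gamma> (fst z), (1 - snd z) * \<delta> (fst z) + snd z / 2))"
  proof (rule continuous_map_compose_euclidean[OF h(1)])
    show "continuous_on ({0..1} \<times> {0..1})
        (\<lambda>z. ((1 - snd z) * \<gamma> (fst z), (1 - snd z) * \<delta> (fst z) + snd z / 2))"
      unfolding \<gamma>_def \<delta>_def by (intro continuous_intros) auto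
    show "(\<lambda>z. ((1 - snd z) * \<gamma> (fst z), (1 - snd z) * \<delta> (fst z) + snd z / 2)) `
        ({0..1} \<times> {0..1}) \<subseteq> {0..1} \<times> {0..1}"
    proof (rule image_subsetI)
      fix z :: "real \<times> real" assume "z \<in> {0..1} \<times> {0..1}"
      then obtain s t where z: "z = (s, t)" and st: "s \<in> {0..1}" "t \<in> {0..1}" by blast
      have "\<gamma> s + (0 - \<gamma> s) * t \<in> {0..1}" "\<delta> s + (1/2 - \<delta> s) * t \<in> {0..1}"
        using linear_in_Icc[OF in01(1)[OF st(1)] _ st(2), of 0]
          linear_in_Icc[OF in01(2)[OF st(1)] _ st(2), of "1/2"] by auto
      then show "((1 - snd z) * \<gamma> (fst z), (1 - snd z) * \<delta> (fst z) + snd z / 2) \<in> {0..1} \<times> {0..1}"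
        by (simp add: z algebra_simps)
    qed
  qed
  then show ?thesis
  proof (rule path_homotopicI)
    fix t :: real assume "t \<in> {0..1}"
    then show "h ((1 - snd (0, t)) * \<gamma> (fst (0, t)), (1 - snd (0, t)) * \<delta> (fst (0, t)) + snd (0, t) / 2) = p t"
      by (simp add: \<gamma>_def \<delta>_def h loop_join_def)
  next
    fix t :: real assume t: "t \<in> {0..1}"
    \<comment> \<open>At \<open>t = 1\<close> the time 1/2 belongs to the first half of
      \<open>loop_join\<close>, whose value there is \<open>p 1\<close>, equal to
      \<open>q 1\<close>.\<close>
    have "h (0, 1 - t / 2) = q t"
      using t pq by (subst h) (auto simp: loop_join_def)
    then show "h ((1 - snd (1, t)) * \<gamma> (fst (1, t)), (1 - snd (1, t)) * \<delta> (fst (1, t)) + snd (1, t) / 2) = q t"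
      by (simp add: \<gamma>_def \<delta>_def)
  next
    fix s :: real assume s: "s \<in> {0..1}"
    then show "h ((1 - snd (s, 0)) * \<gamma> (fst (s, 0)), (1 - snd (s, 0)) * \<delta> (fst (s, 0)) + snd (s, 0) / 2) = x"
      using in01[OF s] edge[OF s] by (auto simp: h)
  next
    fix s :: real assume "s \<in> {0..1}"
    then show "h ((1 - snd (s, 1)) * \<gamma> (fst (s, 1)), (1 - snd (s, 1)) * \<delta> (fst (s, 1)) + snd (s, 1) / 2) = y"
      by (simp add: h loop_join_def pq)
  qed
qed

text \<open>The definition speaks of loops only. It makes \<open>p\<close> followed by the reverse
  of \<open>q\<close> null homotopic, and the preceding lemma turns this into a homotopy of
  paths.\<close>

lemma simply_connected_path_homotopic:
  assumes "simply_connected_space X" and p: "pathin X p" "p 0 = x" "p 1 = y"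
    and q: "pathin X q" "q 0 = x" "q 1 = y"
  shows "path_homotopic X x y p q"
proof -
  let ?l = "loop_join p (\<lambda>t. q (1 - t))"
  have x: "x \<in> topspace X"
    using p by (auto simp: pathin_def continuous_map_def Pi_iff)
  have l: "pathin X ?l"
    using assms by (intro pathin_join pathin_reversed) auto
  have "trivial_group (fundamental_group X x)"
    using assms(1) x by (simp add: simply_connected_space_def)
  moreover have "?l \<in> loops X x"
    using l assms by (simp add: loops_def)
  ultimately have "loop_class X x ?l = loop_class X x (\<lambda>_. x)"
    by (auto simp: trivial_group_def fundamental_group_def)
  moreover have "(\<lambda>_. x) \<in> loop_class X x (\<lambda>_. x)"
    using path_homotopic_refl[OF pathin_const[OF x]] by (simp add: loop_class_eq)
  ultimately have "path_homotopic X x x ?l (\<lambda>_. x)"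
    by (auto simp: loop_class_eq)
  then show ?thesis
    using assms by (blast intro: path_homotopic_of_null_homotopic)
qed

text \<open>The homotopy squeezes the path \<open>p\<close> into the midpoint of the unit interval, where the value
  can be replaced by \<open>x\<close> because every neighbourhood of \<open>x\<close> contains the whole image.\<close>

lemma path_homotopic_squeeze:
  assumes p: "pathin X p" and x: "x \<in> topspace X"
    and U: "\<And>W. openin X W \<Longrightarrow> x \<in> W \<Longrightarrow> p ` {0..1} \<subseteq> W"
  shows "path_homotopic X (p 0) (p 1) (\<lambda>t. if t = 1/2 then x else if t < 1/2 then p 0 else p 1) p"
proof -
  define Q where "Q = {0..1::real} \<times> {0..1::real}"
  \<comment> \<open>Time is rescaled about 1/2. At height 1 the maximum is 1 and nothing changes; at
    height 0 the quotient is -1/2 or 1/2, so that \<open>\<phi>\<close> jumps from 0 to 1. The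
    factor 2 keeps the values in the unit interval, and the denominator vanishes only at
    \<open>(0, 1/2)\<close>.\<close>
  define \<phi> :: "real \<times> real \<Rightarrow> real" where
    "\<phi> z = 1/2 + (snd z - 1/2) / max (fst z) (2 * \<bar>snd z - 1/2\<bar>)" for z
  define K where "K z = (if z = (0, 1/2) then x else p (\<phi> z))" for z
  have pos: "max (fst z) (2 * \<bar>snd z - 1/2\<bar>) > 0" if "z \<in> Q - {(0, 1/2)}" for z
    using that by (cases z) (auto simp: Q_def less_max_iff_disj)
  have \<phi>01: "\<phi> z \<in> {0..1}" if "z \<in> Q - {(0, 1/2)}" for z
  proof -
    have "\<bar>(snd z - 1/2) / max (fst z) (2 * \<bar>snd z - 1/2\<bar>)\<bar> \<le> 1/2"
      using pos[OF that] by (simp add: field_simps)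
    then show ?thesis
      unfolding \<phi>_def atLeastAtMost_iff by linarith
  qed
  have pc: "continuous_map (top_of_set (Q - {(0, 1/2)})) X (\<lambda>z. p (\<phi> z))"
  proof (rule continuous_map_compose_euclidean[OF p[unfolded pathin_def]])
    show "continuous_on (Q - {(0, 1/2)}) \<phi>"
      unfolding \<phi>_def using pos by (intro continuous_intros ballI) (metis less_irrefl)
    show "\<phi> ` (Q - {(0, 1/2)}) \<subseteq> {0..1}"
      using \<phi>01 by blast
  qed
  have pX: "p t \<in> topspace X" if "t \<in> {0..1}" for t
    using p that by (auto simp: pathin_def continuous_map_def Pi_iff)
  have KX: "K z \<in> topspace X" if "z \<in> Q" for z
    using that x pX \<phi>01 by (auto simp: K_def)
  \<comment> \<open>If \<open>W\<close> contains \<open>x\<close>, the preimage is the whole square.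
    Otherwise it misses the exceptional point, away from which \<open>K\<close> is \<open>p\<close>
    after \<open>\<phi>\<close>.\<close>
  have "openin (top_of_set Q) {z \<in> Q. K z \<in> W}" if W: "openin X W" for W
  proof (cases "x \<in> W")
    case True
    then have "p t \<in> W" if "t \<in> {0..1}" for t
      using U[OF W] that by blast
    then have "{z \<in> Q. K z \<in> W} = Q"
      using True \<phi>01 by (auto simp: K_def)
    then show ?thesis by simp
  next
    case False
    then have "{z \<in> Q. K z \<in> W} = {z \<in> Q - {(0, 1/2)}. p (\<phi> z) \<in> W}"
      by (auto simp: K_def)
    moreover have "openin (top_of_set (Q - {(0, 1/2)})) {z \<in> Q - {(0, 1/2)}. p (\<phi> z) \<in> W}"
      using pc W by (auto simp: continuous_map_def)
    moreover have "openin (top_of_set Q) (Q - {(0, 1/2)})"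
      by (simp add: openin_delete)
    ultimately show ?thesis
      by (simp only: openin_trans)
  qed
  then have "continuous_map (top_of_set Q) X K"
    using KX by (auto simp: continuous_map_def)
  then show ?thesis
    unfolding Q_def
  proof (rule path_homotopicI)
    fix t :: real assume t: "t \<in> {0..1}"
    show "K (0, t) = (if t = 1/2 then x else if t < 1/2 then p 0 else p 1)"
    proof (cases "t = 1/2")
      case False
      then have "(t - 1/2) / (2 * \<bar>t - 1/2\<bar>) = (if t < 1/2 then - 1/2 else 1/2)"
        by (simp add: abs_if field_simps)
      then have "\<phi> (0, t) = (if t < 1/2 then 0 else 1)"
        by (simp add: \<phi>_def)
      then show ?thesis
        using False by (simp add: K_def)
    qed (simp add: K_def)
    have "max 1 (2 * \<bar>t - 1/2\<bar>) = 1"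
      using t by (simp add: abs_if)
    then show "K (1, t) = p t"
      by (simp add: K_def \<phi>_def)
  next
    fix s :: real assume "s \<in> {0..1}"
    then have "max s 1 = 1" by simp
    then show "K (s, 0) = p 0" "K (s, 1) = p 1"
      by (simp_all add: K_def \<phi>_def)
  qed
qed

text \<open>Both paths are homotopic to the same squeezed path, which depends only on
  \<open>x\<close> and the two ends.\<close>

lemma path_homotopic_in_minimal_open:
  assumes x: "x \<in> topspace X" and U: "\<And>W. openin X W \<Longrightarrow> x \<in> W \<Longrightarrow> U \<subseteq> W"
    and p: "pathin X p" "p ` {0..1} \<subseteq> U" and q: "pathin X q" "q ` {0..1} \<subseteq> U"
    and eq: "p 0 = q 0" "p 1 = q 1"
  shows "path_homotopic X (p 0) (p 1) p q"
proof -
  have "path_homotopic X (p 0) (p 1) (\<lambda>t. if t = 1/2 then x else if t < 1/2 then p 0 else p 1) p"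
    by (rule path_homotopic_squeeze[OF p(1) x]) (use U p in blast)
  moreover have "path_homotopic X (q 0) (q 1) (\<lambda>t. if t = 1/2 then x else if t < 1/2 then q 0 else q 1) q"
    by (rule path_homotopic_squeeze[OF q(1) x]) (use U q in blast)
  ultimately show ?thesis
    unfolding eq by (rule path_homotopic_trans[OF path_homotopic_sym])
qed


section \<open>Local systems and monodromy\<close>

text \<open>Continuity in metric form on the domain side, the shape in which the local hypothesis of
  \<open>Bolzano\<close> asks for it.\<close>

lemma pathin_nhds:
  assumes "pathin Y c" "openin Y W" "t \<in> {0..1}" "c t \<in> W"
  obtains d where "d > 0" "\<And>u. u \<in> {0..1} \<Longrightarrow> \<bar>u - t\<bar> < d \<Longrightarrow> c u \<in> W"
proof -
  have "openin (top_of_set {0..1}) {u \<in> {0..1}. c u \<in> W}"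
    using assms by (simp add: pathin_def continuous_map_def)
  then obtain d where "d > 0" "\<And>u. u \<in> {0..1} \<Longrightarrow> dist u t < d \<Longrightarrow> u \<in> {u \<in> {0..1}. c u \<in> W}"
    using assms(3,4) unfolding openin_euclidean_subtopology_iff by (metis (mono_tags, lifting) mem_Collect_eq)
  then show ?thesis
    by (intro that[of d]) (auto simp: dist_real_def)
qed

lemma square_nhds:
  fixes h :: "real \<times> real \<Rightarrow> 'a"
  assumes "continuous_map (top_of_set ({0..1} \<times> {0..1})) Y h" "openin Y W"
    and "s \<in> {0..1}" "t \<in> {0..1}" "h (s, t) \<in> W"
  obtains d where "d > 0"
    "\<And>u v. u \<in> {0..1} \<Longrightarrow> v \<in> {0..1} \<Longrightarrow> \<bar>u - s\<bar> < d \<Longrightarrow> \<bar>v - t\<bar> < d \<Longrightarrow> h (u, v) \<in> W"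
proof -
  have "openin (top_of_set ({0..1} \<times> {0..1})) {z \<in> {0..1} \<times> {0..1}. h z \<in> W}"
    using assms by (simp add: continuous_map_def)
  then obtain d where d: "d > 0"
    "\<And>z. z \<in> {0..1} \<times> {0..1} \<Longrightarrow> dist z (s, t) < d \<Longrightarrow> z \<in> {z \<in> {0..1} \<times> {0..1}. h z \<in> W}"
    using assms(3-5) unfolding openin_euclidean_subtopology_iff
    by (metis (mono_tags, lifting) mem_Collect_eq mem_Sigma_iff)
  show ?thesis
  \<comment> \<open>The distance in the plane is at most the sum of the coordinate distances, so
    half of the radius \<open>d\<close> suffices for each.\<close>
  proof (rule that[of "d / 2"])
    fix u v assume uv: "u \<in> {0..1}" "v \<in> {0..1}" "\<bar>u - s\<bar> < d / 2" "\<bar>v - t\<bar> < d / 2"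
    have "dist (u, v) (s, t) \<le> dist u s + dist v t"
      unfolding dist_Pair_Pair by (rule sqrt_sum_squares_le_sum) auto
    also have "\<dots> < d"
      using uv by (simp add: dist_real_def)
    finally show "h (u, v) \<in> W"
      using d(2)[of "(u, v)"] uv by simp
  qed (use d in simp)
qed

text \<open>A covering of \<open>Y\<close> without its total space. Sets of the base are evenly
  covered, and \<open>\<tau> V x y\<close> moves from the fibre at \<open>x\<close> to the fibre at
  \<open>y\<close> along the sheets over \<open>V\<close>. Transports over two overlapping sets are
  tied together only on basic sets inside both, which leaves room for nontrivial monodromy.\<close>

locale local_system =
  fixes Y :: "'y topology" and B :: "'y set set" and F :: "'y \<Rightarrow> 'f set"
    and \<tau> :: "'y set \<Rightarrow> 'y \<Rightarrow> 'y \<Rightarrow> 'f \<Rightarrow> 'f"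
  assumes base_open: "V \<in> B \<Longrightarrow> openin Y V"
    and base: "openin Y W \<Longrightarrow> y \<in> W \<Longrightarrow> \<exists>V\<in>B. y \<in> V \<and> V \<subseteq> W"
    and transport_mem: "V \<in> B \<Longrightarrow> x \<in> V \<Longrightarrow> y \<in> V \<Longrightarrow> f \<in> F x \<Longrightarrow> \<tau> V x y f \<in> F y"
    and transport_refl: "V \<in> B \<Longrightarrow> x \<in> V \<Longrightarrow> f \<in> F x \<Longrightarrow> \<tau> V x x f = f"
    and transport_trans: "V \<in> B \<Longrightarrow> x \<in> V \<Longrightarrow> y \<in> V \<Longrightarrow> z \<in> V \<Longrightarrow> f \<in> F x \<Longrightarrow>
      \<tau> V y z (\<tau> V x y f) = \<tau> V x z f"
    and transport_mono: "V \<in> B \<Longrightarrow> N \<in> B \<Longrightarrow> N \<subseteq> V \<Longrightarrow> x \<in> N \<Longrightarrow> y \<in> N \<Longrightarrow> f \<in> F x \<Longrightarrow>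
      \<tau> N x y f = \<tau> V x y f"
begin

text \<open>\<open>e\<close> is a continuous lift of the curve \<open>c\<close>: near each time it
  stays on one sheet. The interval is a parameter so that lifts can be built by bisection.\<close>

definition flat :: "(real \<Rightarrow> 'y) \<Rightarrow> (real \<Rightarrow> 'f) \<Rightarrow> real \<Rightarrow> real \<Rightarrow> bool" where
  "flat c e a b \<longleftrightarrow> (\<forall>t\<in>{a..b}. e t \<in> F (c t) \<and>
     (\<forall>V\<in>B. c t \<in> V \<longrightarrow>
        (\<exists>d>0. \<forall>u\<in>{a..b}. \<bar>u - t\<bar> < d \<longrightarrow> c u \<in> V \<and> e u = \<tau> V (c t) (c u) (e t))))"

lemma flat_mem: "flat c e a b \<Longrightarrow> t \<in> {a..b} \<Longrightarrow> e t \<in> F (c t)"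
  by (simp add: flat_def)

lemma flatE:
  assumes "flat c e a b" "t \<in> {a..b}" "V \<in> B" "c t \<in> V"
  obtains d where "d > 0"
    "\<And>u. u \<in> {a..b} \<Longrightarrow> \<bar>u - t\<bar> < d \<Longrightarrow> c u \<in> V \<and> e u = \<tau> V (c t) (c u) (e t)"
  using assms unfolding flat_def by blast

lemma flat_subset: "flat c e a b \<Longrightarrow> {a'..b'} \<subseteq> {a..b} \<Longrightarrow> flat c e a' b'"
  unfolding flat_def by (meson subsetD)

lemma base_Int:
  assumes "V \<in> B" "W \<in> B" "y \<in> V" "y \<in> W"
  obtains N where "N \<in> B" "y \<in> N" "N \<subseteq> V" "N \<subseteq> W"
  using base[of "V \<inter> W" y] base_open assms by auto

lemma transport_local:
  assumes "V \<in> B" "W \<in> B" "N \<in> B" "N \<subseteq> V" "N \<subseteq> W" "x \<in> N" "y \<in> N" "f \<in> F x"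
  shows "\<tau> V x y f = \<tau> W x y f"
  using assms transport_mono by metis

text \<open>Flatness relates all times close to \<open>t\<close> through \<open>t\<close>, and
  transitivity of transport adds up adjacent intervals.\<close>

lemma flat_within:
  assumes fl: "flat c e a b" and "a \<le> b" and V: "V \<in> B" "c ` {a..b} \<subseteq> V"
  shows "e b = \<tau> V (c a) (c b) (e a)"
proof -
  \<comment> \<open>The local hypothesis of \<open>Bolzano\<close> also concerns intervals that
    stick out of \<open>{a..b}\<close>; the guard, trivial for the whole interval, excludes
    them.\<close>
  have "a \<le> a \<and> b \<le> b \<longrightarrow> e b = \<tau> V (c a) (c b) (e a)"
    using \<open>a \<le> b\<close>
  proof (induction rule: Bolzano[where P = "\<lambda>u v. a \<le> u \<and> v \<le> b \<longrightarrow> e v = \<tau> V (c u) (c v) (e u)"])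
    case (trans u v w)
    show ?case
    proof
      assume *: "a \<le> u \<and> w \<le> b"
      then have "e v = \<tau> V (c u) (c v) (e u)" "e w = \<tau> V (c v) (c w) (e v)"
        using trans by auto
      moreover have "c u \<in> V" "c v \<in> V" "c w \<in> V" "e u \<in> F (c u)"
        using V * trans(3,4) flat_mem[OF fl, of u] by auto
      ultimately show "e w = \<tau> V (c u) (c w) (e u)"
        using transport_trans[OF V(1), of "c u" "c v" "c w" "e u"] by metis
    qed
  next
    case (local t)
    then have t: "t \<in> {a..b}" "c t \<in> V" using V by auto
    obtain d where d: "d > 0"
      "\<And>u. u \<in> {a..b} \<Longrightarrow> \<bar>u - t\<bar> < d \<Longrightarrow> c u \<in> V \<and> e u = \<tau> V (c t) (c u) (e t)"
      by (rule flatE[OF fl t(1) V(1) t(2)]) blast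
    have "e v = \<tau> V (c u) (c v) (e u)" if "a \<le> u" "u \<le> t" "t \<le> v" "v \<le> b" "v - u < d" for u v
    proof -
      have "e u = \<tau> V (c t) (c u) (e t)" "e v = \<tau> V (c t) (c v) (e t)" "c u \<in> V" "c v \<in> V"
        using that d(2)[of u] d(2)[of v] by auto
      then show ?thesis
        using transport_trans[OF V(1) _ t(2), of "c u" "c v"] transport_trans[OF V(1) t(2), of "c u" "c v" "e t"]
          flat_mem[OF fl t(1)] by metis
    qed
    then show ?case
      using d(1) by (intro exI[of _ d]) auto
  qed
  then show ?thesis by simp
qed

section \<open>Uniqueness, gluing and existence of flat lifts\<close>

text \<open>Equality at one time spreads to all close times, because transport can be undone: it
  passes from \<open>u\<close> back to \<open>t\<close> and from there on to
  \<open>v\<close>.\<close>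

lemma flat_unique:
  assumes c: "c ` {a..b} \<subseteq> topspace Y"
    and fl: "flat c e a b" "flat c e' a b" and "a \<le> b" and eq: "e a = e' a"
  shows "e b = e' b"
proof -
  have "a \<le> a \<and> b \<le> b \<longrightarrow> e a = e' a \<longrightarrow> e b = e' b"
    using \<open>a \<le> b\<close>
  proof (induction rule: Bolzano[where P = "\<lambda>u v. a \<le> u \<and> v \<le> b \<longrightarrow> e u = e' u \<longrightarrow> e v = e' v"])
    case (trans u v w)
    then show ?case by auto
  next
    case (local t)
    then have t: "t \<in> {a..b}" by auto
    then have "c t \<in> topspace Y" using c by blast
    then obtain V where V: "V \<in> B" "c t \<in> V"
      using base[OF openin_topspace] by blast
    obtain d where d: "d > 0"
      "\<And>u. u \<in> {a..b} \<Longrightarrow> \<bar>u - t\<bar> < d \<Longrightarrow> c u \<in> V \<and> e u = \<tau> V (c t) (c u) (e t)"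
      by (rule flatE[OF fl(1) t V]) blast
    obtain d' where d': "d' > 0"
      "\<And>u. u \<in> {a..b} \<Longrightarrow> \<bar>u - t\<bar> < d' \<Longrightarrow> c u \<in> V \<and> e' u = \<tau> V (c t) (c u) (e' t)"
      by (rule flatE[OF fl(2) t V]) blast
    have "e v = e' v" if uv: "a \<le> u" "u \<le> t" "t \<le> v" "v \<le> b" "v - u < min d d'" "e u = e' u" for u v
    proof -
      have u: "e u = \<tau> V (c t) (c u) (e t)" "e' u = \<tau> V (c t) (c u) (e' t)" "c u \<in> V"
        and v: "e v = \<tau> V (c t) (c v) (e t)" "e' v = \<tau> V (c t) (c v) (e' t)" "c v \<in> V"
        using uv d(2)[of u] d'(2)[of u] d(2)[of v] d'(2)[of v] by auto
      have "e t = \<tau> V (c u) (c t) (e u)" "e' t = \<tau> V (c u) (c t) (e' u)"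
        using transport_trans[OF V u(3) V(2) flat_mem[OF fl(1) t]]
          transport_trans[OF V u(3) V(2) flat_mem[OF fl(2) t]]
          transport_refl[OF V flat_mem[OF fl(1) t]] transport_refl[OF V flat_mem[OF fl(2) t]] u(1,2)
        by metis+
      then show ?thesis
        using uv v by simp
    qed
    then show ?case
      using d(1) d'(1) by (intro exI[of _ "min d d'"]) auto
  qed
  then show ?thesis using eq by simp
qed

text \<open>Away from \<open>b\<close> the radius is cut down so that only one of the lifts is seen.
  At \<open>b\<close> both are seen, and they start from the same value.\<close>

lemma flat_glue:
  assumes "flat c e a b" "flat c e' b d" "e b = e' b" "a \<le> b" "b \<le> d"
  shows "flat c (\<lambda>t. if t \<le> b then e t else e' t) a d" (is "flat c ?e a d")
  unfolding flat_def
proof (intro ballI conjI impI)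
  fix t assume t: "t \<in> {a..d}"
  show "?e t \<in> F (c t)"
    using t assms flat_mem[OF assms(1)] flat_mem[OF assms(2)] by auto
  fix V assume V: "V \<in> B" "c t \<in> V"
  consider "t < b" | "t = b" | "t > b" by linarith
  then show "\<exists>r>0. \<forall>u\<in>{a..d}. \<bar>u - t\<bar> < r \<longrightarrow> c u \<in> V \<and> ?e u = \<tau> V (c t) (c u) (?e t)"
  proof cases
    case 1
    obtain r where r: "r > 0"
      "\<And>u. u \<in> {a..b} \<Longrightarrow> \<bar>u - t\<bar> < r \<Longrightarrow> c u \<in> V \<and> e u = \<tau> V (c t) (c u) (e t)"
      by (rule flatE[OF assms(1) _ V], use 1 t in simp, blast)
    have "c u \<in> V \<and> ?e u = \<tau> V (c t) (c u) (?e t)"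
      if u: "u \<in> {a..d}" "\<bar>u - t\<bar> < min r (b - t)" for u
    proof -
      have "u \<in> {a..b}" "\<bar>u - t\<bar> < r" "u \<le> b" using u by auto
      with r(2)[of u] show ?thesis using 1 by simp
    qed
    then show ?thesis
      using 1 r(1) by (intro exI[of _ "min r (b - t)"]) simp
  next
    case 2
    obtain r where r: "r > 0"
      "\<And>u. u \<in> {a..b} \<Longrightarrow> \<bar>u - t\<bar> < r \<Longrightarrow> c u \<in> V \<and> e u = \<tau> V (c t) (c u) (e t)"
      by (rule flatE[OF assms(1) _ V], use 2 t in simp, blast)
    obtain r' where r': "r' > 0"
      "\<And>u. u \<in> {b..d} \<Longrightarrow> \<bar>u - t\<bar> < r' \<Longrightarrow> c u \<in> V \<and> e' u = \<tau> V (c t) (c u) (e' t)"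
      by (rule flatE[OF assms(2) _ V], use assms(5) 2 t in simp, blast)
    have "c u \<in> V \<and> ?e u = \<tau> V (c t) (c u) (?e t)"
      if u: "u \<in> {a..d}" "\<bar>u - t\<bar> < min r r'" for u
    proof (cases "u \<le> b")
      case True
      then show ?thesis using r(2)[of u] u 2 by simp
    next
      case False
      then show ?thesis using r'(2)[of u] u 2 assms(3) by simp
    qed
    then show ?thesis
      using r(1) r'(1) by (intro exI[of _ "min r r'"]) simp
  next
    case 3
    obtain r where r: "r > 0"
      "\<And>u. u \<in> {b..d} \<Longrightarrow> \<bar>u - t\<bar> < r \<Longrightarrow> c u \<in> V \<and> e' u = \<tau> V (c t) (c u) (e' t)"
      by (rule flatE[OF assms(2) _ V], use 3 t in simp, blast)
    have "c u \<in> V \<and> ?e u = \<tau> V (c t) (c u) (?e t)"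
      if u: "u \<in> {a..d}" "\<bar>u - t\<bar> < min r (t - b)" for u
    proof -
      have "u \<in> {b..d}" "\<bar>u - t\<bar> < r" "\<not> u \<le> b" using u by auto
      with r(2)[of u] show ?thesis using 3 by simp
    qed
    then show ?thesis
      using 3 r(1) by (intro exI[of _ "min r (t - b)"]) simp
  qed
qed

text \<open>The lift that stays on one sheet over \<open>V\<close>. Flatness also asks about other
  basic sets \<open>W\<close>; near \<open>c t\<close> these are compared with \<open>V\<close>
  through a basic set inside both.\<close>

lemma flat_transport_within:
  assumes c: "pathin Y c" and uv: "{u..v} \<subseteq> {0..1}" "u \<le> v" and V: "V \<in> B" "c ` {u..v} \<subseteq> V"
    and f: "f \<in> F (c u)"
  shows "flat c (\<lambda>t. \<tau> V (c u) (c t) f) u v"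
  unfolding flat_def
proof (intro ballI conjI impI)
  fix t assume t: "t \<in> {u..v}"
  have cV: "c w \<in> V" if "w \<in> {u..v}" for w using V that by blast
  show "\<tau> V (c u) (c t) f \<in> F (c t)"
    using transport_mem[OF V(1) cV cV f] t uv by simp
  fix W assume W: "W \<in> B" "c t \<in> W"
  obtain N where N: "N \<in> B" "c t \<in> N" "N \<subseteq> V" "N \<subseteq> W"
    using base_Int[OF V(1) W(1) cV[OF t] W(2)] .
  obtain d where d: "d > 0" "\<And>w. w \<in> {0..1} \<Longrightarrow> \<bar>w - t\<bar> < d \<Longrightarrow> c w \<in> N"
    using pathin_nhds[OF c base_open[OF N(1)] _ N(2)] t uv by blast
  have "c w \<in> W \<and> \<tau> V (c u) (c w) f = \<tau> W (c t) (c w) (\<tau> V (c u) (c t) f)"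
    if w: "w \<in> {u..v}" "\<bar>w - t\<bar> < d" for w
  proof -
    have cw: "c w \<in> N" using d(2)[of w] w uv by blast
    have g: "\<tau> V (c u) (c t) f \<in> F (c t)"
      using transport_mem[OF V(1) cV cV f] t uv by simp
    have "\<tau> W (c t) (c w) (\<tau> V (c u) (c t) f) = \<tau> V (c t) (c w) (\<tau> V (c u) (c t) f)"
      using transport_local[OF W(1) V(1) N(1,4,3,2) cw g] .
    also have "\<dots> = \<tau> V (c u) (c w) f"
      using transport_trans[OF V(1) _ _ _ f] cV t w uv by simp
    finally show ?thesis using cw N by auto
  qed
  then show "\<exists>d>0. \<forall>w\<in>{u..v}. \<bar>w - t\<bar> < d \<longrightarrow> c w \<in> W \<and>
      \<tau> V (c u) (c w) f = \<tau> W (c t) (c w) (\<tau> V (c u) (c t) f)"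
    using d(1) by blast
qed

text \<open>Path lifting: a short piece of \<open>c\<close> lies in one basic set, where transport
  from its start is flat, and \<open>flat_glue\<close> joins such pieces.\<close>

lemma flat_exists:
  assumes c: "pathin Y c" and f: "f \<in> F (c 0)"
  obtains e where "flat c e 0 1" "e 0 = f"
proof -
  have cY: "c t \<in> topspace Y" if "t \<in> {0..1}" for t
    using c that by (auto simp: pathin_def continuous_map_def Pi_iff)
  \<comment> \<open>Every start value is allowed, since the lift over the right piece has to begin
    where the one over the left piece ended.\<close>
  define P where "P u v \<longleftrightarrow> 0 \<le> u \<and> u \<le> v \<and> v \<le> 1 \<longrightarrow> (\<forall>f\<in>F (c u). \<exists>e. flat c e u v \<and> e u = f)" for u v
  have "P 0 1"
  proof (rule Bolzano)
    fix u v w assume trans: "P u v" "P v w" "u \<le> v" "v \<le> w"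
    show "P u w"
      unfolding P_def
    proof (intro impI ballI)
      fix f assume *: "0 \<le> u \<and> u \<le> w \<and> w \<le> 1" and f: "f \<in> F (c u)"
      obtain e where e: "flat c e u v" "e u = f"
        using trans * f unfolding P_def by (meson order_trans)
      then have "e v \<in> F (c v)" using trans by (auto intro: flat_mem)
      then obtain e' where e': "flat c e' v w" "e' v = e v"
        using trans * unfolding P_def by (meson order_trans)
      show "\<exists>e. flat c e u w \<and> e u = f"
        using flat_glue[OF e(1) e'(1)] e e' trans
        by (intro exI[of _ "\<lambda>t. if t \<le> v then e t else e' t"]) auto
    qed
  next
    fix t :: real assume "0 \<le> t" "t \<le> 1"
    then have t: "t \<in> {0..1}" by simp
    obtain V where V: "V \<in> B" "c t \<in> V"
      using base[OF openin_topspace cY[OF t]] by auto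
    obtain d where d: "d > 0" "\<And>w. w \<in> {0..1} \<Longrightarrow> \<bar>w - t\<bar> < d \<Longrightarrow> c w \<in> V"
      by (rule pathin_nhds[OF c base_open[OF V(1)] t V(2)]) blast
    have "\<exists>e. flat c e u v \<and> e u = f"
      if *: "0 \<le> u" "u \<le> t" "t \<le> v" "v \<le> 1" "v - u < d" "f \<in> F (c u)" for u v f
    proof -
      have cV: "c ` {u..v} \<subseteq> V"
        using * by (auto intro!: d(2))
      then have "flat c (\<lambda>t. \<tau> V (c u) (c t) f) u v"
        using * V by (intro flat_transport_within[OF c]) auto
      moreover have "\<tau> V (c u) (c u) f = f"
        using * cV V by (intro transport_refl) auto
      ultimately show ?thesis by blast
    qed
    then show "\<exists>d>0. \<forall>a b. a \<le> t \<and> t \<le> b \<and> b - a < d \<longrightarrow> P a b"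
      unfolding P_def using d(1) by (intro exI[of _ d]) simp
  qed simp
  then show ?thesis using f that unfolding P_def by auto
qed

lemma flat_const:
  assumes "y \<in> topspace Y" "f \<in> F y"
  shows "flat (\<lambda>_. y) (\<lambda>_. f) a b"
  unfolding flat_def using assms by (auto simp: transport_refl intro: exI[of _ 1])

text \<open>Serves to read off, from a lift along a joined path, the end value of a lift along its
  first part.\<close>

lemma flat_first_half:
  assumes "flat c e 0 1"
  shows "flat (\<lambda>t. c (t / 2)) (\<lambda>t. e (t / 2)) 0 1"
  unfolding flat_def
proof (intro ballI conjI impI)
  fix t :: real assume t: "t \<in> {0..1}"
  then show "e (t / 2) \<in> F (c (t / 2))" using flat_mem[OF assms] by auto
  fix V assume V: "V \<in> B" "c (t / 2) \<in> V"
  obtain d where d: "d > 0" "\<And>u. u \<in> {0..1} \<Longrightarrow> \<bar>u - t / 2\<bar> < d \<Longrightarrow>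
      c u \<in> V \<and> e u = \<tau> V (c (t / 2)) (c u) (e (t / 2))"
    by (rule flatE[OF assms _ V], use t in simp, blast)
  show "\<exists>d>0. \<forall>u\<in>{0..1}. \<bar>u - t\<bar> < d \<longrightarrow>
      c (u / 2) \<in> V \<and> e (u / 2) = \<tau> V (c (t / 2)) (c (u / 2)) (e (t / 2))"
  proof (intro exI[of _ d] conjI ballI impI d(1))
    fix u :: real assume "u \<in> {0..1}" "\<bar>u - t\<bar> < d"
    then have "u / 2 \<in> {0..1}" "\<bar>u / 2 - t / 2\<bar> < d" by auto
    from d(2)[OF this] show "c (u / 2) \<in> V"
      "e (u / 2) = \<tau> V (c (t / 2)) (c (u / 2)) (e (t / 2))" by auto
  qed
qed

text \<open>If two flat lifts along the curves at heights \<open>s\<close> and \<open>s0\<close> of the square correspond to each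
  other at one time, then also at a later time, as long as \<open>s\<close> is close to \<open>s0\<close>; the
  correspondence at time \<open>a\<close> is transport within a chosen neighbourhood \<open>N a\<close> of \<open>h (s0, a)\<close>.\<close>

lemma flat_strip:
  fixes h :: "real \<times> real \<Rightarrow> 'y"
  assumes h: "continuous_map (top_of_set ({0..1} \<times> {0..1})) Y h" and s0: "s0 \<in> {0..1}"
    and ends: "\<And>s. s \<in> {0..1} \<Longrightarrow> h (s, 0) = x" "\<And>s. s \<in> {0..1} \<Longrightarrow> h (s, 1) = y"
  obtains \<delta> where "\<delta> > 0"
    "\<And>s e e'. \<lbrakk>s \<in> {0..1}; \<bar>s - s0\<bar> < \<delta>; flat (\<lambda>t. h (s0, t)) e 0 1; flat (\<lambda>t. h (s, t)) e' 0 1;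
       e 0 = e' 0\<rbrakk> \<Longrightarrow> e 1 = e' 1"
proof -
  have hY: "h (s, t) \<in> topspace Y" if "s \<in> {0..1}" "t \<in> {0..1}" for s t
    using h that by (auto simp: continuous_map_def Pi_iff)
  have "\<exists>N. \<forall>t\<in>{0..1}. N t \<in> B \<and> h (s0, t) \<in> N t"
    by (rule bchoice) (use base[OF openin_topspace hY[OF s0]] in blast)
  then obtain N where "\<forall>t\<in>{0..1}. N t \<in> B \<and> h (s0, t) \<in> N t" ..
  then have N: "\<And>t. t \<in> {0..1} \<Longrightarrow> N t \<in> B" "\<And>t. t \<in> {0..1} \<Longrightarrow> h (s0, t) \<in> N t"
    by simp_all
  define R where "R s e e' a \<longleftrightarrow> h (s, a) \<in> N a \<and> e' a = \<tau> (N a) (h (s0, a)) (h (s, a)) (e a)"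
    for s e e' a
  \<comment> \<open>A single \<open>\<delta>\<close> serves all heights \<open>s\<close> and all
    lifts. Adjacent strips then combine with the smaller of their two bounds.\<close>
  define Q where "Q \<delta> a b \<longleftrightarrow> (\<forall>s\<in>{0..1}. \<bar>s - s0\<bar> < \<delta> \<longrightarrow>
       (\<forall>e e'. flat (\<lambda>t. h (s0, t)) e 0 1 \<longrightarrow> flat (\<lambda>t. h (s, t)) e' 0 1 \<longrightarrow>
          R s e e' a \<longrightarrow> R s e e' b))" for \<delta> a b :: real
  define P where "P a b \<longleftrightarrow> 0 \<le> a \<and> a \<le> b \<and> b \<le> 1 \<longrightarrow> (\<exists>\<delta>>0. Q \<delta> a b)" for a b :: real
  have "P 0 1"
  proof (rule Bolzano)
    fix a b c assume P: "P a b" "P b c" and le: "a \<le> b" "b \<le> c"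
    show "P a c"
      unfolding P_def
    proof
      assume "0 \<le> a \<and> a \<le> c \<and> c \<le> 1"
      then obtain \<delta> \<delta>' where \<delta>: "\<delta> > 0" "Q \<delta> a b" "\<delta>' > 0" "Q \<delta>' b c"
        using P le unfolding P_def by auto
      then have "Q (min \<delta> \<delta>') a c"
        unfolding Q_def by simp
      then show "\<exists>\<delta>>0. Q \<delta> a c"
        using \<delta> by (intro exI[of _ "min \<delta> \<delta>'"]) simp
    qed
  next
    fix t :: real assume "0 \<le> t" "t \<le> 1"
    then have t: "t \<in> {0..1}" by simp
    obtain d where d: "d > 0" "\<And>u v. u \<in> {0..1} \<Longrightarrow> v \<in> {0..1} \<Longrightarrow> \<bar>u - s0\<bar> < d \<Longrightarrow> \<bar>v - t\<bar> < d \<Longrightarrow>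
        h (u, v) \<in> N t"
      by (rule square_nhds[OF h base_open[OF N(1)[OF t]] s0 t N(2)[OF t]]) blast
    have "P a b" if ab: "a \<le> t" "t \<le> b" "b - a < d" for a b
      unfolding P_def
    proof
      assume "0 \<le> a \<and> a \<le> b \<and> b \<le> 1"
      then have ab01: "a \<in> {0..1}" "b \<in> {0..1}" by auto
      have h0: "h (s0, a) \<in> N t" "h (s0, b) \<in> N t"
        using d(1) d(2)[OF s0 ab01(1)] d(2)[OF s0 ab01(2)] ab by auto
      \<comment> \<open>Inside \<open>Na\<close> the transports over \<open>N a\<close> and
        \<open>N t\<close> agree, so the correspondence at time \<open>a\<close> can be computed in
        \<open>N t\<close>; \<open>Nb\<close> does the same at time \<open>b\<close>. The heights
        must be close enough to put both ends of the upper curve into these sets.\<close>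
      obtain Na where Na: "Na \<in> B" "h (s0, a) \<in> Na" "Na \<subseteq> N a" "Na \<subseteq> N t"
        using base_Int[OF N(1)[OF ab01(1)] N(1)[OF t] N(2)[OF ab01(1)] h0(1)] .
      obtain Nb where Nb: "Nb \<in> B" "h (s0, b) \<in> Nb" "Nb \<subseteq> N b" "Nb \<subseteq> N t"
        using base_Int[OF N(1)[OF ab01(2)] N(1)[OF t] N(2)[OF ab01(2)] h0(2)] .
      obtain d1 where d1: "d1 > 0" "\<And>u v. u \<in> {0..1} \<Longrightarrow> v \<in> {0..1} \<Longrightarrow> \<bar>u - s0\<bar> < d1 \<Longrightarrow>
          \<bar>v - a\<bar> < d1 \<Longrightarrow> h (u, v) \<in> Na"
        by (rule square_nhds[OF h base_open[OF Na(1)] s0 ab01(1) Na(2)]) blast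
      obtain d2 where d2: "d2 > 0" "\<And>u v. u \<in> {0..1} \<Longrightarrow> v \<in> {0..1} \<Longrightarrow> \<bar>u - s0\<bar> < d2 \<Longrightarrow>
          \<bar>v - b\<bar> < d2 \<Longrightarrow> h (u, v) \<in> Nb"
        by (rule square_nhds[OF h base_open[OF Nb(1)] s0 ab01(2) Nb(2)]) blast
      have "R s e e' b" if s: "s \<in> {0..1}" "\<bar>s - s0\<bar> < min d (min d1 d2)"
        and e: "flat (\<lambda>t. h (s0, t)) e 0 1" and e': "flat (\<lambda>t. h (s, t)) e' 0 1"
        and R: "R s e e' a" for s e e'
      proof -
        have B: "N t \<in> B" "N a \<in> B" "N b \<in> B" using N t ab01 by auto
        have sub: "{a..b} \<subseteq> {0..1}" and le: "a \<le> b" using ab ab01 by auto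
        have hs: "h (s, a) \<in> Na" "h (s, b) \<in> Nb"
          using d1(1) d1(2)[OF s(1) ab01(1)] d2(1) d2(2)[OF s(1) ab01(2)] s(2) by auto
        have hN: "h (u, v) \<in> N t" if "v \<in> {a..b}" "u = s0 \<or> u = s" for u v
          using d(1) d(2)[of u v] that s s0 sub ab by auto
        have ea: "e a \<in> F (h (s0, a))" and eb: "e b \<in> F (h (s0, b))" 
          using flat_mem[OF e] ab01 by auto
        have eb': "e b = \<tau> (N t) (h (s0, a)) (h (s0, b)) (e a)"
          using hN by (intro flat_within[OF flat_subset[OF e sub] le B(1)]) blast
        have "e' b = \<tau> (N t) (h (s, a)) (h (s, b)) (e' a)"
          using hN by (intro flat_within[OF flat_subset[OF e' sub] le B(1)]) blast
        also have "e' a = \<tau> (N a) (h (s0, a)) (h (s, a)) (e a)"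
          using R by (simp add: R_def)
        also have "\<dots> = \<tau> (N t) (h (s0, a)) (h (s, a)) (e a)"
          using transport_local[OF B(2,1) Na(1,3,4,2) hs(1) ea] .
        also have "\<tau> (N t) (h (s, a)) (h (s, b)) \<dots> = \<tau> (N t) (h (s0, a)) (h (s, b)) (e a)"
          using transport_trans[OF B(1) h0(1) _ _ ea] hs Na Nb by blast
        also have "\<dots> = \<tau> (N t) (h (s0, b)) (h (s, b)) (e b)"
          unfolding eb' using transport_trans[OF B(1) h0 _ ea] hs Nb by auto
        also have "\<dots> = \<tau> (N b) (h (s0, b)) (h (s, b)) (e b)"
          using transport_local[OF B(1,3) Nb(1,4,3,2) hs(2) eb] .
        finally show ?thesis
          using hs Nb by (auto simp: R_def)
      qed
      then have "Q (min d (min d1 d2)) a b"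
        unfolding Q_def by blast
      then show "\<exists>\<delta>>0. Q \<delta> a b"
        using d(1) d1(1) d2(1) by (intro exI[of _ "min d (min d1 d2)"]) simp
    qed
    then show "\<exists>d>0. \<forall>a b. a \<le> t \<and> t \<le> b \<and> b - a < d \<longrightarrow> P a b"
      using d(1) by blast
  qed simp
  then obtain \<delta> where "\<delta> > 0" and "Q \<delta> 0 1"
    unfolding P_def by auto
  then have \<delta>: "\<delta> > 0" "\<And>s e e'. \<lbrakk>s\<in>{0..1}; \<bar>s - s0\<bar> < \<delta>; flat (\<lambda>t. h (s0, t)) e 0 1;
      flat (\<lambda>t. h (s, t)) e' 0 1; R s e e' 0\<rbrakk> \<Longrightarrow> R s e e' 1"
    unfolding Q_def by blast+
  show ?thesis
  proof (rule that[OF \<delta>(1)])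
    fix s e e' assume s: "s \<in> {0..1}" "\<bar>s - s0\<bar> < \<delta>"
      and e: "flat (\<lambda>t. h (s0, t)) e 0 1" and e': "flat (\<lambda>t. h (s, t)) e' 0 1" and eq: "e 0 = e' 0"
    \<comment> \<open>The curves share their ends, where correspondence is transport from a point to
      itself, that is, equality.\<close>
    have x: "x \<in> N 0" and y: "y \<in> N 1" using N(2)[of 0] N(2)[of 1] ends s0 by auto
    have "e 0 \<in> F x" "e 1 \<in> F y" using flat_mem[OF e, of 0] flat_mem[OF e, of 1] ends s0 by auto
    then have "\<tau> (N 0) x x (e 0) = e 0" "\<tau> (N 1) y y (e 1) = e 1"
      using x y N(1) by (simp_all add: transport_refl)
    then have "R s e e' 0" "R s e e' 1 \<Longrightarrow> e 1 = e' 1"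
      using x eq by (simp_all only: R_def ends[OF s(1)] ends[OF s0])
    then show "e 1 = e' 1"
      using \<delta>(2)[OF s e e'] by blast
  qed
qed

text \<open>Bisection in the homotopy parameter. Each intermediate curve has a lift with the given
  start by \<open>flat_exists\<close>, and \<open>flat_strip\<close> compares the lifts at close
  heights.\<close>

theorem monodromy:
  assumes "path_homotopic Y x y p q" and e: "flat p e 0 1" "flat q e' 0 1" "e 0 = e' 0"
  shows "e 1 = e' 1"
  using assms(1)
proof (rule path_homotopicE)
  fix h :: "real \<times> real \<Rightarrow> 'y"
  assume h: "continuous_map (top_of_set ({0..1} \<times> {0..1})) Y h"
    "\<And>t. t \<in> {0..1} \<Longrightarrow> h (0, t) = p t" "\<And>t. t \<in> {0..1} \<Longrightarrow> h (1, t) = q t"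
    "\<And>s. s \<in> {0..1} \<Longrightarrow> h (s, 0) = x" "\<And>s. s \<in> {0..1} \<Longrightarrow> h (s, 1) = y"
  have path: "pathin Y (\<lambda>t. h (s, t))" if "s \<in> {0..1}" for s
    unfolding pathin_def
    by (rule continuous_map_compose_euclidean[OF h(1)]) (use that in \<open>auto intro!: continuous_intros\<close>)
  define P where "P s s' \<longleftrightarrow> 0 \<le> s \<and> s \<le> s' \<and> s' \<le> 1 \<longrightarrow>
      (\<forall>e e'. flat (\<lambda>t. h (s, t)) e 0 1 \<longrightarrow> flat (\<lambda>t. h (s', t)) e' 0 1 \<longrightarrow>
         e 0 = e' 0 \<longrightarrow> e 1 = e' 1)" for s s' :: real
  have "P 0 1"
  proof (rule Bolzano)
    fix a b c assume P: "P a b" "P b c" and le: "a \<le> b" "b \<le> c"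
    show "P a c"
      unfolding P_def
    proof (intro impI allI)
      fix e e' assume *: "0 \<le> a \<and> a \<le> c \<and> c \<le> 1" "flat (\<lambda>t. h (a, t)) e 0 1"
        "flat (\<lambda>t. h (c, t)) e' 0 1" "e 0 = e' 0"
      have "e 0 \<in> F (h (b, 0))"
        using flat_mem[OF *(2), of 0] h(4)[of a] h(4)[of b] * le by simp
      then obtain k where k: "flat (\<lambda>t. h (b, t)) k 0 1" "k 0 = e 0"
        using flat_exists[OF path[of b]] * le by auto
      have "e 1 = k 1"
        by (rule P(1)[unfolded P_def, rule_format, OF _ *(2) k(1)]) (use * le k in simp_all)
      also have "k 1 = e' 1"
        by (rule P(2)[unfolded P_def, rule_format, OF _ k(1) *(3)]) (use * le k in simp_all)
      finally show "e 1 = e' 1" .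
    qed
  next
    fix s0 :: real assume "0 \<le> s0" "s0 \<le> 1"
    then have s0: "s0 \<in> {0..1}" by simp
    obtain \<delta> where \<delta>: "\<delta> > 0"
      "\<And>s e e'. \<lbrakk>s \<in> {0..1}; \<bar>s - s0\<bar> < \<delta>; flat (\<lambda>t. h (s0, t)) e 0 1; flat (\<lambda>t. h (s, t)) e' 0 1;
         e 0 = e' 0\<rbrakk> \<Longrightarrow> e 1 = e' 1"
      using flat_strip[OF h(1) s0 h(4,5)] by blast
    have "P a b" if ab: "a \<le> s0" "s0 \<le> b" "b - a < \<delta>" for a b
      unfolding P_def
    proof (intro impI allI)
      fix e e' assume *: "0 \<le> a \<and> a \<le> b \<and> b \<le> 1" "flat (\<lambda>t. h (a, t)) e 0 1"
        "flat (\<lambda>t. h (b, t)) e' 0 1" "e 0 = e' 0"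
      have "e 0 \<in> F (h (s0, 0))"
        using flat_mem[OF *(2), of 0] h(4)[of a] h(4)[of s0] * s0 by simp
      then obtain k where k: "flat (\<lambda>t. h (s0, t)) k 0 1" "k 0 = e 0"
        using flat_exists[OF path[OF s0]] by auto
      have "k 1 = e 1" "k 1 = e' 1"
        using \<delta>(2)[OF _ _ k(1) *(2)] \<delta>(2)[OF _ _ k(1) *(3)] k(2) * ab by auto
      then show "e 1 = e' 1" by simp
    qed
    then show "\<exists>d>0. \<forall>a b. a \<le> s0 \<and> s0 \<le> b \<and> b - a < d \<longrightarrow> P a b"
      using \<delta>(1) by blast
  qed simp
  \<comment> \<open>Flatness sees a curve on the unit interval only, where the two edges of the
    square are \<open>p\<close> and \<open>q\<close>.\<close>
  moreover have "flat (\<lambda>t. h (0, t)) e 0 1" "flat (\<lambda>t. h (1, t)) e' 0 1"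
    using e(1,2) h(2,3) by (simp_all add: flat_def)
  ultimately show ?thesis
    using e(3) unfolding P_def by simp
qed

end


section \<open>Presheaves\<close>

lemma presheaf_comm_group: "is_presheaf X F \<Longrightarrow> openin X U \<Longrightarrow> comm_group (Sec F U)"
  by (simp add: is_presheaf_def)

lemma presheaf_group: "is_presheaf X F \<Longrightarrow> openin X U \<Longrightarrow> group (Sec F U)"
  by (simp add: presheaf_comm_group comm_group.axioms(2))

lemma Res_hom:
  "is_presheaf X F \<Longrightarrow> openin X U \<Longrightarrow> openin X V \<Longrightarrow> V \<subseteq> U \<Longrightarrow> Res F U V \<in> hom (Sec F U) (Sec F V)"
  by (simp add: is_presheaf_def)

lemma Res_closed:
  "is_presheaf X F \<Longrightarrow> openin X U \<Longrightarrow> openin X V \<Longrightarrow> V \<subseteq> U \<Longrightarrow> s \<in> carrier (Sec F U) \<Longrightarrow>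
    Res F U V s \<in> carrier (Sec F V)"
  by (rule hom_in_carrier[OF Res_hom])

lemma Res_id: "is_presheaf X F \<Longrightarrow> openin X U \<Longrightarrow> s \<in> carrier (Sec F U) \<Longrightarrow> Res F U U s = s"
  by (simp add: is_presheaf_def)

lemma Res_Res:
  "is_presheaf X F \<Longrightarrow> openin X U \<Longrightarrow> openin X V \<Longrightarrow> openin X W \<Longrightarrow> V \<subseteq> U \<Longrightarrow> W \<subseteq> V \<Longrightarrow>
    s \<in> carrier (Sec F U) \<Longrightarrow> Res F V W (Res F U V s) = Res F U W s"
  unfolding is_presheaf_def by blast

lemma Res_mult:
  "is_presheaf X F \<Longrightarrow> openin X U \<Longrightarrow> openin X V \<Longrightarrow> V \<subseteq> U \<Longrightarrow> s \<in> carrier (Sec F U) \<Longrightarrow>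
    t \<in> carrier (Sec F U) \<Longrightarrow> Res F U V (s \<otimes>\<^bsub>Sec F U\<^esub> t) = Res F U V s \<otimes>\<^bsub>Sec F V\<^esub> Res F U V t"
  by (rule hom_mult[OF Res_hom])

lemma Res_one:
  assumes "is_presheaf X F" "openin X U" "openin X V" "V \<subseteq> U"
  shows "Res F U V \<one>\<^bsub>Sec F U\<^esub> = \<one>\<^bsub>Sec F V\<^esub>"
  by (rule hom_one[OF Res_hom[OF assms] presheaf_group presheaf_group]) (use assms in simp_all)

lemma Sec_mult_closed:
  "is_presheaf X F \<Longrightarrow> openin X U \<Longrightarrow> s \<in> carrier (Sec F U) \<Longrightarrow> t \<in> carrier (Sec F U) \<Longrightarrow>
    s \<otimes>\<^bsub>Sec F U\<^esub> t \<in> carrier (Sec F U)"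
  by (meson group.is_monoid monoid.m_closed presheaf_group)

lemma Sec_one_closed: "is_presheaf X F \<Longrightarrow> openin X U \<Longrightarrow> \<one>\<^bsub>Sec F U\<^esub> \<in> carrier (Sec F U)"
  by (meson group.is_monoid monoid.one_closed presheaf_group)

lemma sheaf_presheaf: "is_sheaf X F \<Longrightarrow> is_presheaf X F"
  by (simp add: is_sheaf_def)


section \<open>Germs and stalks\<close>

lemma mem_germ_iff:
  "(V, t) \<in> germ X F x U s \<longleftrightarrow> openin X V \<and> x \<in> V \<and> t \<in> carrier (Sec F V) \<and>
     (\<exists>W. openin X W \<and> x \<in> W \<and> W \<subseteq> U \<and> W \<subseteq> V \<and> Res F U W s = Res F V W t)"
  by (simp add: germ_def)

lemma germ_refl: "openin X U \<Longrightarrow> x \<in> U \<Longrightarrow> s \<in> carrier (Sec F U) \<Longrightarrow> (U, s) \<in> germ X F x U s"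
  by (auto simp: mem_germ_iff)

text \<open>A germ is a whole equivalence class, so equality is two inclusions, which are symmetric.
  Given a further representative, all three sections agree on the intersection of the two witnessing
  open sets.\<close>

lemma germ_eqI:
  assumes P: "is_presheaf X F" and U: "openin X U" "s \<in> carrier (Sec F U)"
    and V: "openin X V" "t \<in> carrier (Sec F V)"
    and W: "openin X W" "x \<in> W" "W \<subseteq> U" "W \<subseteq> V" "Res F U W s = Res F V W t"
  shows "germ X F x U s = germ X F x V t"
proof -
  have sub: "germ X F x U s \<subseteq> germ X F x V t"
    if U: "openin X U" "s \<in> carrier (Sec F U)" and V: "openin X V" "t \<in> carrier (Sec F V)"
    and W: "openin X W" "x \<in> W" "W \<subseteq> U" "W \<subseteq> V" "Res F U W s = Res F V W t"
    for U V s t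
  proof (rule subsetI)
    fix z assume z: "z \<in> germ X F x U s"
    obtain T r where zz: "z = (T, r)" by force
    obtain N where T: "openin X T" "x \<in> T" "r \<in> carrier (Sec F T)"
      and N: "openin X N" "x \<in> N" "N \<subseteq> U" "N \<subseteq> T" "Res F U N s = Res F T N r"
      using z unfolding zz mem_germ_iff by blast
    have NW: "openin X (N \<inter> W)" using N(1) W(1) by blast
    have "Res F V (N \<inter> W) t = Res F W (N \<inter> W) (Res F V W t)"
      using Res_Res[OF P V(1) W(1) NW W(4) _ V(2)] by auto
    also have "\<dots> = Res F U (N \<inter> W) s"
      using Res_Res[OF P U(1) W(1) NW W(3) _ U(2)] W(5) by auto
    also have "\<dots> = Res F N (N \<inter> W) (Res F U N s)"
      using Res_Res[OF P U(1) N(1) NW N(3) _ U(2)] by auto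
    also have "\<dots> = Res F T (N \<inter> W) r"
      using Res_Res[OF P T(1) N(1) NW N(4) _ T(3)] N(5) by auto
    finally show "z \<in> germ X F x V t"
      unfolding zz mem_germ_iff using T N W NW by blast
  qed
  show ?thesis
    using sub[OF U V W] sub[OF V U W(1,2,4,3) W(5)[symmetric]] by (rule equalityI)
qed

lemma germ_eqE:
  assumes "germ X F x U s = germ X F x V t" "openin X V" "x \<in> V" "t \<in> carrier (Sec F V)"
  obtains W where "openin X W" "x \<in> W" "W \<subseteq> U" "W \<subseteq> V" "Res F U W s = Res F V W t"
  using germ_refl[OF assms(2-4)] unfolding assms(1)[symmetric] mem_germ_iff by blast

lemma germ_Res:
  assumes P: "is_presheaf X F" and U: "openin X U" "s \<in> carrier (Sec F U)"
    and V: "openin X V" "V \<subseteq> U" "x \<in> V"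
  shows "germ X F x V (Res F U V s) = germ X F x U s"
  by (rule germ_eqI[OF P V(1) Res_closed[OF P U(1) V(1,2) U(2)] U V(1) V(3) order_refl V(2)])
    (simp add: Res_id[OF P V(1)] Res_closed[OF P U(1) V(1,2) U(2)])

lemma germ_memD:
  assumes "is_presheaf X F" "openin X U" "s \<in> carrier (Sec F U)" "(V, t) \<in> germ X F x U s"
  shows "openin X V" "x \<in> V" "t \<in> carrier (Sec F V)" "germ X F x V t = germ X F x U s"
proof -
  obtain W where *: "openin X V" "x \<in> V" "t \<in> carrier (Sec F V)"
    "openin X W" "x \<in> W" "W \<subseteq> U" "W \<subseteq> V" "Res F U W s = Res F V W t"
    using assms(4) unfolding mem_germ_iff by blast
  show "openin X V" "x \<in> V" "t \<in> carrier (Sec F V)" by fact+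
  show "germ X F x V t = germ X F x U s"
    by (rule germ_eqI[OF assms(1) *(1,3) assms(2,3) *(4,5,7,6) *(8)[symmetric]])
qed

lemma germ_in_stalk:
  "openin X U \<Longrightarrow> x \<in> U \<Longrightarrow> s \<in> carrier (Sec F U) \<Longrightarrow> germ X F x U s \<in> carrier (stalk X F x)"
  unfolding stalk_def by auto

lemma stalkE:
  assumes "a \<in> carrier (stalk X F x)"
  obtains U s where "openin X U" "x \<in> U" "s \<in> carrier (Sec F U)" "a = germ X F x U s"
  using assms unfolding stalk_def by auto

lemma stalkE_within:
  assumes P: "is_presheaf X F" and a: "a \<in> carrier (stalk X F x)" and N: "openin X N" "x \<in> N"
  obtains U s where "openin X U" "x \<in> U" "U \<subseteq> N" "s \<in> carrier (Sec F U)" "a = germ X F x U s"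
proof -
  obtain U s where U: "openin X U" "x \<in> U" "s \<in> carrier (Sec F U)" "a = germ X F x U s"
    using a by (rule stalkE)
  have o: "openin X (U \<inter> N)" using U N by blast
  show ?thesis
    by (rule that[OF o _ _ Res_closed[OF P U(1) o _ U(3)]])
      (use U N germ_Res[OF P U(1,3) o] in auto)
qed

text \<open>Evaluates the unions over representatives in the definitions on stalks: all members of
  the nonempty class contribute the same set.\<close>

lemma UN_germ:
  assumes P: "is_presheaf X F" and U: "openin X U" "x \<in> U" "s \<in> carrier (Sec F U)"
    and f: "\<And>V t. \<lbrakk>openin X V; x \<in> V; t \<in> carrier (Sec F V); germ X F x V t = germ X F x U s\<rbrakk> \<Longrightarrow>
      f V t = f U s"
  shows "(\<Union>(V, t)\<in>germ X F x U s. f V t) = f U s"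
proof -
  have "f V t = f U s" if "(V, t) \<in> germ X F x U s" for V t
    using germ_memD[OF P U(1,3) that] by (rule f)
  then have "(\<lambda>(V, t). f V t) ` germ X F x U s \<subseteq> {f U s}"
    by (simp only: image_subset_iff split_paired_all) blast
  moreover have "f U s \<in> (\<lambda>(V, t). f V t) ` germ X F x U s"
    using germ_refl[OF U] by (rule rev_image_eqI) simp
  ultimately have "(\<lambda>(V, t). f V t) ` germ X F x U s = {f U s}"
    by blast
  then show ?thesis by simp
qed

text \<open>The product of any two representatives is compared with that of \<open>s\<close> and
  \<open>t\<close> on an open set where the representatives coincide with \<open>s\<close> and
  \<open>t\<close>.\<close>

lemma stalk_mult:
  assumes P: "is_presheaf X F" and U: "openin X U" "x \<in> U" "s \<in> carrier (Sec F U)"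
    and t: "t \<in> carrier (Sec F U)"
  shows "germ X F x U s \<otimes>\<^bsub>stalk X F x\<^esub> germ X F x U t = germ X F x U (s \<otimes>\<^bsub>Sec F U\<^esub> t)"
proof -
  let ?m = "\<lambda>V a W b. germ X F x (V \<inter> W) (Res F V (V \<inter> W) a \<otimes>\<^bsub>Sec F (V \<inter> W)\<^esub> Res F W (V \<inter> W) b)"
  have m: "?m V a W b = germ X F x U (s \<otimes>\<^bsub>Sec F U\<^esub> t)"
    if V: "openin X V" "x \<in> V" "a \<in> carrier (Sec F V)" "germ X F x V a = germ X F x U s"
      and W: "openin X W" "x \<in> W" "b \<in> carrier (Sec F W)" "germ X F x W b = germ X F x U t"
    for V a W b
  proof -
    obtain M where M: "openin X M" "x \<in> M" "M \<subseteq> V" "M \<subseteq> U" "Res F V M a = Res F U M s"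
      using V(4) U by (rule germ_eqE)
    obtain N where N: "openin X N" "x \<in> N" "N \<subseteq> W" "N \<subseteq> U" "Res F W N b = Res F U N t"
      using W(4) U(1,2) t by (rule germ_eqE)
    have o: "openin X (V \<inter> W)" "openin X (M \<inter> N)" using V W M N by blast+
    have sub: "V \<inter> W \<subseteq> V" "V \<inter> W \<subseteq> W" "M \<inter> N \<subseteq> V \<inter> W" "M \<inter> N \<subseteq> U" "M \<inter> N \<subseteq> M" "M \<inter> N \<subseteq> N"
      "M \<inter> N \<subseteq> V" "M \<inter> N \<subseteq> W" using M N by auto
    have a: "Res F V (V \<inter> W) a \<in> carrier (Sec F (V \<inter> W))"
      and b: "Res F W (V \<inter> W) b \<in> carrier (Sec F (V \<inter> W))"
      using Res_closed[OF P _ o(1)] V W by auto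
    have ra: "Res F V (M \<inter> N) a = Res F U (M \<inter> N) s"
      using Res_Res[OF P V(1) M(1) o(2) M(3) sub(5) V(3)] Res_Res[OF P U(1) M(1) o(2) M(4) sub(5) U(3)]
        M(5) by simp
    have rb: "Res F W (M \<inter> N) b = Res F U (M \<inter> N) t"
      using Res_Res[OF P W(1) N(1) o(2) N(3) sub(6) W(3)] Res_Res[OF P U(1) N(1) o(2) N(4) sub(6) t]
        N(5) by simp
    show ?thesis
    proof (rule germ_eqI[OF P o(1) Sec_mult_closed[OF P o(1) a b] U(1) Sec_mult_closed[OF P U(1,3) t] o(2) _ sub(3,4)])
      show "x \<in> M \<inter> N" using M N by blast
      show "Res F (V \<inter> W) (M \<inter> N) (Res F V (V \<inter> W) a \<otimes>\<^bsub>Sec F (V \<inter> W)\<^esub> Res F W (V \<inter> W) b) =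
          Res F U (M \<inter> N) (s \<otimes>\<^bsub>Sec F U\<^esub> t)"
        unfolding Res_mult[OF P o sub(3) a b] Res_mult[OF P U(1) o(2) sub(4) U(3) t]
          Res_Res[OF P V(1) o sub(1,3) V(3)] Res_Res[OF P W(1) o sub(2,3) W(3)] ra rb ..
    qed
  qed
  have "(\<Union>(V, a)\<in>germ X F x U s. \<Union>(W, b)\<in>germ X F x U t. ?m V a W b) =
      (\<Union>(W, b)\<in>germ X F x U t. ?m U s W b)"
  proof (rule UN_germ[OF P U, where f = "\<lambda>V a. \<Union>(W, b)\<in>germ X F x U t. ?m V a W b"])
    fix V a assume V: "openin X V" "x \<in> V" "a \<in> carrier (Sec F V)" "germ X F x V a = germ X F x U s"
    have eq: "?m V a W b = ?m U s W b" if "(W, b) \<in> germ X F x U t" for W b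
      using m[OF V germ_memD[OF P U(1) t that]] m[OF U refl germ_memD[OF P U(1) t that]] by simp
    show "(\<Union>(W, b)\<in>germ X F x U t. ?m V a W b) = (\<Union>(W, b)\<in>germ X F x U t. ?m U s W b)"
    proof (rule SUP_cong[OF refl])
      fix z assume z: "z \<in> germ X F x U t"
      obtain W b where "z = (W, b)" by force
      with z eq[of W b] show "(case z of (W, b) \<Rightarrow> ?m V a W b) = (case z of (W, b) \<Rightarrow> ?m U s W b)"
        by (simp only: prod.case)
    qed
  qed
  also have "\<dots> = ?m U s U t"
  proof (rule UN_germ[OF P U(1,2) t])
    fix W b assume W: "openin X W" "x \<in> W" "b \<in> carrier (Sec F W)" "germ X F x W b = germ X F x U t"
    show "?m U s W b = ?m U s U t"
      using m[OF U refl W] m[OF U refl U(1,2) t refl] by simp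
  qed
  also have "\<dots> = germ X F x U (s \<otimes>\<^bsub>Sec F U\<^esub> t)"
    using m[OF U refl U(1,2) t refl] .
  finally show ?thesis
    by (simp add: stalk_def)
qed

lemma germ_hom:
  assumes "is_presheaf X F" "openin X U" "x \<in> U"
  shows "germ X F x U \<in> hom (Sec F U) (stalk X F x)"
  using assms by (auto simp: hom_def germ_in_stalk stalk_mult)

lemma stalk_one:
  assumes P: "is_presheaf X F" and U: "openin X U" "x \<in> U"
  shows "\<one>\<^bsub>stalk X F x\<^esub> = germ X F x U \<one>\<^bsub>Sec F U\<^esub>"
proof -
  have T: "openin X (topspace X)" "U \<subseteq> topspace X" using openin_subset[OF U(1)] by auto
  show ?thesis
    using germ_Res[OF P T(1) Sec_one_closed[OF P T(1)] U(1) T(2) U(2)]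
    by (simp add: stalk_def Res_one[OF P T(1) U(1) T(2)])
qed

text \<open>Two germs, and below three, live over a common open set, so that the laws of the stalk
  are inherited from a single section group.\<close>

lemma stalkE2:
  assumes P: "is_presheaf X F" and a: "a \<in> carrier (stalk X F x)" and b: "b \<in> carrier (stalk X F x)"
  obtains U s t where "openin X U" "x \<in> U" "s \<in> carrier (Sec F U)" "t \<in> carrier (Sec F U)"
    "a = germ X F x U s" "b = germ X F x U t"
proof -
  obtain V r where V: "openin X V" "x \<in> V" "r \<in> carrier (Sec F V)" "a = germ X F x V r"
    using a by (rule stalkE)
  obtain U t where U: "openin X U" "x \<in> U" "U \<subseteq> V" "t \<in> carrier (Sec F U)" "b = germ X F x U t"
    using stalkE_within[OF P b V(1,2)] .
  show ?thesis
    by (rule that[OF U(1,2) Res_closed[OF P V(1) U(1,3) V(3)] U(4) _ U(5)])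
      (simp add: V(4) germ_Res[OF P V(1,3) U(1,3,2)])
qed

lemma stalkE3:
  assumes P: "is_presheaf X F" and a: "a \<in> carrier (stalk X F x)" and b: "b \<in> carrier (stalk X F x)"
    and c: "c \<in> carrier (stalk X F x)"
  obtains U s t r where "openin X U" "x \<in> U" "s \<in> carrier (Sec F U)" "t \<in> carrier (Sec F U)"
    "r \<in> carrier (Sec F U)" "a = germ X F x U s" "b = germ X F x U t" "c = germ X F x U r"
proof -
  obtain V s t where V: "openin X V" "x \<in> V" "s \<in> carrier (Sec F V)" "t \<in> carrier (Sec F V)"
    "a = germ X F x V s" "b = germ X F x V t"
    using stalkE2[OF P a b] .
  obtain U r where U: "openin X U" "x \<in> U" "U \<subseteq> V" "r \<in> carrier (Sec F U)" "c = germ X F x U r"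
    using stalkE_within[OF P c V(1,2)] .
  show ?thesis
    by (rule that[OF U(1,2) Res_closed[OF P V(1) U(1,3) V(3)] Res_closed[OF P V(1) U(1,3) V(4)] U(4) _ _ U(5)])
      (simp_all add: V(5,6) germ_Res[OF P V(1,3) U(1,3,2)] germ_Res[OF P V(1,4) U(1,3,2)])
qed

lemma stalk_comm_group:
  assumes P: "is_presheaf X F" and x: "x \<in> topspace X"
  shows "comm_group (stalk X F x)"
proof (rule comm_groupI)
  have one: "\<one>\<^bsub>stalk X F x\<^esub> = germ X F x (topspace X) \<one>\<^bsub>Sec F (topspace X)\<^esub>"
    by (simp add: stalk_def)
  fix a assume a: "a \<in> carrier (stalk X F x)"
  obtain U s where U: "openin X U" "x \<in> U" "s \<in> carrier (Sec F U)" "a = germ X F x U s"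
    using a by (rule stalkE)
  interpret G: comm_group "Sec F U" using presheaf_comm_group[OF P U(1)] .
  show "\<one>\<^bsub>stalk X F x\<^esub> \<otimes>\<^bsub>stalk X F x\<^esub> a = a"
    unfolding stalk_one[OF P U(1,2)] U(4) using stalk_mult[OF P U(1,2) _ U(3)] U(3) by simp
  have "germ X F x U (inv\<^bsub>Sec F U\<^esub> s) \<otimes>\<^bsub>stalk X F x\<^esub> a = \<one>\<^bsub>stalk X F x\<^esub>"
    unfolding stalk_one[OF P U(1,2)] U(4) using stalk_mult[OF P U(1,2) _ U(3)] U(3) by simp
  then show "\<exists>y\<in>carrier (stalk X F x). y \<otimes>\<^bsub>stalk X F x\<^esub> a = \<one>\<^bsub>stalk X F x\<^esub>"
    using germ_in_stalk[OF U(1,2) G.inv_closed[OF U(3)]] by blast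
next
  show "\<one>\<^bsub>stalk X F x\<^esub> \<in> carrier (stalk X F x)"
    using stalk_one[OF P openin_topspace x] germ_in_stalk[OF openin_topspace x Sec_one_closed[OF P openin_topspace]]
    by simp
next
  fix a b assume ab: "a \<in> carrier (stalk X F x)" "b \<in> carrier (stalk X F x)"
  obtain U s t where U: "openin X U" "x \<in> U" "s \<in> carrier (Sec F U)" "t \<in> carrier (Sec F U)"
    "a = germ X F x U s" "b = germ X F x U t"
    using stalkE2[OF P ab] .
  interpret G: comm_group "Sec F U" using presheaf_comm_group[OF P U(1)] .
  show "a \<otimes>\<^bsub>stalk X F x\<^esub> b \<in> carrier (stalk X F x)"
    unfolding U(5,6) stalk_mult[OF P U(1,2,3,4)] using U by (intro germ_in_stalk) auto
  show "a \<otimes>\<^bsub>stalk X F x\<^esub> b = b \<otimes>\<^bsub>stalk X F x\<^esub> a"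
    unfolding U(5,6) stalk_mult[OF P U(1,2,3,4)] stalk_mult[OF P U(1,2,4,3)] G.m_comm[OF U(3,4)] ..
next
  fix a b c assume abc: "a \<in> carrier (stalk X F x)" "b \<in> carrier (stalk X F x)" "c \<in> carrier (stalk X F x)"
  obtain U s t r where U: "openin X U" "x \<in> U" and s: "s \<in> carrier (Sec F U)" "t \<in> carrier (Sec F U)"
    "r \<in> carrier (Sec F U)" and eq: "a = germ X F x U s" "b = germ X F x U t" "c = germ X F x U r"
    using stalkE3[OF P abc] .
  interpret G: comm_group "Sec F U" using presheaf_comm_group[OF P U(1)] .
  show "a \<otimes>\<^bsub>stalk X F x\<^esub> b \<otimes>\<^bsub>stalk X F x\<^esub> c = a \<otimes>\<^bsub>stalk X F x\<^esub> (b \<otimes>\<^bsub>stalk X F x\<^esub> c)"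
    unfolding eq using s by (simp add: stalk_mult[OF P U] G.m_assoc)
qed


section \<open>Sections of a sheaf as families of germs\<close>

text \<open>The open sets on which \<open>s\<close> and \<open>t\<close> agree cover
  \<open>U\<close>, so both glue the restrictions of \<open>s\<close>, and gluing is unique. From
  here on sections are compared pointwise.\<close>

lemma sheaf_section_eqI:
  assumes F: "is_sheaf X F" and U: "openin X U" and s: "s \<in> carrier (Sec F U)" and t: "t \<in> carrier (Sec F U)"
    and eq: "\<And>x. x \<in> U \<Longrightarrow> germ X F x U s = germ X F x U t"
  shows "s = t"
proof -
  have P: "is_presheaf X F" using F by (rule sheaf_presheaf)
  define \<V> where "\<V> = {W. openin X W \<and> W \<subseteq> U \<and> Res F U W s = Res F U W t}"
  have "x \<in> \<Union>\<V>" if x: "x \<in> U" for x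
  proof -
    obtain W where "openin X W" "x \<in> W" "W \<subseteq> U" "W \<subseteq> U" "Res F U W s = Res F U W t"
      using eq[OF x] U x t by (rule germ_eqE)
    then show ?thesis unfolding \<V>_def by blast
  qed
  then have Un: "\<Union>\<V> = U" by (auto simp: \<V>_def)
  have "\<exists>!r. r \<in> carrier (Sec F (\<Union>\<V>)) \<and> (\<forall>V\<in>\<V>. Res F (\<Union>\<V>) V r = Res F U V s)"
  proof (rule F[unfolded is_sheaf_def, THEN conjunct2, rule_format])
    fix V assume "V \<in> \<V>"
    then have "openin X V" "V \<subseteq> U" by (auto simp: \<V>_def)
    then show "openin X V \<and> Res F U V s \<in> carrier (Sec F V)"
      using Res_closed[OF P U _ _ s] by blast
  next
    fix V W assume "V \<in> \<V>" "W \<in> \<V>"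
    then have *: "openin X V" "openin X W" "V \<subseteq> U" "W \<subseteq> U" "openin X (V \<inter> W)" by (auto simp: \<V>_def)
    show "Res F V (V \<inter> W) (Res F U V s) = Res F W (V \<inter> W) (Res F U W s)"
      using Res_Res[OF P U *(1) *(5) *(3) _ s] Res_Res[OF P U *(2) *(5) *(4) _ s] by simp
  qed
  moreover have "\<forall>V\<in>\<V>. Res F U V t = Res F U V s" by (simp add: \<V>_def)
  ultimately show ?thesis
    using s t unfolding Un by blast
qed

text \<open>Compatibility on overlaps is automatic: there two local sections have the same germs,
  hence coincide by \<open>sheaf_section_eqI\<close>.\<close>

lemma sheaf_glue_germs:
  assumes F: "is_sheaf X F" and U: "openin X U"
    and loc: "\<And>x. x \<in> U \<Longrightarrow> \<exists>N t. openin X N \<and> x \<in> N \<and> N \<subseteq> U \<and> t \<in> carrier (Sec F N) \<and>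
      (\<forall>z\<in>N. e z = germ X F z N t)"
  shows "\<exists>s\<in>carrier (Sec F U). \<forall>x\<in>U. germ X F x U s = e x"
proof -
  have P: "is_presheaf X F" using F by (rule sheaf_presheaf)
  define \<V> where "\<V> = {N. openin X N \<and> N \<subseteq> U \<and> (\<exists>t\<in>carrier (Sec F N). \<forall>z\<in>N. e z = germ X F z N t)}"
  define \<sigma> where "\<sigma> N = (SOME t. t \<in> carrier (Sec F N) \<and> (\<forall>z\<in>N. e z = germ X F z N t))" for N
  have \<sigma>: "\<sigma> N \<in> carrier (Sec F N) \<and> (\<forall>z\<in>N. e z = germ X F z N (\<sigma> N))" if "N \<in> \<V>" for N
    unfolding \<sigma>_def by (rule someI_ex) (use that in \<open>auto simp: \<V>_def\<close>)
  have "x \<in> \<Union>\<V>" if "x \<in> U" for x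
    using loc[OF that] unfolding \<V>_def by blast
  then have Un: "\<Union>\<V> = U" by (auto simp: \<V>_def)
  have "\<exists>!r. r \<in> carrier (Sec F (\<Union>\<V>)) \<and> (\<forall>V\<in>\<V>. Res F (\<Union>\<V>) V r = \<sigma> V)"
  proof (rule F[unfolded is_sheaf_def, THEN conjunct2, rule_format])
    fix V assume "V \<in> \<V>"
    then show "openin X V \<and> \<sigma> V \<in> carrier (Sec F V)"
      using \<sigma> by (auto simp: \<V>_def)
  next
    fix V W assume VW: "V \<in> \<V>" "W \<in> \<V>"
    then have *: "openin X V" "openin X W" "openin X (V \<inter> W)" by (auto simp: \<V>_def)
    have s: "\<sigma> V \<in> carrier (Sec F V)" "\<sigma> W \<in> carrier (Sec F W)" using \<sigma> VW by blast+
    show "Res F V (V \<inter> W) (\<sigma> V) = Res F W (V \<inter> W) (\<sigma> W)"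
    proof (rule sheaf_section_eqI[OF F *(3)])
      fix x assume x: "x \<in> V \<inter> W"
      then show "germ X F x (V \<inter> W) (Res F V (V \<inter> W) (\<sigma> V)) = germ X F x (V \<inter> W) (Res F W (V \<inter> W) (\<sigma> W))"
        using germ_Res[OF P *(1) s(1) *(3) _ x] germ_Res[OF P *(2) s(2) *(3) _ x]
          \<sigma>[OF VW(1)] \<sigma>[OF VW(2)] by (metis Int_iff inf_le1 inf_le2)
    qed (use Res_closed[OF P *(1,3) _ s(1)] Res_closed[OF P *(2,3) _ s(2)] in auto)
  qed
  then obtain r where r: "r \<in> carrier (Sec F U)" "\<And>V. V \<in> \<V> \<Longrightarrow> Res F U V r = \<sigma> V"
    unfolding Un by blast
  show ?thesis
  proof (intro bexI[OF _ r(1)] ballI)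
    fix x assume "x \<in> U"
    then obtain V where V: "V \<in> \<V>" "x \<in> V" using Un by blast
    then have "openin X V" "V \<subseteq> U" by (auto simp: \<V>_def)
    then show "germ X F x U r = e x"
      using germ_Res[OF P U r(1) _ _ V(2)] r(2)[OF V(1)] \<sigma>[OF V(1)] V(2) by auto
  qed
qed


section \<open>Open sets over which a sheaf is constant\<close>

text \<open>Constancy phrased without a reference group or a chosen trivialization: the sections
  over \<open>V\<close> themselves play the role of the constant group.\<close>

definition const_on :: "'a topology \<Rightarrow> ('a, 'g) presheaf \<Rightarrow> 'a set \<Rightarrow> bool" where
  "const_on X F V \<longleftrightarrow> openin X V \<and>
     (\<forall>y\<in>V. bij_betw (germ X F y V) (carrier (Sec F V)) (carrier (stalk X F y)))"

lemma const_on_open: "const_on X F V \<Longrightarrow> openin X V"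
  and const_on_bij: "const_on X F V \<Longrightarrow> y \<in> V \<Longrightarrow>
    bij_betw (germ X F y V) (carrier (Sec F V)) (carrier (stalk X F y))"
  by (auto simp: const_on_def)

lemma const_on_injD:
  "const_on X F V \<Longrightarrow> y \<in> V \<Longrightarrow> s \<in> carrier (Sec F V) \<Longrightarrow> t \<in> carrier (Sec F V) \<Longrightarrow>
    germ X F y V s = germ X F y V t \<Longrightarrow> s = t"
  by (meson bij_betw_imp_inj_on const_on_bij inj_onD)

lemma const_on_surjE:
  assumes "const_on X F V" "y \<in> V" "g \<in> carrier (stalk X F y)"
  obtains s where "s \<in> carrier (Sec F V)" "germ X F y V s = g"
  using bij_betw_imp_surj_on[OF const_on_bij[OF assms(1,2)]] assms(3) by (metis imageE)

lemma const_onI: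
  assumes P: "is_presheaf X F" and V: "openin X V"
    and inj: "\<And>y s t. \<lbrakk>y \<in> V; s \<in> carrier (Sec F V); t \<in> carrier (Sec F V);
      germ X F y V s = germ X F y V t\<rbrakk> \<Longrightarrow> s = t"
    and surj: "\<And>y N t. \<lbrakk>y \<in> N; openin X N; N \<subseteq> V; t \<in> carrier (Sec F N)\<rbrakk> \<Longrightarrow>
      \<exists>s\<in>carrier (Sec F V). germ X F y V s = germ X F y N t"
  shows "const_on X F V"
  unfolding const_on_def
proof (intro conjI V ballI)
  fix y assume y: "y \<in> V"
  have "g \<in> germ X F y V ` carrier (Sec F V)" if g: "g \<in> carrier (stalk X F y)" for g
  proof -
    obtain N t where N: "openin X N" "y \<in> N" "N \<subseteq> V" "t \<in> carrier (Sec F N)" "g = germ X F y N t"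
      using stalkE_within[OF P g V y] .
    show ?thesis
      using surj[OF N(2,1,3,4)] N(5) by force
  qed
  then show "bij_betw (germ X F y V) (carrier (Sec F V)) (carrier (stalk X F y))"
    unfolding bij_betw_def using inj[OF y] germ_in_stalk[OF V y] by (auto intro!: inj_onI)
qed

lemma continuous_map_to_discrete_iff:
  "continuous_map Y (discrete_topology A) f \<longleftrightarrow>
     f \<in> topspace Y \<rightarrow> A \<and> (\<forall>y\<in>topspace Y. \<exists>N. openin Y N \<and> y \<in> N \<and> (\<forall>z\<in>N. f z = f y))"
  (is "?l \<longleftrightarrow> ?r")
proof
  assume l: ?l
  then have A: "f \<in> topspace Y \<rightarrow> A" by (simp add: continuous_map_def)
  have "\<exists>N. openin Y N \<and> y \<in> N \<and> (\<forall>z\<in>N. f z = f y)" if "y \<in> topspace Y" for y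
  proof (intro exI conjI)
    have "openin (discrete_topology A) {f y}"
      using A that by auto
    then show "openin Y {z \<in> topspace Y. f z \<in> {f y}}"
      using l unfolding continuous_map_def by blast
  qed (use that in auto)
  with A show ?r by blast
next
  assume r: ?r
  have "openin Y {z \<in> topspace Y. f z \<in> U}" for U
  proof (subst openin_subopen, intro ballI)
    fix y assume y: "y \<in> {z \<in> topspace Y. f z \<in> U}"
    then obtain N where "openin Y N" "y \<in> N" "\<forall>z\<in>N. f z = f y" using r by blast
    then show "\<exists>T. openin Y T \<and> y \<in> T \<and> T \<subseteq> {z \<in> topspace Y. f z \<in> U}"
      using y openin_subset by (intro exI[of _ N]) fastforce
  qed
  with r show ?l by (auto simp: continuous_map_def)
qed

lemma Sec_constant_sheaf:
  assumes "openin X W"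
  shows "f \<in> carrier (Sec (constant_sheaf X A) W) \<longleftrightarrow>
    f \<in> (\<Pi>\<^sub>E y\<in>W. carrier A) \<and> (\<forall>y\<in>W. \<exists>N. openin X N \<and> y \<in> N \<and> N \<subseteq> W \<and> (\<forall>z\<in>N. f z = f y))"
proof -
  have "topspace (subtopology X W) = W"
    using openin_subset[OF assms] by (rule topspace_subtopology_subset)
  then show ?thesis
    by (simp add: constant_sheaf_def continuous_map_to_discrete_iff
        openin_open_subtopology[OF assms] PiE_def conj_ac)
qed

lemma constant_sheaf_simps:
  "Res (constant_sheaf X A) U V f = restrict f V"
  "f \<otimes>\<^bsub>Sec (constant_sheaf X A) U\<^esub> g = (\<lambda>x\<in>U. f x \<otimes>\<^bsub>A\<^esub> g x)"
  by (simp_all add: constant_sheaf_def)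

text \<open>The trivialization over \<open>U\<close> sends a section \<open>t\<close> to the function whose value at \<open>y\<close> is the
  section over \<open>U\<close> with the same germ at \<open>y\<close> as \<open>t\<close>.\<close>

lemma locally_constant_sheafI:
  fixes F :: "('a, 'g) presheaf"
  assumes F: "is_sheaf X F" and cov: "\<And>x. x \<in> topspace X \<Longrightarrow> \<exists>U. x \<in> U \<and> const_on X F U"
  shows "locally_constant_sheaf X F"
  unfolding locally_constant_sheaf_def
proof (intro conjI F ballI)
  have P: "is_presheaf X F" using F by (rule sheaf_presheaf)
  fix x assume "x \<in> topspace X"
  then obtain U where xU: "x \<in> U" and U: "const_on X F U" using cov by blast
  have oU: "openin X U" using U by (rule const_on_open)
  define j where "j y = the_inv_into (carrier (Sec F U)) (germ X F y U)" for y
  have j: "j y g \<in> carrier (Sec F U)" "germ X F y U (j y g) = g"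
    if "y \<in> U" "g \<in> carrier (stalk X F y)" for y g
    using const_on_bij[OF U that(1)] that(2) unfolding j_def bij_betw_def
    by (metis order_refl the_inv_into_into) (metis const_on_bij[OF U that(1)] f_the_inv_into_f_bij_betw that(2))
  have j_germ: "j y (germ X F y U a) = a" if "y \<in> U" "a \<in> carrier (Sec F U)" for y a
    using const_on_bij[OF U that(1)] that(2) unfolding j_def bij_betw_def by (auto intro: the_inv_into_f_f)
  define \<phi> where "\<phi> = (\<lambda>W\<in>{W. openin (subtopology X U) W}.
      \<lambda>t\<in>carrier (Sec F W). \<lambda>y\<in>W. j y (germ X F y W t))"
  let ?C = "constant_sheaf (subtopology X U) (Sec F U)"
  have op: "openin (subtopology X U) W \<longleftrightarrow> openin X W \<and> W \<subseteq> U" for W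
    by (rule openin_open_subtopology[OF oU])
  have SecC: "f \<in> carrier (Sec ?C W) \<longleftrightarrow> f \<in> (\<Pi>\<^sub>E y\<in>W. carrier (Sec F U)) \<and>
      (\<forall>y\<in>W. \<exists>N. openin X N \<and> y \<in> N \<and> N \<subseteq> W \<and> (\<forall>z\<in>N. f z = f y))"
    if W: "openin X W" "W \<subseteq> U" for f W
    using W Sec_constant_sheaf[of "subtopology X U" W f "Sec F U"]
    by (simp add: op) (meson subset_trans)
  have \<phi>: "\<phi> W t = (\<lambda>y\<in>W. j y (germ X F y W t))"
    if W: "openin X W" "W \<subseteq> U" and t: "t \<in> carrier (Sec F W)" for W t
    using that by (simp add: \<phi>_def op)
  have germ_\<phi>: "\<phi> W t y \<in> carrier (Sec F U)" "germ X F y U (\<phi> W t y) = germ X F y W t"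
    if W: "openin X W" "W \<subseteq> U" and t: "t \<in> carrier (Sec F W)" and y: "y \<in> W" for W t y
    using j[of y "germ X F y W t"] germ_in_stalk[OF W(1) y t] y W(2) by (auto simp: \<phi>[OF W t])
  have \<phi>_eqI: "\<phi> W t y = a"
    if W: "openin X W" "W \<subseteq> U" and t: "t \<in> carrier (Sec F W)" and y: "y \<in> W"
      and a: "a \<in> carrier (Sec F U)" "germ X F y U a = germ X F y W t" for W t y a
    using const_on_injD[OF U _ germ_\<phi>(1)[OF W t y] a(1)] germ_\<phi>(2)[OF W t y] a(2) y W(2) by auto
  have cl: "\<phi> W t \<in> carrier (Sec ?C W)"
    if W: "openin X W" "W \<subseteq> U" and t: "t \<in> carrier (Sec F W)" for W t
    unfolding SecC[OF W]
  proof (intro conjI ballI)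
    show "\<phi> W t \<in> (\<Pi>\<^sub>E y\<in>W. carrier (Sec F U))"
      using germ_\<phi>(1)[OF W t] by (auto simp: \<phi>[OF W t])
    fix y assume y: "y \<in> W"
    obtain N where N: "openin X N" "y \<in> N" "N \<subseteq> U" "N \<subseteq> W" "Res F U N (\<phi> W t y) = Res F W N t"
      using germ_eqE[OF germ_\<phi>(2)[OF W t y] W(1) y t] .
    \<comment> \<open>The section over \<open>U\<close> with the germ of \<open>t\<close> at
      \<open>y\<close> agrees with \<open>t\<close> on all of \<open>N\<close>, so it is the right
      value at \<open>z\<close> too.\<close>
    have "\<phi> W t z = \<phi> W t y" if z: "z \<in> N" for z
    proof (rule \<phi>_eqI[OF W t _ germ_\<phi>(1)[OF W t y]])
      show "z \<in> W" using z N by blast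
      show "germ X F z U (\<phi> W t y) = germ X F z W t"
        using germ_Res[OF P oU germ_\<phi>(1)[OF W t y] N(1,3) z] germ_Res[OF P W(1) t N(1,4) z] N(5) by simp
    qed
    then show "\<exists>N. openin X N \<and> y \<in> N \<and> N \<subseteq> W \<and> (\<forall>z\<in>N. \<phi> W t z = \<phi> W t y)"
      using N by blast
  qed
  have hom: "\<phi> W \<in> hom (Sec F W) (Sec ?C W)" if W: "openin X W" "W \<subseteq> U" for W
  proof (rule homI)
    fix s t assume s: "s \<in> carrier (Sec F W)" and t: "t \<in> carrier (Sec F W)"
    have st: "s \<otimes>\<^bsub>Sec F W\<^esub> t \<in> carrier (Sec F W)" using Sec_mult_closed[OF P W(1) s t] .
    show "\<phi> W (s \<otimes>\<^bsub>Sec F W\<^esub> t) = \<phi> W s \<otimes>\<^bsub>Sec ?C W\<^esub> \<phi> W t"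
    proof
      fix y show "\<phi> W (s \<otimes>\<^bsub>Sec F W\<^esub> t) y = (\<phi> W s \<otimes>\<^bsub>Sec ?C W\<^esub> \<phi> W t) y"
      proof (cases "y \<in> W")
        case y: True
        have yU: "y \<in> U" using y W by blast
        have "\<phi> W (s \<otimes>\<^bsub>Sec F W\<^esub> t) y = \<phi> W s y \<otimes>\<^bsub>Sec F U\<^esub> \<phi> W t y"
          by (rule \<phi>_eqI[OF W st y Sec_mult_closed[OF P oU germ_\<phi>(1)[OF W s y] germ_\<phi>(1)[OF W t y]]])
            (simp add: stalk_mult[OF P oU yU germ_\<phi>(1)[OF W s y] germ_\<phi>(1)[OF W t y], symmetric]
              stalk_mult[OF P W(1) y s t, symmetric] germ_\<phi>(2)[OF W s y] germ_\<phi>(2)[OF W t y])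
        then show ?thesis using y by (simp add: constant_sheaf_simps)
      next
        case False
        then show ?thesis by (simp add: constant_sheaf_simps \<phi>[OF W st])
      qed
    qed
  qed (rule cl[OF W])
  have bij: "bij_betw (\<phi> W) (carrier (Sec F W)) (carrier (Sec ?C W))" if W: "openin X W" "W \<subseteq> U" for W
    unfolding bij_betw_def
  proof (intro conjI inj_onI)
    fix s t assume s: "s \<in> carrier (Sec F W)" and t: "t \<in> carrier (Sec F W)" and eq: "\<phi> W s = \<phi> W t"
    show "s = t"
      by (rule sheaf_section_eqI[OF F W(1) s t])
        (metis eq germ_\<phi>(2)[OF W s] germ_\<phi>(2)[OF W t])
  next
    have "f \<in> \<phi> W ` carrier (Sec F W)" if f: "f \<in> carrier (Sec ?C W)" for f
    proof -
      have fE: "f \<in> (\<Pi>\<^sub>E y\<in>W. carrier (Sec F U))"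
        and fl: "\<And>y. y \<in> W \<Longrightarrow> \<exists>N. openin X N \<and> y \<in> N \<and> N \<subseteq> W \<and> (\<forall>z\<in>N. f z = f y)"
        using f unfolding SecC[OF W] by blast+
      \<comment> \<open>Where \<open>f\<close> is constant, the prescribed germs are those of one
        section over \<open>U\<close>, so they can be glued.\<close>
      have "\<exists>t\<in>carrier (Sec F W). \<forall>y\<in>W. germ X F y W t = germ X F y U (f y)"
      proof (rule sheaf_glue_germs[OF F W(1)])
        fix y assume y: "y \<in> W"
        obtain N where N: "openin X N" "y \<in> N" "N \<subseteq> W" "\<forall>z\<in>N. f z = f y"
          using fl[OF y] by blast
        have fy: "f y \<in> carrier (Sec F U)" using fE y by auto
        have NU: "N \<subseteq> U" using N W by blast
        have "\<forall>z\<in>N. germ X F z U (f z) = germ X F z N (Res F U N (f y))"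
          using germ_Res[OF P oU fy N(1) NU] N(4) by simp
        then show "\<exists>N t. openin X N \<and> y \<in> N \<and> N \<subseteq> W \<and> t \<in> carrier (Sec F N) \<and>
            (\<forall>z\<in>N. germ X F z U (f z) = germ X F z N t)"
          by (intro exI[of _ N] exI[of _ "Res F U N (f y)"] conjI N(1-3) Res_closed[OF P oU N(1) NU fy])
      qed
      then obtain t where t: "t \<in> carrier (Sec F W)" "\<And>y. y \<in> W \<Longrightarrow> germ X F y W t = germ X F y U (f y)"
        by blast
      have "\<phi> W t y = f y" for y
      proof (cases "y \<in> W")
        case True
        have "f y \<in> carrier (Sec F U)" using fE True by (rule PiE_mem)
        then show ?thesis by (rule \<phi>_eqI[OF W t(1) True _ t(2)[OF True, symmetric]])
      next
        case False
        have "f y = undefined" using fE False by (rule PiE_arb)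
        then show ?thesis using False by (simp only: \<phi>[OF W t(1)] restrict_apply if_False)
      qed
      then have "\<phi> W t = f" ..
      then show ?thesis using t(1) by blast
    qed
    then show "\<phi> W ` carrier (Sec F W) = carrier (Sec ?C W)"
      using cl[OF W] by blast
  qed
  have "\<phi> \<in> sheaf_hom (subtopology X U) F ?C"
    unfolding sheaf_hom_def mem_Collect_eq op
  proof (intro CollectI conjI allI impI ballI)
    show "\<phi> \<in> extensional {Ua. openin X Ua \<and> Ua \<subseteq> U}" by (simp add: \<phi>_def op)
    fix W assume W: "openin X W \<and> W \<subseteq> U"
    then show "\<phi> W \<in> extensional (carrier (Sec F W))" by (simp add: \<phi>_def op)
    show "\<phi> W \<in> hom (Sec F W) (Sec ?C W)" using hom W by blast
    fix V s assume V: "openin X V \<and> V \<subseteq> U" "V \<subseteq> W" and s: "s \<in> carrier (Sec F W)"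
    have "germ X F y V (Res F W V s) = germ X F y W s" if "y \<in> V" for y
      using germ_Res[OF P _ s _ V(2) that] W V by blast
    then have "\<phi> V (Res F W V s) = restrict (\<phi> W s) V"
      using \<phi>[of W s] \<phi>[of V "Res F W V s"] Res_closed[OF P _ _ V(2) s] W V s
      by (auto simp: restrict_def fun_eq_iff)
    then show "\<phi> V (Res F W V s) = Res ?C W V (\<phi> W s)"
      by (simp add: constant_sheaf_simps)
  qed
  then have "\<phi> \<in> sheaf_iso (subtopology X U) F ?C"
    using hom bij by (auto simp: sheaf_iso_def iso_def op)
  then show "\<exists>U (A :: 'g monoid). openin X U \<and> x \<in> U \<and> comm_group A \<and>
        sheaf_iso (subtopology X U) F (constant_sheaf (subtopology X U) A) \<noteq> {}"
    using oU xU presheaf_comm_group[OF P oU] by blast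
qed

lemma locally_constant_sheaf_is_sheaf: "locally_constant_sheaf X F \<Longrightarrow> is_sheaf X F"
  by (simp add: locally_constant_sheaf_def)

text \<open>Over a connected \<open>V\<close> inside a trivializing set, the locally constant
  functions are constant, and passing to the germ at \<open>y\<close> amounts to evaluating at
  \<open>y\<close>.\<close>

lemma locally_constant_sheaf_const_on:
  fixes F :: "('a, 'g) presheaf"
  assumes F: "locally_constant_sheaf X F" and x: "x \<in> topspace X"
  obtains U where "openin X U" "x \<in> U"
    "\<And>V. \<lbrakk>openin X V; V \<subseteq> U; connectedin X V\<rbrakk> \<Longrightarrow> const_on X F V"
proof -
  have P: "is_presheaf X F" using F by (simp add: locally_constant_sheaf_def sheaf_presheaf)
  obtain U and A :: "'g monoid" and \<phi> where oU: "openin X U" and xU: "x \<in> U"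
    and \<phi>: "\<phi> \<in> sheaf_iso (subtopology X U) F (constant_sheaf (subtopology X U) A)"
    using F x unfolding locally_constant_sheaf_def by blast
  let ?C = "constant_sheaf (subtopology X U) A"
  have op: "openin (subtopology X U) W \<longleftrightarrow> openin X W \<and> W \<subseteq> U" for W
    by (rule openin_open_subtopology[OF oU])
  have SecC: "f \<in> carrier (Sec ?C W) \<longleftrightarrow> f \<in> (\<Pi>\<^sub>E y\<in>W. carrier A) \<and>
      (\<forall>y\<in>W. \<exists>N. openin X N \<and> y \<in> N \<and> N \<subseteq> W \<and> (\<forall>z\<in>N. f z = f y))"
    if W: "openin X W" "W \<subseteq> U" for f W
    using W Sec_constant_sheaf[of "subtopology X U" W f A]
    by (simp add: op) (meson subset_trans)
  have bij: "bij_betw (\<phi> W) (carrier (Sec F W)) (carrier (Sec ?C W))" if W: "openin X W" "W \<subseteq> U" for W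
    using \<phi> W by (auto simp: sheaf_iso_def iso_def op)
  have nat: "\<phi> V (Res F W V s) = restrict (\<phi> W s) V"
    if "openin X W" "W \<subseteq> U" "openin X V" "V \<subseteq> W" "s \<in> carrier (Sec F W)" for V W s
  proof -
    have "V \<subseteq> U" using that by blast
    then show ?thesis
      using \<phi> that by (simp add: sheaf_iso_def sheaf_hom_def constant_sheaf_simps op)
  qed
  have "const_on X F V" if V: "openin X V" "V \<subseteq> U" and conn: "connectedin X V" for V
  proof (rule const_onI[OF P V(1)])
    have const: "f y = f z" if f: "f \<in> carrier (Sec ?C V)" and yz: "y \<in> V" "z \<in> V" for f y z
    proof -
      have "continuous_map (subtopology X V) (discrete_topology (carrier A)) f"
        using f V oU by (auto simp: constant_sheaf_def subtopology_subtopology Int_absorb1)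
      then have "connectedin (discrete_topology (carrier A)) (f ` V)"
        by (rule connectedin_continuous_map_image) (simp add: conn connectedin_absolute)
      then show ?thesis
        using yz by (auto simp: connectedin_discrete_topology)
    qed
    {
      fix y s t assume y: "y \<in> V" and s: "s \<in> carrier (Sec F V)" and t: "t \<in> carrier (Sec F V)"
        and eq: "germ X F y V s = germ X F y V t"
      obtain N where N: "openin X N" "y \<in> N" "N \<subseteq> V" "N \<subseteq> V" "Res F V N s = Res F V N t"
        using germ_eqE[OF eq V(1) y t] .
      have "restrict (\<phi> V s) N y = restrict (\<phi> V t) N y"
        using nat[OF V N(1,3) s] nat[OF V N(1,3) t] N(5) by simp
      then have e: "\<phi> V s y = \<phi> V t y" using N by simp
      have C: "\<phi> V s \<in> carrier (Sec ?C V)" "\<phi> V t \<in> carrier (Sec ?C V)"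
        using bij_betwE[OF bij[OF V]] s t by blast+
      have "\<phi> V s z = \<phi> V t z" for z
      proof (cases "z \<in> V")
        case True
        then show ?thesis
          using const[OF C(1) True y] const[OF C(2) True y] e by simp
      next
        case False
        have "\<phi> V s \<in> (\<Pi>\<^sub>E y\<in>V. carrier A)" "\<phi> V t \<in> (\<Pi>\<^sub>E y\<in>V. carrier A)"
          using C unfolding SecC[OF V] by blast+
        from PiE_arb[OF this(1) False] PiE_arb[OF this(2) False] show ?thesis by simp
      qed
      then have "\<phi> V s = \<phi> V t" ..
      then show "s = t"
        using bij_betw_imp_inj_on[OF bij[OF V]] s t by (meson inj_onD)
    }
    fix y N t assume y: "y \<in> N" and N: "openin X N" "N \<subseteq> V" and t: "t \<in> carrier (Sec F N)"
    have NU: "N \<subseteq> U" using N V by blast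
    have "\<phi> N t \<in> carrier (Sec ?C N)"
      using bij_betwE[OF bij[OF N(1) NU]] t by blast
    then have tA: "\<phi> N t \<in> (\<Pi>\<^sub>E y\<in>N. carrier A)"
      and "\<exists>M. openin X M \<and> y \<in> M \<and> M \<subseteq> N \<and> (\<forall>z\<in>M. \<phi> N t z = \<phi> N t y)"
      unfolding SecC[OF N(1) NU] using y by blast+
    then obtain M where M: "openin X M" "y \<in> M" "M \<subseteq> N" "\<And>z. z \<in> M \<Longrightarrow> \<phi> N t z = \<phi> N t y"
      by blast
    \<comment> \<open>The germ of \<open>t\<close> at \<open>y\<close> extends to \<open>V\<close>
      as the function that is constant with the value at \<open>y\<close>.\<close>
    have "(\<lambda>z\<in>V. \<phi> N t y) \<in> carrier (Sec ?C V)"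
      unfolding SecC[OF V] using tA y V(1) by auto
    then obtain s where s: "s \<in> carrier (Sec F V)" "\<phi> V s = (\<lambda>z\<in>V. \<phi> N t y)"
      using bij_betw_imp_surj_on[OF bij[OF V]] by (metis imageE)
    have MV: "M \<subseteq> V" and MU: "M \<subseteq> U" using M N V by blast+
    have "\<phi> M (Res F V M s) = \<phi> M (Res F N M t)"
      unfolding nat[OF V M(1) MV s(1)] nat[OF N(1) NU M(1,3) t] s(2)
      using M(3,4) MV by (auto simp: restrict_def fun_eq_iff)
    then have "Res F V M s = Res F N M t"
      using bij_betw_imp_inj_on[OF bij[OF M(1) MU]] Res_closed[OF P V(1) M(1) MV s(1)]
        Res_closed[OF P N(1) M(1,3) t] by (meson inj_onD)
    then have "germ X F y V s = germ X F y N t"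
      by (rule germ_eqI[OF P V(1) s(1) N(1) t M(1,2) MV M(3)])
    then show "\<exists>s\<in>carrier (Sec F V). germ X F y V s = germ X F y N t"
      using s(1) by blast
  qed
  then show ?thesis using that oU xU by blast
qed


section \<open>Monodromy of locally constant sheaves\<close>

definition sheaf_transport ::
    "'a topology \<Rightarrow> ('a, 'g) presheaf \<Rightarrow> 'a set \<Rightarrow> 'a \<Rightarrow> 'a \<Rightarrow> ('a, 'g) germ \<Rightarrow> ('a, 'g) germ" where
  "sheaf_transport X F V x y g = germ X F y V (the_inv_into (carrier (Sec F V)) (germ X F x V) g)"

lemma sheaf_transport_germ:
  assumes "const_on X F V" "x \<in> V" "s \<in> carrier (Sec F V)"
  shows "sheaf_transport X F V x y (germ X F x V s) = germ X F y V s"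
  unfolding sheaf_transport_def
  using the_inv_into_f_f[OF bij_betw_imp_inj_on[OF const_on_bij[OF assms(1,2)]] assms(3)] by simp

lemma locally_constant_sheaf_base:
  assumes F: "locally_constant_sheaf X F" and X: "locally_path_connected_space X"
    and W: "openin X W" "y \<in> W"
  shows "\<exists>V\<in>{V. path_connectedin X V \<and> const_on X F V}. y \<in> V \<and> V \<subseteq> W"
proof -
  have "y \<in> topspace X" using W openin_subset by blast
  then obtain U where U: "openin X U" "y \<in> U"
    and c: "\<And>V. \<lbrakk>openin X V; V \<subseteq> U; connectedin X V\<rbrakk> \<Longrightarrow> const_on X F V"
    using locally_constant_sheaf_const_on[OF F] by metis
  have "openin X (U \<inter> W)" "y \<in> U \<inter> W" using U W by auto
  then obtain V where V: "openin X V" "path_connectedin X V" "y \<in> V" "V \<subseteq> U \<inter> W"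
    using X unfolding locally_path_connected_space_alt neighbourhood_base_of by blast
  then show ?thesis
    using c[OF V(1) _ path_connectedin_imp_connectedin[OF V(2)]] by blast
qed

text \<open>Over a basic set each germ extends to a unique section, and transport reads that section
  at another point. The laws become identities between germs of one section.\<close>

lemma local_system_of_sheaf:
  assumes F: "locally_constant_sheaf X F" and X: "locally_path_connected_space X"
  shows "local_system X {V. path_connectedin X V \<and> const_on X F V} (\<lambda>x. carrier (stalk X F x))
    (sheaf_transport X F)"
proof -
  have P: "is_presheaf X F" using F locally_constant_sheaf_is_sheaf sheaf_presheaf by blast
  let ?B = "{V. path_connectedin X V \<and> const_on X F V}"
  show ?thesis
  proof (unfold_locales, goal_cases)
    case (1 V)
    then show ?case using const_on_open by blast
  next
    case (2 W y)
    then show ?case by (rule locally_constant_sheaf_base[OF F X])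
  next
    case (3 V x y f)
    then have V: "const_on X F V" by simp
    obtain s where s: "s \<in> carrier (Sec F V)" "germ X F x V s = f"
      using const_on_surjE[OF V 3(2,4)] .
    show ?case
      unfolding s(2)[symmetric] sheaf_transport_germ[OF V 3(2) s(1)]
      by (rule germ_in_stalk[OF const_on_open[OF V] 3(3) s(1)])
  next
    case (4 V x f)
    then have V: "const_on X F V" by simp
    obtain s where s: "s \<in> carrier (Sec F V)" "germ X F x V s = f"
      using const_on_surjE[OF V 4(2,3)] .
    show ?case
      unfolding s(2)[symmetric] sheaf_transport_germ[OF V 4(2) s(1)] ..
  next
    case (5 V x y z f)
    then have V: "const_on X F V" by simp
    obtain s where s: "s \<in> carrier (Sec F V)" "germ X F x V s = f"
      using const_on_surjE[OF V 5(2,5)] .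
    show ?case
      unfolding s(2)[symmetric] sheaf_transport_germ[OF V 5(2) s(1)] sheaf_transport_germ[OF V 5(3) s(1)] ..
  next
    case (6 V N x y f)
    then have V: "const_on X F V" and N: "const_on X F N" by simp_all
    have xV: "x \<in> V" "y \<in> V" using 6 by auto
    obtain s where s: "s \<in> carrier (Sec F V)" "germ X F x V s = f"
      using const_on_surjE[OF V xV(1) 6(6)] .
    have r: "Res F V N s \<in> carrier (Sec F N)"
      by (rule Res_closed[OF P const_on_open[OF V] const_on_open[OF N] 6(3) s(1)])
    have g: "germ X F z N (Res F V N s) = germ X F z V s" if "z \<in> N" for z
      by (rule germ_Res[OF P const_on_open[OF V] s(1) const_on_open[OF N] 6(3) that])
    have "sheaf_transport X F N x y f = sheaf_transport X F N x y (germ X F x N (Res F V N s))"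
      using g[OF 6(4)] s(2) by simp
    also have "\<dots> = germ X F y V s"
      using sheaf_transport_germ[OF N 6(4) r] g[OF 6(5)] by simp
    also have "\<dots> = sheaf_transport X F V x y f"
      using sheaf_transport_germ[OF V xV(1) s(1)] s(2) by simp
    finally show ?case .
  qed
qed

lemma pathin_topspace: "pathin X c \<Longrightarrow> t \<in> {0..1} \<Longrightarrow> c t \<in> topspace X"
  by (auto simp: pathin_def continuous_map_def Pi_iff)

lemma pathin_subtopology_iff:
  "pathin (subtopology X U) c \<longleftrightarrow> pathin X c \<and> c ` {0..1} \<subseteq> U"
  by (auto simp: pathin_def continuous_map_in_subtopology)

lemma path_connected_spaceD:
  assumes "path_connected_space X" "x \<in> topspace X" "y \<in> topspace X"
  shows "\<exists>c. pathin X c \<and> c 0 = x \<and> c 1 = y"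
  using assms unfolding path_connected_space_def by blast

text \<open>Germs of a section form a flat lift along every path in \<open>W\<close>, so a section
  is determined by one germ. Conversely a germ is continued along paths in \<open>W\<close>; by
  monodromy the result depends on the end point only, and the results glue to a section.\<close>

theorem const_on_simply_connected:
  assumes F: "locally_constant_sheaf X F" and X: "locally_path_connected_space X"
    and W: "openin X W" and sc: "simply_connected_space (subtopology X W)"
  shows "const_on X F W"
proof -
  have Sh: "is_sheaf X F" using F by (rule locally_constant_sheaf_is_sheaf)
  have P: "is_presheaf X F" using Sh by (rule sheaf_presheaf)
  let ?B = "{V. path_connectedin X V \<and> const_on X F V}"
  interpret local_system X ?B "\<lambda>x. carrier (stalk X F x)" "sheaf_transport X F"
    by (rule local_system_of_sheaf[OF F X])
  have pcW: "path_connected_space (subtopology X W)"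
    using sc by (simp add: simply_connected_space_def)
  have topW: "topspace (subtopology X W) = W"
    using openin_subset[OF W] by (rule topspace_subtopology_subset)
  have pathW: "pathin X c" "c ` {0..1} \<subseteq> W" "\<And>t. t \<in> {0..1} \<Longrightarrow> c t \<in> W"
    if "pathin (subtopology X W) c" for c
    using that unfolding pathin_subtopology_iff by auto
  have flat_germ: "flat c (\<lambda>t. germ X F (c t) W a) 0 1"
    if c: "pathin (subtopology X W) c" and a: "a \<in> carrier (Sec F W)" for c a
    unfolding flat_def
  proof (intro ballI conjI impI)
    fix t :: real assume t: "t \<in> {0..1}"
    have ct: "c t \<in> W" using pathW(3)[OF c t] .
    show mem: "germ X F (c t) W a \<in> carrier (stalk X F (c t))"
      by (rule germ_in_stalk[OF W ct a])
    fix V assume "V \<in> ?B" and cV: "c t \<in> V"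
    then have V: "const_on X F V" by simp
    obtain b where b: "b \<in> carrier (Sec F V)" "germ X F (c t) V b = germ X F (c t) W a"
      using const_on_surjE[OF V cV mem] .
    obtain N where N: "openin X N" "c t \<in> N" "N \<subseteq> V" "N \<subseteq> W" "Res F V N b = Res F W N a"
      using germ_eqE[OF b(2) W ct a] .
    obtain d where d: "d > 0" "\<And>u. u \<in> {0..1} \<Longrightarrow> \<bar>u - t\<bar> < d \<Longrightarrow> c u \<in> N"
      by (rule pathin_nhds[OF pathW(1)[OF c] N(1) t N(2)]) blast
    have "c u \<in> V \<and> germ X F (c u) W a = sheaf_transport X F V (c t) (c u) (germ X F (c t) W a)"
      if u: "u \<in> {0..1}" "\<bar>u - t\<bar> < d" for u
    proof
      have cu: "c u \<in> N" using d(2)[OF u] .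
      then show "c u \<in> V" using N by blast
      have "germ X F (c u) W a = germ X F (c u) V b"
        using germ_Res[OF P W a N(1,4) cu] germ_Res[OF P const_on_open[OF V] b(1) N(1,3) cu] N(5)
        by simp
      then show "germ X F (c u) W a = sheaf_transport X F V (c t) (c u) (germ X F (c t) W a)"
        unfolding b(2)[symmetric] sheaf_transport_germ[OF V cV b(1)] .
    qed
    then show "\<exists>d>0. \<forall>u\<in>{0..1}. \<bar>u - t\<bar> < d \<longrightarrow> c u \<in> V \<and>
        germ X F (c u) W a = sheaf_transport X F V (c t) (c u) (germ X F (c t) W a)"
      using d(1) by (intro exI[of _ d]) simp
  qed
  show ?thesis
  proof (rule const_onI[OF P W])
    fix y a b assume y: "y \<in> W" and a: "a \<in> carrier (Sec F W)" and b: "b \<in> carrier (Sec F W)"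
      and eq: "germ X F y W a = germ X F y W b"
    show "a = b"
    proof (rule sheaf_section_eqI[OF Sh W a b])
      fix z assume z: "z \<in> W"
      obtain c where c: "pathin (subtopology X W) c" "c 0 = y" "c 1 = z"
        using path_connected_spaceD[OF pcW, unfolded topW, OF y z] by blast
      have "c ` {0..1} \<subseteq> topspace X" using pathW(2)[OF c(1)] openin_subset[OF W] by blast
      from flat_unique[OF this flat_germ[OF c(1) a] flat_germ[OF c(1) b]]
      show "germ X F z W a = germ X F z W b"
        using eq c by simp
    qed
  next
    fix y N t assume y: "y \<in> N" and N: "openin X N" "N \<subseteq> W" and t: "t \<in> carrier (Sec F N)"
    have yW: "y \<in> W" using y N by blast
    define g where "g = germ X F y N t"
    have g: "g \<in> carrier (stalk X F y)" unfolding g_def by (rule germ_in_stalk[OF N(1) y t])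
    \<comment> \<open>The continuation of \<open>g\<close> to \<open>z\<close>. The fact
      \<open>E\<close> that follows shows that every path and every lift give the same
      value.\<close>
    define E where "E z = (SOME f. \<exists>c e. pathin (subtopology X W) c \<and> c 0 = y \<and> c 1 = z \<and>
      flat c e 0 1 \<and> e 0 = g \<and> e 1 = f)" for z
    have E: "E z = e 1" if c: "pathin (subtopology X W) c" "c 0 = y" "c 1 = z" "flat c e 0 1" "e 0 = g"
      for z c e
    proof -
      have "\<exists>f c e. pathin (subtopology X W) c \<and> c 0 = y \<and> c 1 = z \<and> flat c e 0 1 \<and> e 0 = g \<and> e 1 = f"
        using c by blast
      from someI_ex[OF this] obtain c' e' where c': "pathin (subtopology X W) c'" "c' 0 = y" "c' 1 = z"
        "flat c' e' 0 1" "e' 0 = g" "e' 1 = E z"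
        unfolding E_def by blast
      \<comment> \<open>The homotopy is found inside \<open>W\<close> and then read in
        \<open>X\<close>, where the local system lives.\<close>
      have "path_homotopic X y z c' c"
        by (rule path_homotopic_subtopologyD[OF simply_connected_path_homotopic[OF sc c'(1-3) c(1-3)]])
      from monodromy[OF this c'(4) c(4)] show ?thesis
        using c' c by simp
    qed
    have lift: "\<exists>c e. pathin (subtopology X W) c \<and> c 0 = y \<and> c 1 = z \<and> flat c e 0 1 \<and> e 0 = g"
      if z: "z \<in> W" for z
    proof -
      obtain c where c: "pathin (subtopology X W) c" "c 0 = y" "c 1 = z"
        using path_connected_spaceD[OF pcW, unfolded topW, OF yW z] by blast
      have "g \<in> carrier (stalk X F (c 0))" using g c by simp
      from flat_exists[OF pathW(1)[OF c(1)] this] obtain e where "flat c e 0 1" "e 0 = g" .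
      then show ?thesis using c by blast
    qed
    \<comment> \<open>A path to \<open>z\<close> is prolonged to \<open>z'\<close> inside
      \<open>V\<close>, and on this last piece a flat lift is transport over \<open>V\<close>. For
      this the basic sets are path connected.\<close>
    have step: "E z \<in> carrier (stalk X F z)" "E z' = sheaf_transport X F V z z' (E z)"
      if V: "V \<in> ?B" "V \<subseteq> W" and zV: "z \<in> V" "z' \<in> V" for V z z'
    proof -
      obtain c e where c: "pathin (subtopology X W) c" "c 0 = y" "c 1 = z" "flat c e 0 1" "e 0 = g"
        using lift[of z] zV V(2) by blast
      have Ez: "E z = e 1" by (rule E[OF c])
      then show "E z \<in> carrier (stalk X F z)"
        using flat_mem[OF c(4), of 1] c(3) by simp
      have pcV: "path_connected_space (subtopology X V)" "V \<subseteq> topspace X"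
        using V by (auto simp: path_connectedin_def)
      obtain k where k: "pathin (subtopology X V) k" "k 0 = z" "k 1 = z'"
        using path_connected_spaceD[OF pcV(1), unfolded topspace_subtopology_subset[OF pcV(2)], OF zV] by blast
      have kV: "pathin X k" "k ` {0..1} \<subseteq> V" using k(1) unfolding pathin_subtopology_iff by auto
      have kW: "pathin (subtopology X W) k" using kV V(2) unfolding pathin_subtopology_iff by auto
      define m where "m = loop_join c k"
      have m: "pathin (subtopology X W) m" "m 0 = y" "m 1 = z'"
        unfolding m_def using c k kW by (auto intro: pathin_join)
      have "g \<in> carrier (stalk X F (m 0))" using g m by simp
      from flat_exists[OF pathW(1)[OF m(1)] this] obtain e' where e': "flat m e' 0 1" "e' 0 = g" .
      \<comment> \<open>This path equals \<open>c\<close> on the unit interval only. Applying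
        \<open>E\<close> to it exhibits \<open>E z\<close> as a value of the new lift
        \<open>e'\<close>.\<close>
      have half: "pathin (subtopology X W) (\<lambda>t. m (t / 2))"
        using pathin_subpath_of[OF m(1), of 0 "1/2"] by (simp add: subpath_of_def)
      have m_half: "m (1 / 2) = z" by (simp add: m_def loop_join_def c)
      have "E z = e' (1 / 2)"
        using E[OF half _ _ flat_first_half[OF e'(1)]] m(2) m_half e'(2) by simp
      moreover have "m ` {1/2..1} \<subseteq> V"
      proof (rule image_subsetI)
        fix t :: real assume t: "t \<in> {1/2..1}"
        show "m t \<in> V"
        \<comment> \<open>\<open>loop_join\<close> assigns the time 1/2 to its first half, so the
          formula for \<open>k\<close> starts only after it.\<close>
        proof (cases "t = 1/2")
          case True
          show ?thesis using zV(1) unfolding True m_half .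
        next
          case False
          then have "m t = k (2 * t - 1)" "2 * t - 1 \<in> {0..1}" using t by (auto simp: m_def loop_join_def)
          then show ?thesis using kV(2) by auto
        qed
      qed
      then have "e' 1 = sheaf_transport X F V (m (1 / 2)) (m 1) (e' (1 / 2))"
        by (intro flat_within[OF flat_subset[OF e'(1)] _ V(1)]) auto
      ultimately show "E z' = sheaf_transport X F V z z' (E z)"
        using E[OF m e'] m(3) m_half by simp
    qed
    have "\<exists>s\<in>carrier (Sec F W). \<forall>z\<in>W. germ X F z W s = E z"
    proof (rule sheaf_glue_germs[OF Sh W])
      fix z assume z: "z \<in> W"
      obtain V where V: "V \<in> ?B" "z \<in> V" "V \<subseteq> W"
        using base[OF W z] by blast
      have cV: "const_on X F V" using V by simp
      obtain a where a: "a \<in> carrier (Sec F V)" "germ X F z V a = E z"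
        using const_on_surjE[OF cV V(2) step(1)[OF V(1,3,2,2)]] .
      have "E z' = germ X F z' V a" if "z' \<in> V" for z'
        using step(2)[OF V(1,3,2) that] sheaf_transport_germ[OF cV V(2) a(1), of z'] a(2) by simp
      then show "\<exists>M t. openin X M \<and> z \<in> M \<and> M \<subseteq> W \<and> t \<in> carrier (Sec F M) \<and>
          (\<forall>z'\<in>M. E z' = germ X F z' M t)"
        using V(2,3) a(1) const_on_open[OF cV] by (intro exI[of _ V] exI[of _ a]) simp
    qed
    then obtain s where s: "s \<in> carrier (Sec F W)" "germ X F y W s = E y"
      using yW by blast
    have "pathin (subtopology X W) (\<lambda>_. y)"
      by (rule pathin_const) (simp only: topW yW)
    moreover have "y \<in> topspace X" using openin_subset[OF W] yW by blast
    then have "flat (\<lambda>_. y) (\<lambda>_. g) 0 1" using g by (rule flat_const)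
    ultimately have "E y = g"
      using E[of "\<lambda>_. y" y "\<lambda>_. g"] by simp
    then show "\<exists>s\<in>carrier (Sec F W). germ X F y W s = germ X F y N t"
      using s unfolding g_def by auto
  qed
qed


section \<open>Direct images\<close>

lemma preimg_mono: "V \<subseteq> W \<Longrightarrow> preimg S f V \<subseteq> preimg S f W"
  and preimg_Int: "preimg S f (V \<inter> W) = preimg S f V \<inter> preimg S f W"
  and preimg_Union: "preimg S f (\<Union>\<V>) = \<Union>(preimg S f ` \<V>)"
  by (auto simp: preimg_def)

lemma mem_preimg: "s \<in> preimg S f V \<longleftrightarrow> s \<in> topspace S \<and> f s \<in> V"
  by (simp add: preimg_def)

lemma openin_preimg: "continuous_map S X f \<Longrightarrow> openin X V \<Longrightarrow> openin S (preimg S f V)"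
  by (simp add: preimg_def continuous_map_def)

lemma direct_image_simps [simp]:
  "Sec (direct_image S f F) V = Sec F (preimg S f V)"
  "Res (direct_image S f F) V W = Res F (preimg S f V) (preimg S f W)"
  by (simp_all add: direct_image_def)

text \<open>Different open sets of \<open>X\<close> can have the same preimage, so a family is first
  reindexed by preimages. This is consistent because compatible sections over equal preimages
  coincide.\<close>

lemma direct_image_sheaf:
  assumes F: "is_sheaf S F" and f: "continuous_map S X f"
  shows "is_sheaf X (direct_image S f F)"
  unfolding is_sheaf_def direct_image_simps
proof (intro conjI allI impI)
  have P: "is_presheaf S F" using F by (rule sheaf_presheaf)
  note o = openin_preimg[OF f]
  show "is_presheaf X (direct_image S f F)"
    unfolding is_presheaf_def direct_image_simps
  proof (intro conjI allI impI ballI)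
    fix U assume U: "openin X U"
    show "comm_group (Sec F (preimg S f U))" using P o[OF U] by (rule presheaf_comm_group)
    show "Res F (preimg S f U) (preimg S f U) s = s" if "s \<in> carrier (Sec F (preimg S f U))" for s
      using P o[OF U] that by (rule Res_id)
    fix V assume V: "openin X V" "V \<subseteq> U"
    show "Res F (preimg S f U) (preimg S f V) \<in> hom (Sec F (preimg S f U)) (Sec F (preimg S f V))"
      using P o[OF U] o[OF V(1)] preimg_mono[OF V(2)] by (rule Res_hom)
    fix W s assume W: "openin X W" "W \<subseteq> V" and s: "s \<in> carrier (Sec F (preimg S f U))"
    show "Res F (preimg S f V) (preimg S f W) (Res F (preimg S f U) (preimg S f V) s) =
        Res F (preimg S f U) (preimg S f W) s"
      using P o[OF U] o[OF V(1)] o[OF W(1)] preimg_mono[OF V(2)] preimg_mono[OF W(2)] s by (rule Res_Res)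
  qed
  fix \<V> \<sigma>
  assume 1: "\<forall>V\<in>\<V>. openin X V \<and> \<sigma> V \<in> carrier (Sec F (preimg S f V))"
    and 2: "\<forall>V\<in>\<V>. \<forall>W\<in>\<V>. Res F (preimg S f V) (preimg S f (V \<inter> W)) (\<sigma> V) =
      Res F (preimg S f W) (preimg S f (V \<inter> W)) (\<sigma> W)"
  have eq: "\<sigma> V = \<sigma> W" if "V \<in> \<V>" "W \<in> \<V>" "preimg S f V = preimg S f W" for V W
  proof -
    have "Res F (preimg S f V) (preimg S f V) (\<sigma> V) = Res F (preimg S f W) (preimg S f W) (\<sigma> W)"
      using 2[rule_format, OF that(1,2)] that(3) by (simp add: preimg_Int)
    then show ?thesis
      using 1 that(1,2) Res_id[OF P o, of V "\<sigma> V"] Res_id[OF P o, of W "\<sigma> W"] by simp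
  qed
  define \<tau> where "\<tau> Q = \<sigma> (SOME V. V \<in> \<V> \<and> preimg S f V = Q)" for Q
  have \<tau>: "\<tau> (preimg S f V) = \<sigma> V" if "V \<in> \<V>" for V
  proof -
    have "(SOME W. W \<in> \<V> \<and> preimg S f W = preimg S f V) \<in> \<V> \<and>
        preimg S f (SOME W. W \<in> \<V> \<and> preimg S f W = preimg S f V) = preimg S f V"
      by (rule someI[of "\<lambda>W. W \<in> \<V> \<and> preimg S f W = preimg S f V" V]) (simp add: that)
    then show ?thesis
      unfolding \<tau>_def using that by (intro eq) simp_all
  qed
  have "\<exists>!s. s \<in> carrier (Sec F (\<Union>(preimg S f ` \<V>))) \<and>
      (\<forall>Q\<in>preimg S f ` \<V>. Res F (\<Union>(preimg S f ` \<V>)) Q s = \<tau> Q)"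
  proof (rule F[unfolded is_sheaf_def, THEN conjunct2, rule_format])
    fix Q assume "Q \<in> preimg S f ` \<V>"
    then show "openin S Q \<and> \<tau> Q \<in> carrier (Sec F Q)"
      using 1 o \<tau> by auto
  next
    fix Q R assume "Q \<in> preimg S f ` \<V>" "R \<in> preimg S f ` \<V>"
    then show "Res F Q (Q \<inter> R) (\<tau> Q) = Res F R (Q \<inter> R) (\<tau> R)"
      using 2 \<tau> by (auto simp: preimg_Int)
  qed
  then show "\<exists>!s. s \<in> carrier (Sec F (preimg S f (\<Union>\<V>))) \<and>
      (\<forall>V\<in>\<V>. Res F (preimg S f (\<Union>\<V>)) (preimg S f V) s = \<sigma> V)"
    unfolding preimg_Union using \<tau> by simp
qed


section \<open>Inverse images\<close>

lemma Sec_inverse_image: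
  "\<sigma> \<in> carrier (Sec (inverse_image S X f F) V) \<longleftrightarrow>
     \<sigma> \<in> (\<Pi>\<^sub>E s\<in>V. carrier (stalk X F (f s))) \<and>
     (\<forall>s\<in>V. \<exists>V' W t. openin S V' \<and> s \<in> V' \<and> V' \<subseteq> V \<and> openin X W \<and> f ` V' \<subseteq> W \<and>
        t \<in> carrier (Sec F W) \<and> (\<forall>s'\<in>V'. \<sigma> s' = germ X F (f s') W t))"
  by (simp add: inverse_image_def)

lemma inverse_image_simps:
  "Res (inverse_image S X f F) U V \<sigma> = restrict \<sigma> V"
  "\<sigma> \<otimes>\<^bsub>Sec (inverse_image S X f F) V\<^esub> \<tau> = (\<lambda>s\<in>V. \<sigma> s \<otimes>\<^bsub>stalk X F (f s)\<^esub> \<tau> s)"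
  "\<one>\<^bsub>Sec (inverse_image S X f F) V\<^esub> = (\<lambda>s\<in>V. \<one>\<^bsub>stalk X F (f s)\<^esub>)"
  by (simp_all add: inverse_image_def)

lemma inverse_imageE:
  assumes "\<sigma> \<in> carrier (Sec (inverse_image S X f F) V)" "s \<in> V"
  obtains V' W t where "openin S V'" "s \<in> V'" "V' \<subseteq> V" "openin X W" "f ` V' \<subseteq> W"
    "t \<in> carrier (Sec F W)" "\<forall>s'\<in>V'. \<sigma> s' = germ X F (f s') W t"
  using assms unfolding Sec_inverse_image by blast

lemma inverse_image_mem:
  assumes "\<sigma> \<in> carrier (Sec (inverse_image S X f F) V)" "s \<in> V"
  shows "\<sigma> s \<in> carrier (stalk X F (f s))"
  using assms unfolding Sec_inverse_image by (blast intro: PiE_mem)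

lemma inverse_image_ext:
  assumes "\<sigma> \<in> carrier (Sec (inverse_image S X f F) V)" "\<tau> \<in> carrier (Sec (inverse_image S X f F) V)"
    and "\<And>s. s \<in> V \<Longrightarrow> \<sigma> s = \<tau> s"
  shows "\<sigma> = \<tau>"
proof (rule PiE_ext)
  show "\<sigma> \<in> (\<Pi>\<^sub>E s\<in>V. carrier (stalk X F (f s)))" "\<tau> \<in> (\<Pi>\<^sub>E s\<in>V. carrier (stalk X F (f s)))"
    using assms(1,2) unfolding Sec_inverse_image by blast+
qed (rule assms(3))

lemma inverse_imageI:
  assumes "\<And>s. s \<in> V \<Longrightarrow> \<exists>V' W t. openin S V' \<and> s \<in> V' \<and> V' \<subseteq> V \<and> openin X W \<and> f ` V' \<subseteq> W \<and>
        t \<in> carrier (Sec F W) \<and> (\<forall>s'\<in>V'. e s' = germ X F (f s') W t)"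
  shows "(\<lambda>s\<in>V. e s) \<in> carrier (Sec (inverse_image S X f F) V)"
  unfolding Sec_inverse_image
proof (intro conjI ballI)
  show "(\<lambda>s\<in>V. e s) \<in> (\<Pi>\<^sub>E s\<in>V. carrier (stalk X F (f s)))"
  proof (rule restrict_PiE_iff[THEN iffD2], intro ballI)
    fix s assume "s \<in> V"
    from assms[OF this] obtain V' W t where "s \<in> V'" "openin X W" "f ` V' \<subseteq> W"
      "t \<in> carrier (Sec F W)" "\<forall>s'\<in>V'. e s' = germ X F (f s') W t"
      by blast
    then show "e s \<in> carrier (stalk X F (f s))"
      using germ_in_stalk[of X W "f s" t F] by auto
  qed
  fix s assume "s \<in> V"
  from assms[OF this] obtain V' W t where *: "openin S V'" "s \<in> V'" "V' \<subseteq> V" "openin X W" "f ` V' \<subseteq> W"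
    "t \<in> carrier (Sec F W)" "\<forall>s'\<in>V'. e s' = germ X F (f s') W t"
    by blast
  have "\<forall>s'\<in>V'. (\<lambda>s\<in>V. e s) s' = germ X F (f s') W t"
    using *(3,7) by auto
  then show "\<exists>V' W t. openin S V' \<and> s \<in> V' \<and> V' \<subseteq> V \<and> openin X W \<and> f ` V' \<subseteq> W \<and>
        t \<in> carrier (Sec F W) \<and> (\<forall>s'\<in>V'. (\<lambda>s\<in>V. e s) s' = germ X F (f s') W t)"
    using *(1-6) by (intro exI[of _ V'] exI[of _ W] exI[of _ t] conjI)
qed

lemma inverse_image_eq_restrict:
  assumes "\<sigma> \<in> carrier (Sec (inverse_image S X f F) V)"
  shows "(\<lambda>s\<in>V. \<sigma> s) = \<sigma>"
  using assms unfolding Sec_inverse_image by (auto simp: PiE_def intro: extensional_restrict)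

lemma inverse_image_closed:
  assumes P: "is_presheaf X F" and \<sigma>: "\<sigma> \<in> carrier (Sec (inverse_image S X f F) V)"
    and \<tau>: "\<tau> \<in> carrier (Sec (inverse_image S X f F) V)"
  shows "(\<lambda>s\<in>V. \<sigma> s \<otimes>\<^bsub>stalk X F (f s)\<^esub> \<tau> s) \<in> carrier (Sec (inverse_image S X f F) V)"
proof (rule inverse_imageI)
  fix s assume s: "s \<in> V"
  obtain V1 W1 t1 where 1: "openin S V1" "s \<in> V1" "V1 \<subseteq> V" "openin X W1" "f ` V1 \<subseteq> W1"
    "t1 \<in> carrier (Sec F W1)" "\<forall>s'\<in>V1. \<sigma> s' = germ X F (f s') W1 t1"
    using inverse_imageE[OF \<sigma> s] .
  obtain V2 W2 t2 where 2: "openin S V2" "s \<in> V2" "V2 \<subseteq> V" "openin X W2" "f ` V2 \<subseteq> W2"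
    "t2 \<in> carrier (Sec F W2)" "\<forall>s'\<in>V2. \<tau> s' = germ X F (f s') W2 t2"
    using inverse_imageE[OF \<tau> s] .
  let ?W = "W1 \<inter> W2"
  have W: "openin X ?W" using 1 2 by blast
  have t: "Res F W1 ?W t1 \<in> carrier (Sec F ?W)" "Res F W2 ?W t2 \<in> carrier (Sec F ?W)"
    using Res_closed[OF P 1(4) W _ 1(6)] Res_closed[OF P 2(4) W _ 2(6)] by auto
  have "\<sigma> s' \<otimes>\<^bsub>stalk X F (f s')\<^esub> \<tau> s' = germ X F (f s') ?W (Res F W1 ?W t1 \<otimes>\<^bsub>Sec F ?W\<^esub> Res F W2 ?W t2)"
    if s': "s' \<in> V1 \<inter> V2" for s'
  proof -
    have fs: "f s' \<in> ?W" using s' 1 2 by blast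
    show ?thesis
      using stalk_mult[OF P W fs t] germ_Res[OF P 1(4,6) W _ fs] germ_Res[OF P 2(4,6) W _ fs] 1(7) 2(7) s'
      by simp
  qed
  then show "\<exists>V' W t. openin S V' \<and> s \<in> V' \<and> V' \<subseteq> V \<and> openin X W \<and> f ` V' \<subseteq> W \<and> t \<in> carrier (Sec F W) \<and>
      (\<forall>s'\<in>V'. \<sigma> s' \<otimes>\<^bsub>stalk X F (f s')\<^esub> \<tau> s' = germ X F (f s') W t)"
    using 1 2 W Sec_mult_closed[OF P W t]
    by (intro exI[of _ "V1 \<inter> V2"] exI[of _ ?W] exI[of _ "Res F W1 ?W t1 \<otimes>\<^bsub>Sec F ?W\<^esub> Res F W2 ?W t2"] conjI)
      auto
qed

lemma inverse_image_inverse_closed: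
  assumes P: "is_presheaf X F" and \<sigma>: "\<sigma> \<in> carrier (Sec (inverse_image S X f F) V)"
  shows "(\<lambda>s\<in>V. inv\<^bsub>stalk X F (f s)\<^esub> \<sigma> s) \<in> carrier (Sec (inverse_image S X f F) V)"
proof (rule inverse_imageI)
  fix s assume s: "s \<in> V"
  obtain V1 W t where 1: "openin S V1" "s \<in> V1" "V1 \<subseteq> V" "openin X W" "f ` V1 \<subseteq> W"
    "t \<in> carrier (Sec F W)" "\<forall>s'\<in>V1. \<sigma> s' = germ X F (f s') W t"
    using inverse_imageE[OF \<sigma> s] .
  interpret G: group "Sec F W" by (rule presheaf_group[OF P 1(4)])
  have "inv\<^bsub>stalk X F (f s')\<^esub> \<sigma> s' = germ X F (f s') W (inv\<^bsub>Sec F W\<^esub> t)" if s': "s' \<in> V1" for s'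
  proof -
    have fs: "f s' \<in> W" using s' 1 by blast
    then have "f s' \<in> topspace X" using openin_subset[OF 1(4)] by blast
    then interpret H: comm_group "stalk X F (f s')" by (rule stalk_comm_group[OF P])
    interpret h: group_hom "Sec F W" "stalk X F (f s')" "germ X F (f s') W"
      by unfold_locales (rule germ_hom[OF P 1(4) fs])
    show ?thesis using h.hom_inv[OF 1(6)] 1(7) s' by simp
  qed
  then show "\<exists>V' W t. openin S V' \<and> s \<in> V' \<and> V' \<subseteq> V \<and> openin X W \<and> f ` V' \<subseteq> W \<and> t \<in> carrier (Sec F W) \<and>
      (\<forall>s'\<in>V'. inv\<^bsub>stalk X F (f s')\<^esub> \<sigma> s' = germ X F (f s') W t)"
    using 1 G.inv_closed[OF 1(6)]
    by (intro exI[of _ V1] exI[of _ W] exI[of _ "inv\<^bsub>Sec F W\<^esub> t"] conjI) auto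
qed

lemma inverse_image_comm_group:
  assumes P: "is_presheaf X F" and f: "continuous_map S X f" and V: "openin S V"
  shows "comm_group (Sec (inverse_image S X f F) V)" (is "comm_group ?G")
proof -
  have st: "comm_group (stalk X F (f s))" if "s \<in> V" for s
  proof (rule stalk_comm_group[OF P])
    have "s \<in> topspace S" using openin_subset[OF V] that by blast
    then show "f s \<in> topspace X" using f by (auto simp: continuous_map_def Pi_iff)
  qed
  have m: "monoid (stalk X F (f s))" if "s \<in> V" for s
    using st[OF that] by (simp add: comm_group.axioms(2) group.is_monoid)
  show ?thesis
  proof (rule comm_groupI)
    fix \<sigma> \<tau> assume \<sigma>: "\<sigma> \<in> carrier ?G" and \<tau>: "\<tau> \<in> carrier ?G"
    show "\<sigma> \<otimes>\<^bsub>?G\<^esub> \<tau> \<in> carrier ?G"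
      unfolding inverse_image_simps by (rule inverse_image_closed[OF P \<sigma> \<tau>])
    show "\<sigma> \<otimes>\<^bsub>?G\<^esub> \<tau> = \<tau> \<otimes>\<^bsub>?G\<^esub> \<sigma>"
      unfolding inverse_image_simps
    proof (rule restrict_ext)
      fix s assume s: "s \<in> V"
      interpret comm_group "stalk X F (f s)" by (rule st[OF s])
      show "\<sigma> s \<otimes>\<^bsub>stalk X F (f s)\<^esub> \<tau> s = \<tau> s \<otimes>\<^bsub>stalk X F (f s)\<^esub> \<sigma> s"
        by (rule m_comm[OF inverse_image_mem[OF \<sigma> s] inverse_image_mem[OF \<tau> s]])
    qed
    fix \<rho> assume \<rho>: "\<rho> \<in> carrier ?G"
    show "\<sigma> \<otimes>\<^bsub>?G\<^esub> \<tau> \<otimes>\<^bsub>?G\<^esub> \<rho> = \<sigma> \<otimes>\<^bsub>?G\<^esub> (\<tau> \<otimes>\<^bsub>?G\<^esub> \<rho>)"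
      unfolding inverse_image_simps
    proof (rule restrict_ext)
      fix s assume s: "s \<in> V"
      interpret comm_group "stalk X F (f s)" by (rule st[OF s])
      show "(\<lambda>s\<in>V. \<sigma> s \<otimes>\<^bsub>stalk X F (f s)\<^esub> \<tau> s) s \<otimes>\<^bsub>stalk X F (f s)\<^esub> \<rho> s =
          \<sigma> s \<otimes>\<^bsub>stalk X F (f s)\<^esub> (\<lambda>s\<in>V. \<tau> s \<otimes>\<^bsub>stalk X F (f s)\<^esub> \<rho> s) s"
        using s m_assoc[OF inverse_image_mem[OF \<sigma> s] inverse_image_mem[OF \<tau> s] inverse_image_mem[OF \<rho> s]]
        by simp
    qed
  next
    show "\<one>\<^bsub>?G\<^esub> \<in> carrier ?G"
      unfolding inverse_image_simps
    proof (rule inverse_imageI)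
      fix s assume s: "s \<in> V"
      have fV: "f ` V \<subseteq> topspace X"
        using f openin_subset[OF V] by (auto simp: continuous_map_def Pi_iff)
      show "\<exists>V' W t. openin S V' \<and> s \<in> V' \<and> V' \<subseteq> V \<and> openin X W \<and> f ` V' \<subseteq> W \<and>
         t \<in> carrier (Sec F W) \<and> (\<forall>s'\<in>V'. \<one>\<^bsub>stalk X F (f s')\<^esub> = germ X F (f s') W t)"
        using V s fV Sec_one_closed[OF P openin_topspace] stalk_one[OF P openin_topspace]
        by (intro exI[of _ V] exI[of _ "topspace X"] exI[of _ "\<one>\<^bsub>Sec F (topspace X)\<^esub>"] conjI) auto
    qed
  next
    fix \<sigma> assume \<sigma>: "\<sigma> \<in> carrier ?G"
    have "(\<lambda>s\<in>V. \<one>\<^bsub>stalk X F (f s)\<^esub> \<otimes>\<^bsub>stalk X F (f s)\<^esub> \<sigma> s) = (\<lambda>s\<in>V. \<sigma> s)"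
      by (rule restrict_ext) (rule monoid.l_one[OF m inverse_image_mem[OF \<sigma>]])
    then show "\<one>\<^bsub>?G\<^esub> \<otimes>\<^bsub>?G\<^esub> \<sigma> = \<sigma>"
      unfolding inverse_image_simps inverse_image_eq_restrict[OF \<sigma>] by (simp cong: restrict_cong)
    have "(\<lambda>s\<in>V. inv\<^bsub>stalk X F (f s)\<^esub> \<sigma> s \<otimes>\<^bsub>stalk X F (f s)\<^esub> \<sigma> s) = (\<lambda>s\<in>V. \<one>\<^bsub>stalk X F (f s)\<^esub>)"
      by (rule restrict_ext) (rule group.l_inv[OF comm_group.axioms(2)[OF st] inverse_image_mem[OF \<sigma>]])
    then have "(\<lambda>s\<in>V. inv\<^bsub>stalk X F (f s)\<^esub> \<sigma> s) \<otimes>\<^bsub>?G\<^esub> \<sigma> = \<one>\<^bsub>?G\<^esub>"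
      unfolding inverse_image_simps by (simp cong: restrict_cong)
    then show "\<exists>\<tau>\<in>carrier ?G. \<tau> \<otimes>\<^bsub>?G\<^esub> \<sigma> = \<one>\<^bsub>?G\<^esub>"
      using inverse_image_inverse_closed[OF P \<sigma>] by blast
  qed
qed

lemma inverse_image_restrict:
  assumes \<sigma>: "\<sigma> \<in> carrier (Sec (inverse_image S X f F) U)" and V: "openin S V" "V \<subseteq> U"
  shows "restrict \<sigma> V \<in> carrier (Sec (inverse_image S X f F) V)"
proof (rule inverse_imageI)
  fix s assume s: "s \<in> V"
  then have "s \<in> U" using V by blast
  obtain V' W t where 1: "openin S V'" "s \<in> V'" "V' \<subseteq> U" "openin X W" "f ` V' \<subseteq> W"
    "t \<in> carrier (Sec F W)" "\<forall>s'\<in>V'. \<sigma> s' = germ X F (f s') W t"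
    using inverse_imageE[OF \<sigma> \<open>s \<in> U\<close>] .
  show "\<exists>V' W t. openin S V' \<and> s \<in> V' \<and> V' \<subseteq> V \<and> openin X W \<and> f ` V' \<subseteq> W \<and> t \<in> carrier (Sec F W) \<and>
      (\<forall>s'\<in>V'. \<sigma> s' = germ X F (f s') W t)"
    using 1 V s by (intro exI[of _ "V' \<inter> V"] exI[of _ W] exI[of _ t] conjI) auto
qed

text \<open>Sections are families of germs subject to a local condition, so gluing is the gluing of
  functions.\<close>

lemma inverse_image_sheaf:
  assumes P: "is_presheaf X F" and f: "continuous_map S X f"
  shows "is_sheaf S (inverse_image S X f F)" (is "is_sheaf S ?I")
  unfolding is_sheaf_def
proof (intro conjI allI impI)
  show "is_presheaf S ?I"
    unfolding is_presheaf_def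
  proof (intro conjI allI impI ballI)
    fix U assume U: "openin S U"
    show "comm_group (Sec ?I U)" by (rule inverse_image_comm_group[OF P f U])
    show "Res ?I U U s = s" if "s \<in> carrier (Sec ?I U)" for s
      unfolding inverse_image_simps by (rule inverse_image_eq_restrict[OF that])
    fix V assume V: "openin S V" "V \<subseteq> U"
    show "Res ?I U V \<in> hom (Sec ?I U) (Sec ?I V)"
    proof (rule homI)
      fix \<sigma> assume "\<sigma> \<in> carrier (Sec ?I U)"
      then show "Res ?I U V \<sigma> \<in> carrier (Sec ?I V)"
        unfolding inverse_image_simps using V by (rule inverse_image_restrict)
    next
      fix \<sigma> \<tau> assume "\<sigma> \<in> carrier (Sec ?I U)" "\<tau> \<in> carrier (Sec ?I U)"
      show "Res ?I U V (\<sigma> \<otimes>\<^bsub>Sec ?I U\<^esub> \<tau>) = Res ?I U V \<sigma> \<otimes>\<^bsub>Sec ?I V\<^esub> Res ?I U V \<tau>"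
        unfolding inverse_image_simps using V(2) by (auto simp: restrict_def fun_eq_iff)
    qed
    fix W s assume W: "openin S W" "W \<subseteq> V"
    show "Res ?I V W (Res ?I U V s) = Res ?I U W s"
      unfolding inverse_image_simps using W(2) by (auto simp: restrict_def fun_eq_iff)
  qed
  fix \<V> \<sigma>
  assume 1: "\<forall>V\<in>\<V>. openin S V \<and> \<sigma> V \<in> carrier (Sec ?I V)"
    and 2: "\<forall>V\<in>\<V>. \<forall>W\<in>\<V>. Res ?I V (V \<inter> W) (\<sigma> V) = Res ?I W (V \<inter> W) (\<sigma> W)"
  have eq: "\<sigma> V x = \<sigma> W x" if "V \<in> \<V>" "W \<in> \<V>" "x \<in> V" "x \<in> W" for V W x
  proof -
    have "restrict (\<sigma> V) (V \<inter> W) x = restrict (\<sigma> W) (V \<inter> W) x"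
      using 2[rule_format, OF that(1,2)] unfolding inverse_image_simps by (rule fun_cong)
    then show ?thesis using that by simp
  qed
  define e where "e x = \<sigma> (SOME V. V \<in> \<V> \<and> x \<in> V) x" for x
  have e: "e x = \<sigma> V x" if "V \<in> \<V>" "x \<in> V" for V x
  proof -
    have "(SOME V. V \<in> \<V> \<and> x \<in> V) \<in> \<V> \<and> x \<in> (SOME V. V \<in> \<V> \<and> x \<in> V)"
      by (rule someI[of "\<lambda>V. V \<in> \<V> \<and> x \<in> V" V]) (simp add: that)
    then show ?thesis unfolding e_def using that by (intro eq) simp_all
  qed
  show "\<exists>!s. s \<in> carrier (Sec ?I (\<Union>\<V>)) \<and> (\<forall>V\<in>\<V>. Res ?I (\<Union>\<V>) V s = \<sigma> V)"
  proof (rule ex1I)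
    have "(\<lambda>x\<in>\<Union>\<V>. e x) \<in> carrier (Sec ?I (\<Union>\<V>))"
    proof (rule inverse_imageI)
      fix s assume "s \<in> \<Union>\<V>"
      then obtain V where V: "V \<in> \<V>" "s \<in> V" by blast
      then have "\<sigma> V \<in> carrier (Sec ?I V)" using 1 by blast
      from inverse_imageE[OF this V(2)]
      obtain V' W t where *: "openin S V'" "s \<in> V'" "V' \<subseteq> V" "openin X W" "f ` V' \<subseteq> W"
        "t \<in> carrier (Sec F W)" "\<forall>s'\<in>V'. \<sigma> V s' = germ X F (f s') W t" .
      have "\<forall>s'\<in>V'. e s' = germ X F (f s') W t"
        using *(3,7) e[OF V(1)] by auto
      then show "\<exists>V' W t. openin S V' \<and> s \<in> V' \<and> V' \<subseteq> \<Union>\<V> \<and> openin X W \<and> f ` V' \<subseteq> W \<and>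
          t \<in> carrier (Sec F W) \<and> (\<forall>s'\<in>V'. e s' = germ X F (f s') W t)"
        using * V(1) by (intro exI[of _ V'] exI[of _ W] exI[of _ t] conjI) auto
    qed
    moreover have "restrict (\<lambda>x\<in>\<Union>\<V>. e x) V = \<sigma> V" if V: "V \<in> \<V>" for V
    proof -
      have "restrict (\<lambda>x\<in>\<Union>\<V>. e x) V = (\<lambda>x\<in>V. \<sigma> V x)"
        using e[OF V] V by (auto simp: restrict_def fun_eq_iff)
      also have "\<dots> = \<sigma> V" using 1 V inverse_image_eq_restrict by blast
      finally show ?thesis .
    qed
    ultimately show "(\<lambda>x\<in>\<Union>\<V>. e x) \<in> carrier (Sec ?I (\<Union>\<V>)) \<and> (\<forall>V\<in>\<V>. Res ?I (\<Union>\<V>) V (\<lambda>x\<in>\<Union>\<V>. e x) = \<sigma> V)"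
      unfolding inverse_image_simps by blast
    fix r assume r: "r \<in> carrier (Sec ?I (\<Union>\<V>)) \<and> (\<forall>V\<in>\<V>. Res ?I (\<Union>\<V>) V r = \<sigma> V)"
    have "r x = e x" if x: "x \<in> \<Union>\<V>" for x
    proof -
      obtain V where V: "V \<in> \<V>" "x \<in> V" using x by blast
      then have "restrict r V x = \<sigma> V x" using r unfolding inverse_image_simps by simp
      then show ?thesis using e[OF V] V by simp
    qed
    then have "(\<lambda>x\<in>\<Union>\<V>. r x) = (\<lambda>x\<in>\<Union>\<V>. e x)" by (rule restrict_ext)
    then show "r = (\<lambda>x\<in>\<Union>\<V>. e x)"
      using inverse_image_eq_restrict r by metis
  qed
qed

lemma inverse_image_germ_section:
  assumes f: "continuous_map S X f" and U: "openin X U" "a \<in> carrier (Sec F U)"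
    and V: "openin S V" "f ` V \<subseteq> U"
  shows "(\<lambda>s\<in>V. germ X F (f s) U a) \<in> carrier (Sec (inverse_image S X f F) V)"
  by (rule inverse_imageI) (use U V in \<open>intro exI[of _ V] exI[of _ U] exI[of _ a] conjI; simp\<close>)

text \<open>Near \<open>s\<close> the family is induced by some section \<open>t\<close>. Equality
  of the germs of \<open>a\<close> and \<open>t\<close> at \<open>f s\<close> means agreement on an
  open set of \<open>X\<close>, whose preimage is the required neighbourhood.\<close>

lemma inverse_image_agree_nearby:
  assumes P: "is_presheaf X F" and f: "continuous_map S X f" and V: "openin S V"
    and \<sigma>: "\<sigma> \<in> carrier (Sec (inverse_image S X f F) V)" and s: "s \<in> V"
    and U: "openin X U" "f s \<in> U" "a \<in> carrier (Sec F U)" and eq: "germ X F (f s) U a = \<sigma> s"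
  obtains N where "openin S N" "s \<in> N" "N \<subseteq> V" "f ` N \<subseteq> U" "\<forall>s'\<in>N. \<sigma> s' = germ X F (f s') U a"
proof -
  obtain V' W t where 1: "openin S V'" "s \<in> V'" "V' \<subseteq> V" "openin X W" "f ` V' \<subseteq> W"
    "t \<in> carrier (Sec F W)" "\<forall>s'\<in>V'. \<sigma> s' = germ X F (f s') W t"
    using inverse_imageE[OF \<sigma> s] .
  have "germ X F (f s) U a = germ X F (f s) W t" "f s \<in> W" using eq 1 by auto
  from germ_eqE[OF this(1) 1(4) this(2) 1(6)]
  obtain M where M: "openin X M" "f s \<in> M" "M \<subseteq> U" "M \<subseteq> W" "Res F U M a = Res F W M t" .
  show ?thesis
  proof (rule that[of "V' \<inter> preimg S f M"])
    show "openin S (V' \<inter> preimg S f M)" using 1(1) openin_preimg[OF f M(1)] by blast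
    show "s \<in> V' \<inter> preimg S f M"
      using 1 M openin_subset[OF 1(1)] by (auto simp: mem_preimg)
    show "V' \<inter> preimg S f M \<subseteq> V" "f ` (V' \<inter> preimg S f M) \<subseteq> U"
      using 1(3) M(3) by (auto simp: mem_preimg)
    show "\<forall>s'\<in>V' \<inter> preimg S f M. \<sigma> s' = germ X F (f s') U a"
    proof
      fix s' assume "s' \<in> V' \<inter> preimg S f M"
      then have s': "s' \<in> V'" "f s' \<in> M" by (auto simp: mem_preimg)
      show "\<sigma> s' = germ X F (f s') U a"
        using germ_Res[OF P U(1,3) M(1,3) s'(2)] germ_Res[OF P 1(4,6) M(1,4) s'(2)] M(5) 1(7) s'(1)
        by simp
    qed
  qed
qed

text \<open>\<open>A s\<close> denotes the section over \<open>U\<close> through the germ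
  \<open>\<sigma> s\<close>. It is locally constant in \<open>s\<close> by
  \<open>inverse_image_agree_nearby\<close> and injectivity of the germ maps, hence constant on the
  connected set \<open>V\<close>.\<close>

lemma inverse_image_connected:
  assumes P: "is_presheaf X F" and f: "continuous_map S X f" and V: "openin S V" "connectedin S V"
    and U: "const_on X F U" "f ` V \<subseteq> U" and \<sigma>: "\<sigma> \<in> carrier (Sec (inverse_image S X f F) V)"
  obtains a where "a \<in> carrier (Sec F U)" "\<forall>s\<in>V. \<sigma> s = germ X F (f s) U a"
proof (cases "V = {}")
  case True
  then show ?thesis using that Sec_one_closed[OF P const_on_open[OF U(1)]] by blast
next
  case False
  then obtain s0 where s0: "s0 \<in> V" by blast
  have "\<exists>a\<in>carrier (Sec F U). germ X F (f s) U a = \<sigma> s" if "s \<in> V" for s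
  proof -
    have "f s \<in> U" using U that by blast
    from const_on_surjE[OF U(1) this inverse_image_mem[OF \<sigma> that]]
    obtain a where "a \<in> carrier (Sec F U)" "germ X F (f s) U a = \<sigma> s" .
    then show ?thesis by blast
  qed
  then obtain A where A: "\<And>s. s \<in> V \<Longrightarrow> A s \<in> carrier (Sec F U)" "\<And>s. s \<in> V \<Longrightarrow> germ X F (f s) U (A s) = \<sigma> s"
    by metis
  have tV: "topspace (subtopology S V) = V"
    using openin_subset[OF V(1)] by (rule topspace_subtopology_subset)
  have "continuous_map (subtopology S V) (discrete_topology UNIV) A"
    unfolding continuous_map_to_discrete_iff tV openin_open_subtopology[OF V(1)]
  proof (intro conjI ballI)
    fix s assume s: "s \<in> V"
    have fs: "f s \<in> U" using U s by blast
    obtain N where N: "openin S N" "s \<in> N" "N \<subseteq> V" "f ` N \<subseteq> U" "\<forall>s'\<in>N. \<sigma> s' = germ X F (f s') U (A s)"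
      using inverse_image_agree_nearby[OF P f V(1) \<sigma> s const_on_open[OF U(1)] fs A(1)[OF s] A(2)[OF s]] .
    have "A s' = A s" if s': "s' \<in> N" for s'
    proof (rule const_on_injD[OF U(1)])
      have sV: "s' \<in> V" using s' N by blast
      show "f s' \<in> U" "A s' \<in> carrier (Sec F U)" "A s \<in> carrier (Sec F U)"
        using s' N A(1)[OF sV] A(1)[OF s] by auto
      show "germ X F (f s') U (A s') = germ X F (f s') U (A s)"
        using A(2)[OF sV] N(5) s' by simp
    qed
    then show "\<exists>N. (openin S N \<and> N \<subseteq> V) \<and> s \<in> N \<and> (\<forall>z\<in>N. A z = A s)"
      using N(1-3) by blast
  qed simp
  then have "connectedin (discrete_topology UNIV) (A ` V)"
    by (rule connectedin_continuous_map_image) (simp add: V(2) connectedin_absolute)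
  then have "A s = A s0" if "s \<in> V" for s
    using that s0 by (auto simp: connectedin_discrete_topology)
  then show ?thesis
    using that[OF A(1)[OF s0]] A(2) by metis
qed


section \<open>The category of locally constant sheaves\<close>

lemma sheaf_hom_hom: "\<phi> \<in> sheaf_hom X F G \<Longrightarrow> openin X U \<Longrightarrow> \<phi> U \<in> hom (Sec F U) (Sec G U)"
  by (simp add: sheaf_hom_def)

lemma sheaf_hom_closed:
  "\<phi> \<in> sheaf_hom X F G \<Longrightarrow> openin X U \<Longrightarrow> s \<in> carrier (Sec F U) \<Longrightarrow> \<phi> U s \<in> carrier (Sec G U)"
  by (rule hom_in_carrier[OF sheaf_hom_hom])

lemma sheaf_hom_mult:
  "\<phi> \<in> sheaf_hom X F G \<Longrightarrow> openin X U \<Longrightarrow> s \<in> carrier (Sec F U) \<Longrightarrow> t \<in> carrier (Sec F U) \<Longrightarrow>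
    \<phi> U (s \<otimes>\<^bsub>Sec F U\<^esub> t) = \<phi> U s \<otimes>\<^bsub>Sec G U\<^esub> \<phi> U t"
  by (rule hom_mult[OF sheaf_hom_hom])

lemma sheaf_hom_Res:
  "\<phi> \<in> sheaf_hom X F G \<Longrightarrow> openin X U \<Longrightarrow> openin X V \<Longrightarrow> V \<subseteq> U \<Longrightarrow> s \<in> carrier (Sec F U) \<Longrightarrow>
    \<phi> V (Res F U V s) = Res G U V (\<phi> U s)"
  by (simp add: sheaf_hom_def)

lemma sheaf_homI:
  assumes "\<phi> \<in> extensional {U. openin X U}"
    and "\<And>U. openin X U \<Longrightarrow> \<phi> U \<in> extensional (carrier (Sec F U))"
    and "\<And>U s. openin X U \<Longrightarrow> s \<in> carrier (Sec F U) \<Longrightarrow> \<phi> U s \<in> carrier (Sec G U)"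
    and "\<And>U s t. openin X U \<Longrightarrow> s \<in> carrier (Sec F U) \<Longrightarrow> t \<in> carrier (Sec F U) \<Longrightarrow>
      \<phi> U (s \<otimes>\<^bsub>Sec F U\<^esub> t) = \<phi> U s \<otimes>\<^bsub>Sec G U\<^esub> \<phi> U t"
    and "\<And>U V s. openin X U \<Longrightarrow> openin X V \<Longrightarrow> V \<subseteq> U \<Longrightarrow> s \<in> carrier (Sec F U) \<Longrightarrow>
      \<phi> V (Res F U V s) = Res G U V (\<phi> U s)"
  shows "\<phi> \<in> sheaf_hom X F G"
  unfolding sheaf_hom_def mem_Collect_eq
proof (intro conjI allI impI ballI)
  show "\<phi> U \<in> hom (Sec F U) (Sec G U)" if "openin X U" for U
    using assms(3)[OF that] assms(4)[OF that] by (rule homI)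
qed (use assms(1,2,5) in simp_all)

text \<open>Extensionality in both arguments fixes the junk values, so that equality of morphisms is
  decided on actual sections over open sets.\<close>

lemma sheaf_hom_eqI:
  assumes "\<phi> \<in> sheaf_hom X F G" "\<psi> \<in> sheaf_hom X F G"
    and eq: "\<And>U s. openin X U \<Longrightarrow> s \<in> carrier (Sec F U) \<Longrightarrow> \<phi> U s = \<psi> U s"
  shows "\<phi> = \<psi>"
proof (rule extensionalityI[of _ "{U. openin X U}"])
  show "\<phi> \<in> extensional {U. openin X U}" "\<psi> \<in> extensional {U. openin X U}"
    using assms(1,2) by (simp_all add: sheaf_hom_def)
  fix U assume "U \<in> {U. openin X U}"
  then have U: "openin X U" by simp
  show "\<phi> U = \<psi> U"
    by (rule extensionalityI[of _ "carrier (Sec F U)"])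
      (use assms(1,2) U eq[OF U] in \<open>simp_all add: sheaf_hom_def\<close>)
qed

lemma sheaf_isoI:
  "\<phi> \<in> sheaf_hom X F G \<Longrightarrow> (\<And>U. openin X U \<Longrightarrow> bij_betw (\<phi> U) (carrier (Sec F U)) (carrier (Sec G U))) \<Longrightarrow>
    \<phi> \<in> sheaf_iso X F G"
  by (simp add: sheaf_iso_def iso_def sheaf_hom_hom)

lemma sheaf_id_apply: "openin X U \<Longrightarrow> s \<in> carrier (Sec F U) \<Longrightarrow> sheaf_id X F U s = s"
  by (simp add: sheaf_id_def)

lemma sheaf_comp_apply:
  "openin X U \<Longrightarrow> s \<in> carrier (Sec F U) \<Longrightarrow> sheaf_comp X F \<psi> \<phi> U s = \<psi> U (\<phi> U s)"
  by (simp add: sheaf_comp_def compose_eq)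

lemma sheaf_id_hom:
  assumes P: "is_presheaf X F"
  shows "sheaf_id X F \<in> sheaf_hom X F F"
proof (rule sheaf_homI)
  show "sheaf_id X F V (Res F U V s) = Res F U V (sheaf_id X F U s)"
    if "openin X U" "openin X V" "V \<subseteq> U" "s \<in> carrier (Sec F U)" for U V s
    using that Res_closed[OF P that] by (simp add: sheaf_id_apply)
  show "sheaf_id X F U (s \<otimes>\<^bsub>Sec F U\<^esub> t) = sheaf_id X F U s \<otimes>\<^bsub>Sec F U\<^esub> sheaf_id X F U t"
    if "openin X U" "s \<in> carrier (Sec F U)" "t \<in> carrier (Sec F U)" for U s t
    using that Sec_mult_closed[OF P that] by (simp add: sheaf_id_apply)
qed (simp_all add: sheaf_id_def)

lemma sheaf_comp_hom:
  assumes P: "is_presheaf X F" and \<phi>: "\<phi> \<in> sheaf_hom X F G" and \<psi>: "\<psi> \<in> sheaf_hom X G H"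
  shows "sheaf_comp X F \<psi> \<phi> \<in> sheaf_hom X F H"
proof (rule sheaf_homI)
  show "sheaf_comp X F \<psi> \<phi> U s \<in> carrier (Sec H U)" if "openin X U" "s \<in> carrier (Sec F U)" for U s
    unfolding sheaf_comp_apply[OF that]
    by (rule sheaf_hom_closed[OF \<psi> that(1) sheaf_hom_closed[OF \<phi> that]])
  show "sheaf_comp X F \<psi> \<phi> V (Res F U V s) = Res H U V (sheaf_comp X F \<psi> \<phi> U s)"
    if "openin X U" "openin X V" "V \<subseteq> U" "s \<in> carrier (Sec F U)" for U V s
    unfolding sheaf_comp_apply[OF that(1,4)] sheaf_comp_apply[OF that(2) Res_closed[OF P that]]
      sheaf_hom_Res[OF \<phi> that] by (rule sheaf_hom_Res[OF \<psi> that(1-3) sheaf_hom_closed[OF \<phi> that(1,4)]])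
  show "sheaf_comp X F \<psi> \<phi> U (s \<otimes>\<^bsub>Sec F U\<^esub> t) = sheaf_comp X F \<psi> \<phi> U s \<otimes>\<^bsub>Sec H U\<^esub> sheaf_comp X F \<psi> \<phi> U t"
    if "openin X U" "s \<in> carrier (Sec F U)" "t \<in> carrier (Sec F U)" for U s t
    unfolding sheaf_comp_apply[OF that(1,2)] sheaf_comp_apply[OF that(1,3)]
      sheaf_comp_apply[OF that(1) Sec_mult_closed[OF P that]] sheaf_hom_mult[OF \<phi> that]
    by (rule sheaf_hom_mult[OF \<psi> that(1) sheaf_hom_closed[OF \<phi> that(1,2)] sheaf_hom_closed[OF \<phi> that(1,3)]])
qed (simp_all add: sheaf_comp_def compose_def)

lemma LC_simps [simp]:
  "F \<in> Obj (LC X) \<longleftrightarrow> locally_constant_sheaf X F" "Hom (LC X) = sheaf_hom X"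
  "Id (LC X) = sheaf_id X" "Comp (LC X) = sheaf_comp X"
  by (simp_all add: LC_def)

lemma locally_constant_sheaf_presheaf: "locally_constant_sheaf X F \<Longrightarrow> is_presheaf X F"
  by (simp add: locally_constant_sheaf_is_sheaf sheaf_presheaf)

lemma is_category_LC: "is_category (LC X :: (('a, 'g) presheaf, _) cat)"
  unfolding is_category_def LC_simps Ball_def
proof (intro conjI allI impI)
  note P = locally_constant_sheaf_presheaf
  fix F :: "('a, 'g) presheaf" assume F: "locally_constant_sheaf X F"
  show "sheaf_id X F \<in> sheaf_hom X F F" by (rule sheaf_id_hom[OF P[OF F]])
  fix G :: "('a, 'g) presheaf" assume G: "locally_constant_sheaf X G"
  show "sheaf_comp X F \<phi> (sheaf_id X F) = \<phi>" if \<phi>: "\<phi> \<in> sheaf_hom X F G" for \<phi>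
    by (rule sheaf_hom_eqI[OF sheaf_comp_hom[OF P[OF F] sheaf_id_hom[OF P[OF F]] \<phi>] \<phi>])
      (simp add: sheaf_comp_apply sheaf_id_apply)
  show "sheaf_comp X F (sheaf_id X G) \<phi> = \<phi>" if \<phi>: "\<phi> \<in> sheaf_hom X F G" for \<phi>
    by (rule sheaf_hom_eqI[OF sheaf_comp_hom[OF P[OF F] \<phi> sheaf_id_hom[OF P[OF G]]] \<phi>])
      (simp add: sheaf_comp_apply sheaf_id_apply sheaf_hom_closed[OF \<phi>])
  fix H :: "('a, 'g) presheaf" assume H: "locally_constant_sheaf X H"
  show "sheaf_comp X F \<psi> \<phi> \<in> sheaf_hom X F H"
    if "\<phi> \<in> sheaf_hom X F G" "\<psi> \<in> sheaf_hom X G H" for \<phi> \<psi>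
    by (rule sheaf_comp_hom[OF P[OF F] that])
  fix E :: "('a, 'g) presheaf" assume "locally_constant_sheaf X E"
  fix \<phi> \<psi> \<theta> assume \<phi>: "\<phi> \<in> sheaf_hom X F G" and \<psi>: "\<psi> \<in> sheaf_hom X G H" and \<theta>: "\<theta> \<in> sheaf_hom X H E"
  show "sheaf_comp X F \<theta> (sheaf_comp X F \<psi> \<phi>) = sheaf_comp X F (sheaf_comp X G \<theta> \<psi>) \<phi>"
    by (rule sheaf_hom_eqI[OF sheaf_comp_hom[OF P[OF F] sheaf_comp_hom[OF P[OF F] \<phi> \<psi>] \<theta>]
          sheaf_comp_hom[OF P[OF F] \<phi> sheaf_comp_hom[OF P[OF G] \<psi> \<theta>]]])
      (simp add: sheaf_comp_apply sheaf_hom_closed[OF \<phi>])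
qed


section \<open>Functoriality of direct and inverse images\<close>

lemma direct_image_map_apply: "openin X V \<Longrightarrow> direct_image_map S X f \<phi> V = \<phi> (preimg S f V)"
  by (simp add: direct_image_map_def)

lemma direct_image_map_hom:
  assumes f: "continuous_map S X f" and \<phi>: "\<phi> \<in> sheaf_hom S F G"
  shows "direct_image_map S X f \<phi> \<in> sheaf_hom X (direct_image S f F) (direct_image S f G)"
proof (rule sheaf_homI, goal_cases)
  case 1
  show ?case by (simp add: direct_image_map_def)
next
  case (2 U)
  then show ?case using \<phi> openin_preimg[OF f 2]
    by (simp add: direct_image_map_apply sheaf_hom_def)
next
  case (3 U s)
  then show ?case by (simp add: direct_image_map_apply sheaf_hom_closed[OF \<phi> openin_preimg[OF f]])
next
  case (4 U s t)
  then show ?case by (simp add: direct_image_map_apply sheaf_hom_mult[OF \<phi> openin_preimg[OF f]])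
next
  case (5 U V s)
  then show ?case
    by (simp add: direct_image_map_apply
        sheaf_hom_Res[OF \<phi> openin_preimg[OF f] openin_preimg[OF f] preimg_mono])
qed

lemma stalk_map_germ:
  assumes F: "is_presheaf X F" and G: "is_presheaf X G" and \<phi>: "\<phi> \<in> sheaf_hom X F G"
    and U: "openin X U" "x \<in> U" "s \<in> carrier (Sec F U)"
  shows "stalk_map X G \<phi> x (germ X F x U s) = germ X G x U (\<phi> U s)"
  unfolding stalk_map_def
proof (rule UN_germ[OF F U])
  fix V t assume V: "openin X V" "x \<in> V" "t \<in> carrier (Sec F V)" "germ X F x V t = germ X F x U s"
  obtain W where W: "openin X W" "x \<in> W" "W \<subseteq> V" "W \<subseteq> U" "Res F V W t = Res F U W s"
    using germ_eqE[OF V(4) U] .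
  show "germ X G x V (\<phi> V t) = germ X G x U (\<phi> U s)"
    by (rule germ_eqI[OF G V(1) sheaf_hom_closed[OF \<phi> V(1,3)] U(1) sheaf_hom_closed[OF \<phi> U(1,3)] W(1-4)])
      (simp add: sheaf_hom_Res[OF \<phi> V(1) W(1,3) V(3), symmetric] W(5) sheaf_hom_Res[OF \<phi> U(1) W(1,4) U(3)])
qed

lemma stalk_map_mult:
  assumes F: "is_presheaf X F" and G: "is_presheaf X G" and \<phi>: "\<phi> \<in> sheaf_hom X F G"
    and a: "a \<in> carrier (stalk X F x)" and b: "b \<in> carrier (stalk X F x)"
  shows "stalk_map X G \<phi> x (a \<otimes>\<^bsub>stalk X F x\<^esub> b) =
    stalk_map X G \<phi> x a \<otimes>\<^bsub>stalk X G x\<^esub> stalk_map X G \<phi> x b"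
proof -
  obtain U s t where U: "openin X U" "x \<in> U" and s: "s \<in> carrier (Sec F U)" and t: "t \<in> carrier (Sec F U)"
    and eq: "a = germ X F x U s" "b = germ X F x U t"
    using stalkE2[OF F a b] .
  show ?thesis
    unfolding eq stalk_mult[OF F U s t] stalk_map_germ[OF F G \<phi> U s] stalk_map_germ[OF F G \<phi> U t]
      stalk_map_germ[OF F G \<phi> U Sec_mult_closed[OF F U(1) s t]] sheaf_hom_mult[OF \<phi> U(1) s t]
      stalk_mult[OF G U sheaf_hom_closed[OF \<phi> U(1) s] sheaf_hom_closed[OF \<phi> U(1) t]] ..
qed

lemma stalk_map_id:
  assumes F: "is_presheaf X F" and a: "a \<in> carrier (stalk X F x)"
  shows "stalk_map X F (sheaf_id X F) x a = a"
proof -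
  obtain U s where U: "openin X U" "x \<in> U" "s \<in> carrier (Sec F U)" "a = germ X F x U s"
    using a by (rule stalkE)
  show ?thesis
    unfolding U(4) stalk_map_germ[OF F F sheaf_id_hom[OF F] U(1-3)] sheaf_id_apply[OF U(1,3)] ..
qed

lemma stalk_map_comp:
  assumes F: "is_presheaf X F" and G: "is_presheaf X G" and H: "is_presheaf X H"
    and \<phi>: "\<phi> \<in> sheaf_hom X F G" and \<psi>: "\<psi> \<in> sheaf_hom X G H" and a: "a \<in> carrier (stalk X F x)"
  shows "stalk_map X H (sheaf_comp X F \<psi> \<phi>) x a = stalk_map X H \<psi> x (stalk_map X G \<phi> x a)"
proof -
  obtain U s where U: "openin X U" "x \<in> U" "s \<in> carrier (Sec F U)" "a = germ X F x U s"
    using a by (rule stalkE)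
  show ?thesis
    unfolding U(4) stalk_map_germ[OF F H sheaf_comp_hom[OF F \<phi> \<psi>] U(1-3)] sheaf_comp_apply[OF U(1,3)]
      stalk_map_germ[OF F G \<phi> U(1-3)] stalk_map_germ[OF G H \<psi> U(1,2) sheaf_hom_closed[OF \<phi> U(1,3)]] ..
qed

lemma inverse_image_map_apply:
  assumes "openin S V" "\<sigma> \<in> carrier (Sec (inverse_image S X f F) V)"
  shows "inverse_image_map S X f F G \<phi> V \<sigma> = (\<lambda>s\<in>V. stalk_map X G \<phi> (f s) (\<sigma> s))"
  using assms by (simp add: inverse_image_map_def)

text \<open>The essential point is closure: where a section \<open>t\<close> over \<open>W\<close>
  induces the family, \<open>\<phi> W t\<close> induces its image.\<close>

lemma inverse_image_map_hom:
  assumes F: "is_presheaf X F" and G: "is_presheaf X G" and f: "continuous_map S X f"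
    and \<phi>: "\<phi> \<in> sheaf_hom X F G"
  shows "inverse_image_map S X f F G \<phi> \<in> sheaf_hom S (inverse_image S X f F) (inverse_image S X f G)"
proof (rule sheaf_homI, goal_cases)
  case 1
  show ?case by (simp add: inverse_image_map_def)
next
  case (2 U)
  then show ?case by (simp add: inverse_image_map_def)
next
  case (3 U \<sigma>)
  show ?case
    unfolding inverse_image_map_apply[OF 3]
  proof (rule inverse_imageI)
    fix s assume s: "s \<in> U"
    obtain V' W t where 1: "openin S V'" "s \<in> V'" "V' \<subseteq> U" "openin X W" "f ` V' \<subseteq> W"
      "t \<in> carrier (Sec F W)" "\<forall>s'\<in>V'. \<sigma> s' = germ X F (f s') W t"
      using inverse_imageE[OF 3(2) s] .
    have "\<forall>s'\<in>V'. stalk_map X G \<phi> (f s') (\<sigma> s') = germ X G (f s') W (\<phi> W t)"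
      using 1(5,7) stalk_map_germ[OF F G \<phi> 1(4) _ 1(6)] by auto
    then show "\<exists>V' W t. openin S V' \<and> s \<in> V' \<and> V' \<subseteq> U \<and> openin X W \<and> f ` V' \<subseteq> W \<and>
        t \<in> carrier (Sec G W) \<and> (\<forall>s'\<in>V'. stalk_map X G \<phi> (f s') (\<sigma> s') = germ X G (f s') W t)"
      using 1(1-5) sheaf_hom_closed[OF \<phi> 1(4,6)]
      by (intro exI[of _ V'] exI[of _ W] exI[of _ "\<phi> W t"] conjI)
  qed
next
  case (4 U \<sigma> \<tau>)
  have m: "\<sigma> \<otimes>\<^bsub>Sec (inverse_image S X f F) U\<^esub> \<tau> \<in> carrier (Sec (inverse_image S X f F) U)"
    unfolding inverse_image_simps by (rule inverse_image_closed[OF F 4(2,3)])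
  show ?case
    unfolding inverse_image_map_apply[OF 4(1,2)] inverse_image_map_apply[OF 4(1,3)]
      inverse_image_map_apply[OF 4(1) m] unfolding inverse_image_simps
    by (rule restrict_ext)
      (simp add: stalk_map_mult[OF F G \<phi> inverse_image_mem[OF 4(2)] inverse_image_mem[OF 4(3)]])
next
  case (5 U V \<sigma>)
  have r: "restrict \<sigma> V \<in> carrier (Sec (inverse_image S X f F) V)"
    by (rule inverse_image_restrict[OF 5(4,2,3)])
  show ?case
    unfolding inverse_image_simps inverse_image_map_apply[OF 5(1,4)] inverse_image_map_apply[OF 5(2) r]
    using 5(3) by (auto simp: restrict_def fun_eq_iff)
qed

lemma inverse_image_map_id:
  assumes F: "is_presheaf X F" and f: "continuous_map S X f"
  shows "inverse_image_map S X f F F (sheaf_id X F) = sheaf_id S (inverse_image S X f F)"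
proof (rule sheaf_hom_eqI[OF inverse_image_map_hom[OF F F f sheaf_id_hom[OF F]]
      sheaf_id_hom[OF sheaf_presheaf[OF inverse_image_sheaf[OF F f]]]])
  fix U \<sigma> assume *: "openin S U" "\<sigma> \<in> carrier (Sec (inverse_image S X f F) U)"
  have "(\<lambda>s\<in>U. stalk_map X F (sheaf_id X F) (f s) (\<sigma> s)) = (\<lambda>s\<in>U. \<sigma> s)"
    by (rule restrict_ext) (rule stalk_map_id[OF F inverse_image_mem[OF *(2)]])
  then show "inverse_image_map S X f F F (sheaf_id X F) U \<sigma> = sheaf_id S (inverse_image S X f F) U \<sigma>"
    unfolding inverse_image_map_apply[OF *] sheaf_id_apply[OF *] inverse_image_eq_restrict[OF *(2)] .
qed

lemma inverse_image_map_comp: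
  assumes F: "is_presheaf X F" and G: "is_presheaf X G" and H: "is_presheaf X H"
    and f: "continuous_map S X f" and \<phi>: "\<phi> \<in> sheaf_hom X F G" and \<psi>: "\<psi> \<in> sheaf_hom X G H"
  shows "inverse_image_map S X f F H (sheaf_comp X F \<psi> \<phi>) =
    sheaf_comp S (inverse_image S X f F) (inverse_image_map S X f G H \<psi>) (inverse_image_map S X f F G \<phi>)"
proof (rule sheaf_hom_eqI[OF inverse_image_map_hom[OF F H f sheaf_comp_hom[OF F \<phi> \<psi>]]
      sheaf_comp_hom[OF sheaf_presheaf[OF inverse_image_sheaf[OF F f]] inverse_image_map_hom[OF F G f \<phi>]
        inverse_image_map_hom[OF G H f \<psi>]]])
  fix U \<sigma> assume *: "openin S U" "\<sigma> \<in> carrier (Sec (inverse_image S X f F) U)"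
  show "inverse_image_map S X f F H (sheaf_comp X F \<psi> \<phi>) U \<sigma> = sheaf_comp S (inverse_image S X f F)
      (inverse_image_map S X f G H \<psi>) (inverse_image_map S X f F G \<phi>) U \<sigma>"
    unfolding sheaf_comp_apply[OF *] inverse_image_map_apply[OF *]
      inverse_image_map_apply[OF *(1) sheaf_hom_closed[OF inverse_image_map_hom[OF F G f \<phi>] *],
        unfolded inverse_image_map_apply[OF *]]
    by (rule restrict_ext) (simp add: stalk_map_comp[OF F G H \<phi> \<psi> inverse_image_mem[OF *(2)]])
qed


section \<open>The equivalence of categories\<close>

locale minimal_neighbourhoods =
  fixes S :: "'a topology" and X :: "'b topology" and \<pi> :: "'a \<Rightarrow> 'b" and Um :: "'b \<Rightarrow> 'b set"
  assumes lpc: "locally_path_connected_space S"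
    and cont: "continuous_map S X \<pi>"
    and surj: "\<pi> ` topspace S = topspace X"
    and Um_open: "x \<in> topspace X \<Longrightarrow> openin X (Um x)"
    and Um_mem: "x \<in> topspace X \<Longrightarrow> x \<in> Um x"
    and Um_min: "openin X W \<Longrightarrow> x \<in> W \<Longrightarrow> Um x \<subseteq> W"
    and Um_sc: "x \<in> topspace X \<Longrightarrow> simply_connected_space (subtopology S (preimg S \<pi> (Um x)))"
begin

abbreviation Us :: "'b \<Rightarrow> 'a set" where "Us x \<equiv> preimg S \<pi> (Um x)"

lemma Us_open: "x \<in> topspace X \<Longrightarrow> openin S (Us x)"
  by (rule openin_preimg[OF cont Um_open])

lemma pi_topspace: "s \<in> topspace S \<Longrightarrow> \<pi> s \<in> topspace X"
  using surj by blast

lemma mem_Us: "s \<in> topspace S \<Longrightarrow> s \<in> Us (\<pi> s)"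
  by (simp add: mem_preimg Um_mem pi_topspace)

lemma preimg_surj:
  assumes "openin X V" "y \<in> V"
  obtains s where "s \<in> preimg S \<pi> V" "\<pi> s = y"
proof -
  have "y \<in> \<pi> ` topspace S" using assms openin_subset surj by blast
  then show ?thesis using that assms by (auto simp: mem_preimg)
qed

lemma image_preimg:
  assumes "openin X V"
  shows "\<pi> ` preimg S \<pi> V = V"
proof -
  have "V \<subseteq> \<pi> ` topspace S" using openin_subset[OF assms] surj by simp
  then show ?thesis unfolding preimg_def by blast
qed

lemma Us_path_connected: "x \<in> topspace X \<Longrightarrow> path_connectedin S (Us x)"
  using Um_sc[of x] openin_subset[OF Us_open, of x]
  by (simp add: path_connectedin_def simply_connected_space_def)

lemma Us_connected: "x \<in> topspace X \<Longrightarrow> connectedin S (Us x)"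
  by (rule path_connectedin_imp_connectedin[OF Us_path_connected])

lemma Um_connected: "x \<in> topspace X \<Longrightarrow> connectedin X (Um x)"
  using connectedin_continuous_map_image[OF cont Us_connected] image_preimg[OF Um_open] by simp

text \<open>By minimality \<open>Um x\<close> lies in every trivializing neighbourhood of
  \<open>x\<close>, and it is connected as the image of \<open>Us x\<close>.\<close>

lemma const_on_Um:
  assumes M: "locally_constant_sheaf X M" and x: "x \<in> topspace X"
  shows "const_on X M (Um x)"
proof -
  obtain U where U: "openin X U" "x \<in> U" "\<And>V. \<lbrakk>openin X V; V \<subseteq> U; connectedin X V\<rbrakk> \<Longrightarrow> const_on X M V"
    by (rule locally_constant_sheaf_const_on[OF M x]) blast
  show ?thesis by (rule U(3)[OF Um_open[OF x] Um_min[OF U(1,2)] Um_connected[OF x]])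
qed

lemma const_on_Us: "locally_constant_sheaf S L \<Longrightarrow> x \<in> topspace X \<Longrightarrow> const_on S L (Us x)"
  by (rule const_on_simply_connected[OF _ lpc Us_open Um_sc])

lemma direct_image_const_on_Um:
  assumes L: "locally_constant_sheaf S L" and x: "x \<in> topspace X"
  shows "const_on X (direct_image S \<pi> L) (Um x)"
proof -
  have P: "is_presheaf S L" by (rule locally_constant_sheaf_presheaf[OF L])
  have D: "is_presheaf X (direct_image S \<pi> L)"
    by (rule sheaf_presheaf[OF direct_image_sheaf[OF locally_constant_sheaf_is_sheaf[OF L] cont]])
  show ?thesis
  proof (rule const_onI[OF D Um_open[OF x]], unfold direct_image_simps)
    fix y a b assume y: "y \<in> Um x" and a: "a \<in> carrier (Sec L (Us x))" and b: "b \<in> carrier (Sec L (Us x))"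
      and eq: "germ X (direct_image S \<pi> L) y (Um x) a = germ X (direct_image S \<pi> L) y (Um x) b"
    from germ_eqE[OF eq Um_open[OF x] y, unfolded direct_image_simps, OF b]
    obtain N where N: "openin X N" "y \<in> N" "N \<subseteq> Um x" "N \<subseteq> Um x"
      "Res L (Us x) (preimg S \<pi> N) a = Res L (Us x) (preimg S \<pi> N) b" .
    obtain s where s: "s \<in> preimg S \<pi> N" "\<pi> s = y" using preimg_surj[OF N(1,2)] .
    have "germ S L s (Us x) a = germ S L s (Us x) b"
      using germ_Res[OF P Us_open[OF x] a openin_preimg[OF cont N(1)] preimg_mono[OF N(3)] s(1)]
        germ_Res[OF P Us_open[OF x] b openin_preimg[OF cont N(1)] preimg_mono[OF N(3)] s(1)] N(5) by simp
    moreover have "s \<in> Us x" using s(1) preimg_mono[OF N(3), of S \<pi>] by blast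
    ultimately show "a = b"
      using const_on_injD[OF const_on_Us[OF L x] _ a b] by blast
  next
    fix y N t assume y: "y \<in> N" and N: "openin X N" "N \<subseteq> Um x" and t: "t \<in> carrier (Sec L (preimg S \<pi> N))"
    have yX: "y \<in> topspace X" using y N openin_subset by blast
    have UN: "Um y \<subseteq> N" by (rule Um_min[OF N(1) y])
    then have UU: "Um y \<subseteq> Um x" using N(2) by blast
    obtain s where s: "s \<in> preimg S \<pi> N" "\<pi> s = y" using preimg_surj[OF N(1) y] .
    then have sUy: "s \<in> Us y" and sUx: "s \<in> Us x" using Um_mem[OF yX] UU by (auto simp: mem_preimg)
    have oN: "openin S (preimg S \<pi> N)" by (rule openin_preimg[OF cont N(1)])
    obtain a where a: "a \<in> carrier (Sec L (Us x))" "germ S L s (Us x) a = germ S L s (preimg S \<pi> N) t"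
      using const_on_surjE[OF const_on_Us[OF L x] sUx germ_in_stalk[OF oN s(1) t]] .
    \<comment> \<open>On \<open>Us y\<close> one germ determines a section, and \<open>a\<close> was
      chosen with the germ of \<open>t\<close> at \<open>s\<close>. Equality over the least
      neighbourhood of \<open>y\<close> is equality of germs of the direct image.\<close>
    have "Res L (Us x) (Us y) a = Res L (preimg S \<pi> N) (Us y) t"
    proof (rule const_on_injD[OF const_on_Us[OF L yX] sUy])
      show "Res L (Us x) (Us y) a \<in> carrier (Sec L (Us y))"
        by (rule Res_closed[OF P Us_open[OF x] Us_open[OF yX] preimg_mono[OF UU] a(1)])
      show "Res L (preimg S \<pi> N) (Us y) t \<in> carrier (Sec L (Us y))"
        by (rule Res_closed[OF P oN Us_open[OF yX] preimg_mono[OF UN] t])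
      show "germ S L s (Us y) (Res L (Us x) (Us y) a) = germ S L s (Us y) (Res L (preimg S \<pi> N) (Us y) t)"
        unfolding germ_Res[OF P Us_open[OF x] a(1) Us_open[OF yX] preimg_mono[OF UU] sUy]
          germ_Res[OF P oN t Us_open[OF yX] preimg_mono[OF UN] sUy] by (rule a(2))
    qed
    then have "germ X (direct_image S \<pi> L) y (Um x) a = germ X (direct_image S \<pi> L) y N t"
      using a(1) t by (intro germ_eqI[OF D Um_open[OF x] _ N(1) _ Um_open[OF yX] Um_mem[OF yX] UU UN]) simp_all
    then show "\<exists>a\<in>carrier (Sec L (Us x)). germ X (direct_image S \<pi> L) y (Um x) a = germ X (direct_image S \<pi> L) y N t"
      using a(1) by blast
  qed
qed

theorem direct_image_locally_constant:
  assumes L: "locally_constant_sheaf S L"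
  shows "locally_constant_sheaf X (direct_image S \<pi> L)"
  by (rule locally_constant_sheafI[OF direct_image_sheaf[OF locally_constant_sheaf_is_sheaf[OF L] cont]])
    (use Um_mem direct_image_const_on_Um[OF L] in blast)

text \<open>Over \<open>Us x\<close> all sections are induced by sections of \<open>M\<close> over
  \<open>Um x\<close>, and \<open>M\<close> is constant there, so every germ at a point of
  \<open>Us x\<close> comes from exactly one section over \<open>Us x\<close>.\<close>

theorem inverse_image_locally_constant:
  assumes M: "locally_constant_sheaf X M"
  shows "locally_constant_sheaf S (inverse_image S X \<pi> M)" (is "locally_constant_sheaf S ?I")
proof (rule locally_constant_sheafI)
  have P: "is_presheaf X M" by (rule locally_constant_sheaf_presheaf[OF M])
  show I: "is_sheaf S ?I" by (rule inverse_image_sheaf[OF P cont])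
  fix s0 assume s0: "s0 \<in> topspace S"
  define x where "x = \<pi> s0"
  have x: "x \<in> topspace X" using pi_topspace[OF s0] by (simp add: x_def)
  have c: "const_on X M (Um x)" by (rule const_on_Um[OF M x])
  have img: "\<pi> ` Us x \<subseteq> Um x" using image_preimg[OF Um_open[OF x]] by simp
  have "const_on S ?I (Us x)"
  proof (rule const_onI[OF sheaf_presheaf[OF I] Us_open[OF x]])
    fix y \<sigma> \<tau> assume y: "y \<in> Us x" and \<sigma>: "\<sigma> \<in> carrier (Sec ?I (Us x))" and \<tau>: "\<tau> \<in> carrier (Sec ?I (Us x))"
      and eq: "germ S ?I y (Us x) \<sigma> = germ S ?I y (Us x) \<tau>"
    obtain N where N: "openin S N" "y \<in> N" "N \<subseteq> Us x" "N \<subseteq> Us x" "Res ?I (Us x) N \<sigma> = Res ?I (Us x) N \<tau>"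
      using germ_eqE[OF eq Us_open[OF x] y \<tau>] .
    have "restrict \<sigma> N y = restrict \<tau> N y" using N(5) unfolding inverse_image_simps by simp
    then have e: "\<sigma> y = \<tau> y" using N(2) by simp
    obtain a where a: "a \<in> carrier (Sec M (Um x))" "\<forall>s\<in>Us x. \<sigma> s = germ X M (\<pi> s) (Um x) a"
      using inverse_image_connected[OF P cont Us_open[OF x] Us_connected[OF x] c img \<sigma>] .
    obtain b where b: "b \<in> carrier (Sec M (Um x))" "\<forall>s\<in>Us x. \<tau> s = germ X M (\<pi> s) (Um x) b"
      using inverse_image_connected[OF P cont Us_open[OF x] Us_connected[OF x] c img \<tau>] .
    have "\<pi> y \<in> Um x" using y by (simp add: mem_preimg)
    from const_on_injD[OF c this a(1) b(1)] have "a = b" using a(2) b(2) y e by simp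
    then show "\<sigma> = \<tau>" using a(2) b(2) by (intro inverse_image_ext[OF \<sigma> \<tau>]) simp
  next
    fix y N \<tau> assume y: "y \<in> N" and N: "openin S N" "N \<subseteq> Us x" and \<tau>: "\<tau> \<in> carrier (Sec ?I N)"
    have yU: "\<pi> y \<in> Um x" using y N by (auto simp: mem_preimg)
    obtain a where a: "a \<in> carrier (Sec M (Um x))" "germ X M (\<pi> y) (Um x) a = \<tau> y"
      using const_on_surjE[OF c yU inverse_image_mem[OF \<tau> y]] .
    obtain N' where N': "openin S N'" "y \<in> N'" "N' \<subseteq> N" "\<pi> ` N' \<subseteq> Um x"
      "\<forall>s\<in>N'. \<tau> s = germ X M (\<pi> s) (Um x) a"
      using inverse_image_agree_nearby[OF P cont N(1) \<tau> y Um_open[OF x] yU a] .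
    let ?\<sigma> = "\<lambda>s\<in>Us x. germ X M (\<pi> s) (Um x) a"
    have \<sigma>: "?\<sigma> \<in> carrier (Sec ?I (Us x))"
      by (rule inverse_image_germ_section[OF cont Um_open[OF x] a(1) Us_open[OF x] img])
    have NU: "N' \<subseteq> Us x" using N' N by blast
    have "restrict ?\<sigma> N' = restrict \<tau> N'"
      using N'(5) NU by (auto simp: restrict_def fun_eq_iff)
    then have "germ S ?I y (Us x) ?\<sigma> = germ S ?I y N \<tau>"
      by (intro germ_eqI[OF sheaf_presheaf[OF I] Us_open[OF x] \<sigma> N(1) \<tau> N'(1,2) NU N'(3)])
        (simp add: inverse_image_simps)
    then show "\<exists>\<sigma>\<in>carrier (Sec ?I (Us x)). germ S ?I y (Us x) \<sigma> = germ S ?I y N \<tau>"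
      using \<sigma> by blast
  qed
  then show "\<exists>U. s0 \<in> U \<and> const_on S ?I U"
    using mem_Us[OF s0] by (auto simp: x_def)
qed

lemma inverse_image_functor:
  "is_functor (LC X :: (('b, 'g) presheaf, _) cat) (LC S) (inverse_image S X \<pi>) (inverse_image_map S X \<pi>)"
  unfolding is_functor_def LC_simps Ball_def
  using inverse_image_locally_constant
  by (intro conjI allI impI is_category_LC inverse_image_map_hom[OF _ _ cont]
      inverse_image_map_id[OF _ cont] inverse_image_map_comp[OF _ _ _ cont])
    (auto simp: locally_constant_sheaf_presheaf)

lemma direct_image_functor:
  "is_functor (LC S :: (('a, 'g) presheaf, _) cat) (LC X) (direct_image S \<pi>) (\<lambda>_ _. direct_image_map S X \<pi>)"
  unfolding is_functor_def LC_simps Ball_def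
proof (intro conjI allI impI is_category_LC direct_image_locally_constant direct_image_map_hom[OF cont])
  fix F :: "('a, 'g) presheaf" assume F: "locally_constant_sheaf S F"
  note P = locally_constant_sheaf_presheaf
  note D = direct_image_locally_constant
  show "direct_image_map S X \<pi> (sheaf_id S F) = sheaf_id X (direct_image S \<pi> F)"
    by (rule sheaf_hom_eqI[OF direct_image_map_hom[OF cont sheaf_id_hom[OF P[OF F]]] sheaf_id_hom[OF P[OF D[OF F]]]])
      (simp add: direct_image_map_apply sheaf_id_apply openin_preimg[OF cont])
  fix G H :: "('a, 'g) presheaf" and \<phi> \<psi>
  assume G: "locally_constant_sheaf S G" and H: "locally_constant_sheaf S H"
    and \<phi>: "\<phi> \<in> sheaf_hom S F G" and \<psi>: "\<psi> \<in> sheaf_hom S G H"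
  show "direct_image_map S X \<pi> (sheaf_comp S F \<psi> \<phi>) =
      sheaf_comp X (direct_image S \<pi> F) (direct_image_map S X \<pi> \<psi>) (direct_image_map S X \<pi> \<phi>)"
    by (rule sheaf_hom_eqI[OF direct_image_map_hom[OF cont sheaf_comp_hom[OF P[OF F] \<phi> \<psi>]]
          sheaf_comp_hom[OF P[OF D[OF F]] direct_image_map_hom[OF cont \<phi>] direct_image_map_hom[OF cont \<psi>]]])
      (simp add: direct_image_map_apply sheaf_comp_apply openin_preimg[OF cont])
qed

subsection \<open>The unit\<close>

definition unit_map :: "('b, 'g) presheaf \<Rightarrow> 'b set \<Rightarrow> 'g \<Rightarrow> 'a \<Rightarrow> ('b, 'g) germ" where
  "unit_map M = (\<lambda>V\<in>{V. openin X V}. \<lambda>t\<in>carrier (Sec M V). \<lambda>s\<in>preimg S \<pi> V. germ X M (\<pi> s) V t)"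

lemma unit_map_apply:
  "openin X V \<Longrightarrow> t \<in> carrier (Sec M V) \<Longrightarrow> unit_map M V t = (\<lambda>s\<in>preimg S \<pi> V. germ X M (\<pi> s) V t)"
  by (simp add: unit_map_def)

lemma unit_map_hom:
  assumes P: "is_presheaf X M"
  shows "unit_map M \<in> sheaf_hom X M (direct_image S \<pi> (inverse_image S X \<pi> M))"
proof (rule sheaf_homI, goal_cases)
  case (3 V t)
  show ?case
    unfolding unit_map_apply[OF 3] direct_image_simps
    by (rule inverse_image_germ_section[OF cont 3 openin_preimg[OF cont 3(1)]]) (simp add: image_preimg[OF 3(1)])
next
  case (4 V s t)
  show ?case
    unfolding unit_map_apply[OF 4(1,2)] unit_map_apply[OF 4(1,3)] unit_map_apply[OF 4(1) Sec_mult_closed[OF P 4]]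
      direct_image_simps inverse_image_simps
    by (rule restrict_ext) (simp add: mem_preimg stalk_mult[OF P 4(1) _ 4(2,3)])
next
  case (5 U V s)
  show ?case
    unfolding unit_map_apply[OF 5(1,4)] unit_map_apply[OF 5(2) Res_closed[OF P 5]]
      direct_image_simps inverse_image_simps
    using germ_Res[OF P 5(1,4,2,3)] preimg_mono[OF 5(3), of S \<pi>]
    by (auto simp: restrict_def fun_eq_iff mem_preimg)
qed (simp_all add: unit_map_def)

text \<open>Injectivity uses surjectivity of \<open>\<pi>\<close>: all germs on \<open>V\<close> are
  seen from \<open>S\<close>. For surjectivity a section of the inverse image has to be constant
  along the fibres of \<open>\<pi>\<close>, so that it descends to a family of germs on
  \<open>V\<close>.\<close>

lemma unit_map_iso:
  assumes M: "locally_constant_sheaf X M"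
  shows "unit_map M \<in> sheaf_iso X M (direct_image S \<pi> (inverse_image S X \<pi> M))"
proof (rule sheaf_isoI)
  have Sh: "is_sheaf X M" by (rule locally_constant_sheaf_is_sheaf[OF M])
  have P: "is_presheaf X M" by (rule sheaf_presheaf[OF Sh])
  show h: "unit_map M \<in> sheaf_hom X M (direct_image S \<pi> (inverse_image S X \<pi> M))"
    by (rule unit_map_hom[OF P])
  fix V assume V: "openin X V"
  show "bij_betw (unit_map M V) (carrier (Sec M V)) (carrier (Sec (direct_image S \<pi> (inverse_image S X \<pi> M)) V))"
    unfolding bij_betw_def
  proof (intro conjI inj_onI subset_antisym)
    fix a b assume a: "a \<in> carrier (Sec M V)" and b: "b \<in> carrier (Sec M V)" and eq: "unit_map M V a = unit_map M V b"
    show "a = b"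
    proof (rule sheaf_section_eqI[OF Sh V a b])
      fix y assume y: "y \<in> V"
      obtain s where s: "s \<in> preimg S \<pi> V" "\<pi> s = y" using preimg_surj[OF V y] .
      show "germ X M y V a = germ X M y V b"
        using fun_cong[OF eq[unfolded unit_map_apply[OF V a] unit_map_apply[OF V b]], of s] s by simp
    qed
  next
    show "unit_map M V ` carrier (Sec M V) \<subseteq> carrier (Sec (direct_image S \<pi> (inverse_image S X \<pi> M)) V)"
      using sheaf_hom_closed[OF h V] by blast
    show "carrier (Sec (direct_image S \<pi> (inverse_image S X \<pi> M)) V) \<subseteq> unit_map M V ` carrier (Sec M V)"
    proof
      fix \<sigma> assume "\<sigma> \<in> carrier (Sec (direct_image S \<pi> (inverse_image S X \<pi> M)) V)"
      then have \<sigma>: "\<sigma> \<in> carrier (Sec (inverse_image S X \<pi> M) (preimg S \<pi> V))" by simp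
      define e where "e y = \<sigma> (SOME s. s \<in> topspace S \<and> \<pi> s = y)" for y
      have local_sec: "\<exists>a\<in>carrier (Sec M (Um x)). \<forall>s\<in>Us x. \<sigma> s = germ X M (\<pi> s) (Um x) a" if x: "x \<in> V" for x
      proof -
        have xX: "x \<in> topspace X" using x V openin_subset by blast
        have UV: "Us x \<subseteq> preimg S \<pi> V" by (rule preimg_mono[OF Um_min[OF V x]])
        have r: "restrict \<sigma> (Us x) \<in> carrier (Sec (inverse_image S X \<pi> M) (Us x))"
          by (rule inverse_image_restrict[OF \<sigma> Us_open[OF xX] UV])
        have img: "\<pi> ` Us x \<subseteq> Um x" using image_preimg[OF Um_open[OF xX]] by simp
        obtain a where "a \<in> carrier (Sec M (Um x))"
          "\<forall>s\<in>Us x. restrict \<sigma> (Us x) s = germ X M (\<pi> s) (Um x) a"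
          using inverse_image_connected[OF P cont Us_open[OF xX] Us_connected[OF xX] const_on_Um[OF M xX] img r] .
        then show ?thesis by (intro bexI[of _ a]) simp_all
      qed
      \<comment> \<open>Points with the same image lie in a common \<open>Us x\<close>, where one
        section of \<open>M\<close> induces \<open>\<sigma>\<close>; the chosen point of the fibre
        is therefore immaterial.\<close>
      have e: "e (\<pi> s) = \<sigma> s" if s: "s \<in> preimg S \<pi> V" for s
      proof -
        have sS: "s \<in> topspace S" and sV: "\<pi> s \<in> V" using s by (auto simp: mem_preimg)
        define s' where "s' = (SOME r. r \<in> topspace S \<and> \<pi> r = \<pi> s)"
        have s': "s' \<in> topspace S" "\<pi> s' = \<pi> s"
          unfolding s'_def using someI[of "\<lambda>r. r \<in> topspace S \<and> \<pi> r = \<pi> s" s] sS by auto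
        obtain a where "\<forall>r\<in>Us (\<pi> s). \<sigma> r = germ X M (\<pi> r) (Um (\<pi> s)) a"
          using local_sec[OF sV] by blast
        then have "\<sigma> s' = \<sigma> s" using mem_Us[OF sS] mem_Us[OF s'(1)] s'(2) by simp
        then show ?thesis by (simp add: e_def s'_def)
      qed
      have "\<exists>t\<in>carrier (Sec M V). \<forall>y\<in>V. germ X M y V t = e y"
      proof (rule sheaf_glue_germs[OF Sh V])
        fix x assume x: "x \<in> V"
        have xX: "x \<in> topspace X" using x V openin_subset by blast
        obtain a where a: "a \<in> carrier (Sec M (Um x))" "\<forall>s\<in>Us x. \<sigma> s = germ X M (\<pi> s) (Um x) a"
          using local_sec[OF x] by blast
        have "e z = germ X M z (Um x) a" if z: "z \<in> Um x" for z
        proof -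
          obtain s where s: "s \<in> Us x" "\<pi> s = z" using preimg_surj[OF Um_open[OF xX] z] .
          have "s \<in> preimg S \<pi> V" using s(1) preimg_mono[OF Um_min[OF V x], of S \<pi>] by blast
          then show ?thesis using e[of s] a(2) s by simp
        qed
        then show "\<exists>N t. openin X N \<and> x \<in> N \<and> N \<subseteq> V \<and> t \<in> carrier (Sec M N) \<and> (\<forall>z\<in>N. e z = germ X M z N t)"
          using Um_open[OF xX] Um_mem[OF xX] Um_min[OF V x] a(1) by blast
      qed
      then obtain t where t: "t \<in> carrier (Sec M V)" "\<forall>y\<in>V. germ X M y V t = e y" by blast
      have "unit_map M V t = (\<lambda>s\<in>preimg S \<pi> V. \<sigma> s)"
        unfolding unit_map_apply[OF V t(1)] using t(2) e by (intro restrict_ext) (simp add: mem_preimg)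
      also have "\<dots> = \<sigma>" by (rule inverse_image_eq_restrict[OF \<sigma>])
      finally show "\<sigma> \<in> unit_map M V ` carrier (Sec M V)" using t(1) by blast
    qed
  qed
qed

lemma unit_natural:
  "natural_sheaf_iso (LC X :: (('b, 'g) presheaf, _) cat) X (\<lambda>M. M) (\<lambda>_ _ \<phi>. \<phi>)
     (\<lambda>M. direct_image S \<pi> (inverse_image S X \<pi> M))
     (\<lambda>M N \<phi>. direct_image_map S X \<pi> (inverse_image_map S X \<pi> M N \<phi>)) unit_map"
  unfolding natural_sheaf_iso_def LC_simps Ball_def
proof (intro conjI allI impI unit_map_iso)
  fix M N :: "('b, 'g) presheaf" and \<phi>
  assume "locally_constant_sheaf X M" "locally_constant_sheaf X N" and \<phi>: "\<phi> \<in> sheaf_hom X M N"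
  then have M: "is_presheaf X M" and N: "is_presheaf X N" by (simp_all add: locally_constant_sheaf_presheaf)
  show "sheaf_comp X M (unit_map N) \<phi> =
      sheaf_comp X M (direct_image_map S X \<pi> (inverse_image_map S X \<pi> M N \<phi>)) (unit_map M)"
  proof (rule sheaf_hom_eqI[OF sheaf_comp_hom[OF M \<phi> unit_map_hom[OF N]]
        sheaf_comp_hom[OF M unit_map_hom[OF M] direct_image_map_hom[OF cont inverse_image_map_hom[OF M N cont \<phi>]]]])
    fix V t assume V: "openin X V" and t: "t \<in> carrier (Sec M V)"
    have u: "unit_map M V t \<in> carrier (Sec (inverse_image S X \<pi> M) (preimg S \<pi> V))"
      using sheaf_hom_closed[OF unit_map_hom[OF M] V t] by simp
    show "sheaf_comp X M (unit_map N) \<phi> V t =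
        sheaf_comp X M (direct_image_map S X \<pi> (inverse_image_map S X \<pi> M N \<phi>)) (unit_map M) V t"
      unfolding sheaf_comp_apply[OF V t] unit_map_apply[OF V sheaf_hom_closed[OF \<phi> V t]]
        direct_image_map_apply[OF V] inverse_image_map_apply[OF openin_preimg[OF cont V] u]
      by (rule restrict_ext)
        (simp add: unit_map_apply[OF V t] mem_preimg stalk_map_germ[OF M N \<phi> V _ t])
  qed
qed

subsection \<open>The counit\<close>

text \<open>The canonical map from the stalk of the direct image at \<open>\<pi> s\<close> to the
  stalk of \<open>L\<close> at \<open>s\<close>. As on stalks, the union avoids choosing a
  representative.\<close>

definition counit_stalk :: "('a, 'g) presheaf \<Rightarrow> 'a \<Rightarrow> ('b, 'g) germ \<Rightarrow> ('a, 'g) germ" where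
  "counit_stalk L s a = (\<Union>(W, t)\<in>a. germ S L s (preimg S \<pi> W) t)"

lemma counit_stalk_germ:
  assumes L: "is_sheaf S L" and s: "s \<in> topspace S"
    and W: "openin X W" "\<pi> s \<in> W" "t \<in> carrier (Sec L (preimg S \<pi> W))"
  shows "counit_stalk L s (germ X (direct_image S \<pi> L) (\<pi> s) W t) = germ S L s (preimg S \<pi> W) t"
  unfolding counit_stalk_def
proof (rule UN_germ[OF sheaf_presheaf[OF direct_image_sheaf[OF L cont]] W(1,2)], unfold direct_image_simps)
  note P = sheaf_presheaf[OF L]
  fix V r assume V: "openin X V" "\<pi> s \<in> V" "r \<in> carrier (Sec L (preimg S \<pi> V))"
    "germ X (direct_image S \<pi> L) (\<pi> s) V r = germ X (direct_image S \<pi> L) (\<pi> s) W t"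
  from germ_eqE[OF V(4) W(1,2), unfolded direct_image_simps, OF W(3)]
  obtain N where N: "openin X N" "\<pi> s \<in> N" "N \<subseteq> V" "N \<subseteq> W"
    "Res L (preimg S \<pi> V) (preimg S \<pi> N) r = Res L (preimg S \<pi> W) (preimg S \<pi> N) t" .
  have sN: "s \<in> preimg S \<pi> N" using s N by (simp add: mem_preimg)
  show "germ S L s (preimg S \<pi> V) r = germ S L s (preimg S \<pi> W) t"
    by (rule germ_eqI[OF P openin_preimg[OF cont V(1)] V(3) openin_preimg[OF cont W(1)] W(3)
          openin_preimg[OF cont N(1)] sN preimg_mono[OF N(3)] preimg_mono[OF N(4)] N(5)])
qed (rule W(3))

lemma counit_stalk_mult:
  assumes L: "is_sheaf S L" and s: "s \<in> topspace S"
    and a: "a \<in> carrier (stalk X (direct_image S \<pi> L) (\<pi> s))"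
    and b: "b \<in> carrier (stalk X (direct_image S \<pi> L) (\<pi> s))"
  shows "counit_stalk L s (a \<otimes>\<^bsub>stalk X (direct_image S \<pi> L) (\<pi> s)\<^esub> b) =
    counit_stalk L s a \<otimes>\<^bsub>stalk S L s\<^esub> counit_stalk L s b"
proof -
  have D: "is_presheaf X (direct_image S \<pi> L)" by (rule sheaf_presheaf[OF direct_image_sheaf[OF L cont]])
  have P: "is_presheaf S L" by (rule sheaf_presheaf[OF L])
  obtain U p q where U: "openin X U" "\<pi> s \<in> U" and pq': "p \<in> carrier (Sec (direct_image S \<pi> L) U)"
    "q \<in> carrier (Sec (direct_image S \<pi> L) U)"
    and eq: "a = germ X (direct_image S \<pi> L) (\<pi> s) U p" "b = germ X (direct_image S \<pi> L) (\<pi> s) U q"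
    using stalkE2[OF D a b] .
  have pq: "p \<in> carrier (Sec L (preimg S \<pi> U))" "q \<in> carrier (Sec L (preimg S \<pi> U))" using pq' by simp_all
  have oU: "openin S (preimg S \<pi> U)" and sU: "s \<in> preimg S \<pi> U"
    using openin_preimg[OF cont U(1)] s U(2) by (simp_all add: mem_preimg)
  show ?thesis
    unfolding eq stalk_mult[OF D U pq'] unfolding direct_image_simps
      counit_stalk_germ[OF L s U pq(1)] counit_stalk_germ[OF L s U pq(2)]
      counit_stalk_germ[OF L s U Sec_mult_closed[OF P oU pq]] stalk_mult[OF P oU sU pq] ..
qed

text \<open>Germ maps identify both stalks with the sections of \<open>L\<close> over
  \<open>Us (\<pi> s)\<close>, and the map in question commutes with these identifications.\<close>

lemma counit_stalk_bij:
  assumes L: "locally_constant_sheaf S L" and s: "s \<in> topspace S"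
  shows "bij_betw (counit_stalk L s) (carrier (stalk X (direct_image S \<pi> L) (\<pi> s))) (carrier (stalk S L s))"
proof -
  let ?x = "\<pi> s"
  have x: "?x \<in> topspace X" by (rule pi_topspace[OF s])
  have D: "bij_betw (germ X (direct_image S \<pi> L) ?x (Um ?x)) (carrier (Sec L (Us ?x)))
      (carrier (stalk X (direct_image S \<pi> L) ?x))"
    using const_on_bij[OF direct_image_const_on_Um[OF L x] Um_mem[OF x]] by simp
  have "bij_betw (germ S L s (Us ?x)) (carrier (Sec L (Us ?x))) (carrier (stalk S L s))"
    by (rule const_on_bij[OF const_on_Us[OF L x] mem_Us[OF s]])
  moreover have "counit_stalk L s (germ X (direct_image S \<pi> L) ?x (Um ?x) t) = germ S L s (Us ?x) t"
    if "t \<in> carrier (Sec L (Us ?x))" for t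
    by (rule counit_stalk_germ[OF locally_constant_sheaf_is_sheaf[OF L] s Um_open[OF x] Um_mem[OF x] that])
  ultimately have "bij_betw (counit_stalk L s \<circ> germ X (direct_image S \<pi> L) ?x (Um ?x))
      (carrier (Sec L (Us ?x))) (carrier (stalk S L s))"
    by (simp cong: bij_betw_cong)
  then show ?thesis
    using bij_betw_comp_iff[OF D] by blast
qed

text \<open>The images of the germs under the stalk maps must be glued to a section of
  \<open>L\<close>, hence the definite description. \<open>counit_apply\<close> supplies existence
  by gluing and uniqueness from germs.\<close>

definition counit :: "('a, 'g) presheaf \<Rightarrow> 'a set \<Rightarrow> ('a \<Rightarrow> ('b, 'g) germ) \<Rightarrow> 'g" where
  "counit L = (\<lambda>V\<in>{V. openin S V}. \<lambda>\<sigma>\<in>carrier (Sec (inverse_image S X \<pi> (direct_image S \<pi> L)) V).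
     THE t. t \<in> carrier (Sec L V) \<and> (\<forall>s\<in>V. germ S L s V t = counit_stalk L s (\<sigma> s)))"

lemma counit_apply:
  assumes L: "is_sheaf S L" and V: "openin S V"
    and \<sigma>: "\<sigma> \<in> carrier (Sec (inverse_image S X \<pi> (direct_image S \<pi> L)) V)"
  shows "counit L V \<sigma> \<in> carrier (Sec L V)"
    and "s \<in> V \<Longrightarrow> germ S L s V (counit L V \<sigma>) = counit_stalk L s (\<sigma> s)"
proof -
  have P: "is_presheaf S L" by (rule sheaf_presheaf[OF L])
  have "\<exists>t\<in>carrier (Sec L V). \<forall>s\<in>V. germ S L s V t = counit_stalk L s (\<sigma> s)"
  proof (rule sheaf_glue_germs[OF L V])
    fix s assume s: "s \<in> V"
    from inverse_imageE[OF \<sigma> s, unfolded direct_image_simps]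
    obtain V' W t where 1: "openin S V'" "s \<in> V'" "V' \<subseteq> V" "openin X W" "\<pi> ` V' \<subseteq> W"
      "t \<in> carrier (Sec L (preimg S \<pi> W))" "\<forall>s'\<in>V'. \<sigma> s' = germ X (direct_image S \<pi> L) (\<pi> s') W t" .
    have sub: "V' \<subseteq> preimg S \<pi> W" using 1(5) openin_subset[OF 1(1)] unfolding preimg_def by blast
    note o = openin_preimg[OF cont 1(4)]
    have "counit_stalk L s' (\<sigma> s') = germ S L s' V' (Res L (preimg S \<pi> W) V' t)" if s': "s' \<in> V'" for s'
    proof -
      have *: "s' \<in> topspace S" "\<pi> s' \<in> W" using s' sub by (auto simp: mem_preimg)
      show ?thesis
        unfolding 1(7)[rule_format, OF s'] counit_stalk_germ[OF L *(1) 1(4) *(2) 1(6)]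
        by (rule germ_Res[OF P o 1(6,1) sub s', symmetric])
    qed
    then show "\<exists>N t. openin S N \<and> s \<in> N \<and> N \<subseteq> V \<and> t \<in> carrier (Sec L N) \<and>
        (\<forall>z\<in>N. counit_stalk L z (\<sigma> z) = germ S L z N t)"
      using 1(1-3) Res_closed[OF P o 1(1) sub 1(6)]
      by (intro exI[of _ V'] exI[of _ "Res L (preimg S \<pi> W) V' t"] conjI ballI)
  qed
  then obtain t where t: "t \<in> carrier (Sec L V)" "\<forall>s\<in>V. germ S L s V t = counit_stalk L s (\<sigma> s)" by blast
  have "counit L V \<sigma> = (THE t. t \<in> carrier (Sec L V) \<and> (\<forall>s\<in>V. germ S L s V t = counit_stalk L s (\<sigma> s)))"
    using V \<sigma> by (simp add: counit_def)
  also have "\<dots> = t"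
  proof (rule the_equality)
    fix r assume r: "r \<in> carrier (Sec L V) \<and> (\<forall>s\<in>V. germ S L s V r = counit_stalk L s (\<sigma> s))"
    show "r = t"
      by (rule sheaf_section_eqI[OF L V]) (use r t in auto)
  qed (use t in blast)
  finally have eq: "counit L V \<sigma> = t" .
  show "counit L V \<sigma> \<in> carrier (Sec L V)" using t(1) by (simp add: eq)
  show "s \<in> V \<Longrightarrow> germ S L s V (counit L V \<sigma>) = counit_stalk L s (\<sigma> s)" using t(2) by (simp add: eq)
qed

lemma counit_hom:
  assumes L: "is_sheaf S L"
  shows "counit L \<in> sheaf_hom S (inverse_image S X \<pi> (direct_image S \<pi> L)) L" (is "_ \<in> sheaf_hom S ?I L")
proof (rule sheaf_homI, goal_cases)
  case (3 V \<sigma>)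
  then show ?case by (rule counit_apply(1)[OF L])
next
  case (4 V \<sigma> \<tau>)
  have P: "is_presheaf S L" by (rule sheaf_presheaf[OF L])
  have D: "is_presheaf X (direct_image S \<pi> L)" by (rule sheaf_presheaf[OF direct_image_sheaf[OF L cont]])
  have m: "\<sigma> \<otimes>\<^bsub>Sec ?I V\<^esub> \<tau> \<in> carrier (Sec ?I V)"
    unfolding inverse_image_simps by (rule inverse_image_closed[OF D 4(2,3)])
  show ?case
  proof (rule sheaf_section_eqI[OF L 4(1) counit_apply(1)[OF L 4(1) m]
        Sec_mult_closed[OF P 4(1) counit_apply(1)[OF L 4(1,2)] counit_apply(1)[OF L 4(1,3)]]])
    fix s assume s: "s \<in> V"
    then have sS: "s \<in> topspace S" using openin_subset[OF 4(1)] by blast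
    have "germ S L s V (counit L V (\<sigma> \<otimes>\<^bsub>Sec ?I V\<^esub> \<tau>)) =
        counit_stalk L s (\<sigma> s \<otimes>\<^bsub>stalk X (direct_image S \<pi> L) (\<pi> s)\<^esub> \<tau> s)"
      unfolding counit_apply(2)[OF L 4(1) m s] using s by (simp add: inverse_image_simps)
    also have "\<dots> = counit_stalk L s (\<sigma> s) \<otimes>\<^bsub>stalk S L s\<^esub> counit_stalk L s (\<tau> s)"
      by (rule counit_stalk_mult[OF L sS inverse_image_mem[OF 4(2) s] inverse_image_mem[OF 4(3) s]])
    also have "\<dots> = germ S L s V (counit L V \<sigma> \<otimes>\<^bsub>Sec L V\<^esub> counit L V \<tau>)"
      using stalk_mult[OF P 4(1) s counit_apply(1)[OF L 4(1,2)] counit_apply(1)[OF L 4(1,3)]]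
        counit_apply(2)[OF L 4(1,2) s] counit_apply(2)[OF L 4(1,3) s] by simp
    finally show "germ S L s V (counit L V (\<sigma> \<otimes>\<^bsub>Sec ?I V\<^esub> \<tau>)) =
        germ S L s V (counit L V \<sigma> \<otimes>\<^bsub>Sec L V\<^esub> counit L V \<tau>)" .
  qed
next
  case (5 U V \<sigma>)
  have P: "is_presheaf S L" by (rule sheaf_presheaf[OF L])
  have r: "restrict \<sigma> V \<in> carrier (Sec ?I V)" by (rule inverse_image_restrict[OF 5(4,2,3)])
  note c = counit_apply(1)[OF L 5(1,4)]
  show ?case
    unfolding inverse_image_simps
  proof (rule sheaf_section_eqI[OF L 5(2) counit_apply(1)[OF L 5(2) r] Res_closed[OF P 5(1-3) c]])
    fix s assume s: "s \<in> V"
    then have sU: "s \<in> U" using 5(3) by blast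
    show "germ S L s V (counit L V (restrict \<sigma> V)) = germ S L s V (Res L U V (counit L U \<sigma>))"
      unfolding germ_Res[OF P 5(1) c 5(2,3) s] counit_apply(2)[OF L 5(2) r s] counit_apply(2)[OF L 5(1,4) sU]
      using s by simp
  qed
qed (simp_all add: counit_def)

text \<open>Injectivity is checked on stalks. For surjectivity the stalkwise preimages of the germs
  of a section have to be shown to be locally induced by sections over open sets of
  \<open>X\<close>.\<close>

lemma counit_iso:
  assumes L: "locally_constant_sheaf S L"
  shows "counit L \<in> sheaf_iso S (inverse_image S X \<pi> (direct_image S \<pi> L)) L" (is "_ \<in> sheaf_iso S ?I L")
proof (rule sheaf_isoI)
  have Sh: "is_sheaf S L" by (rule locally_constant_sheaf_is_sheaf[OF L])
  have P: "is_presheaf S L" by (rule sheaf_presheaf[OF Sh])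
  show h: "counit L \<in> sheaf_hom S ?I L" by (rule counit_hom[OF Sh])
  fix V assume V: "openin S V"
  have VS: "s \<in> topspace S" if "s \<in> V" for s using openin_subset[OF V] that by blast
  show "bij_betw (counit L V) (carrier (Sec ?I V)) (carrier (Sec L V))"
    unfolding bij_betw_def
  proof (intro conjI inj_onI subset_antisym)
    fix \<sigma> \<tau> assume \<sigma>: "\<sigma> \<in> carrier (Sec ?I V)" and \<tau>: "\<tau> \<in> carrier (Sec ?I V)"
      and eq: "counit L V \<sigma> = counit L V \<tau>"
    show "\<sigma> = \<tau>"
    proof (rule inverse_image_ext[OF \<sigma> \<tau>])
      fix s assume s: "s \<in> V"
      have "counit_stalk L s (\<sigma> s) = counit_stalk L s (\<tau> s)"
        using counit_apply(2)[OF Sh V \<sigma> s] counit_apply(2)[OF Sh V \<tau> s] eq by simp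
      then show "\<sigma> s = \<tau> s"
        by (rule inj_onD[OF bij_betw_imp_inj_on[OF counit_stalk_bij[OF L VS[OF s]]] _
              inverse_image_mem[OF \<sigma> s] inverse_image_mem[OF \<tau> s]])
    qed
  next
    show "counit L V ` carrier (Sec ?I V) \<subseteq> carrier (Sec L V)"
      using sheaf_hom_closed[OF h V] by blast
    show "carrier (Sec L V) \<subseteq> counit L V ` carrier (Sec ?I V)"
    proof
      fix t assume t: "t \<in> carrier (Sec L V)"
      define e where "e s = the_inv_into (carrier (stalk X (direct_image S \<pi> L) (\<pi> s))) (counit_stalk L s)
          (germ S L s V t)" for s
      have e: "counit_stalk L s (e s) = germ S L s V t" if s: "s \<in> V" for s
        unfolding e_def
        by (rule f_the_inv_into_f_bij_betw[OF counit_stalk_bij[OF L VS[OF s]]])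
          (rule germ_in_stalk[OF V s t])
      have e_eqI: "e s = a" if s: "s \<in> V" and a: "a \<in> carrier (stalk X (direct_image S \<pi> L) (\<pi> s))"
        "counit_stalk L s a = germ S L s V t" for s a
        unfolding e_def a(2)[symmetric]
        by (rule the_inv_into_f_f[OF bij_betw_imp_inj_on[OF counit_stalk_bij[OF L VS[OF s]]] a(1)])
      have \<sigma>: "(\<lambda>s\<in>V. e s) \<in> carrier (Sec ?I V)"
      proof (rule inverse_imageI, unfold direct_image_simps)
        fix s assume s: "s \<in> V"
        let ?x = "\<pi> s"
        have x: "?x \<in> topspace X" by (rule pi_topspace[OF VS[OF s]])
        note sU = mem_Us[OF VS[OF s]]
        \<comment> \<open>The germ of \<open>t\<close> at \<open>s\<close> extends over
          \<open>Us ?x\<close>, that is, to a section of the direct image over \<open>Um ?x\<close>.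
          It agrees with \<open>t\<close> near \<open>s\<close> and so induces the stalkwise
          preimages there.\<close>
        obtain a where a: "a \<in> carrier (Sec L (Us ?x))" "germ S L s (Us ?x) a = germ S L s V t"
          using const_on_surjE[OF const_on_Us[OF L x] sU germ_in_stalk[OF V s t]] .
        obtain N where N: "openin S N" "s \<in> N" "N \<subseteq> Us ?x" "N \<subseteq> V" "Res L (Us ?x) N a = Res L V N t"
          using germ_eqE[OF a(2) V s t] .
        have "e s' = germ X (direct_image S \<pi> L) (\<pi> s') (Um ?x) a" if s': "s' \<in> N" for s'
        proof (rule e_eqI)
          show sV: "s' \<in> V" using s' N by blast
          have "s' \<in> Us ?x" using s' N by blast
          then have sx: "\<pi> s' \<in> Um ?x" by (simp add: mem_preimg)
          show "germ X (direct_image S \<pi> L) (\<pi> s') (Um ?x) a \<in> carrier (stalk X (direct_image S \<pi> L) (\<pi> s'))"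
            by (rule germ_in_stalk[OF Um_open[OF x] sx]) (simp add: a(1))
          show "counit_stalk L s' (germ X (direct_image S \<pi> L) (\<pi> s') (Um ?x) a) = germ S L s' V t"
            unfolding counit_stalk_germ[OF Sh VS[OF sV] Um_open[OF x] sx a(1)]
            using germ_Res[OF P Us_open[OF x] a(1) N(1,3) s'] germ_Res[OF P V t N(1,4) s'] N(5) by simp
        qed
        moreover have "\<pi> ` N \<subseteq> Um ?x" using N(3) by (auto simp: mem_preimg)
        ultimately show "\<exists>V' W t. openin S V' \<and> s \<in> V' \<and> V' \<subseteq> V \<and> openin X W \<and> \<pi> ` V' \<subseteq> W \<and>
            t \<in> carrier (Sec L (preimg S \<pi> W)) \<and> (\<forall>s'\<in>V'. e s' = germ X (direct_image S \<pi> L) (\<pi> s') W t)"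
          using N(1,2,4) Um_open[OF x] a(1)
          by (intro exI[of _ N] exI[of _ "Um ?x"] exI[of _ a] conjI ballI)
      qed
      have "counit L V (\<lambda>s\<in>V. e s) = t"
        by (rule sheaf_section_eqI[OF Sh V counit_apply(1)[OF Sh V \<sigma>] t])
          (simp add: counit_apply(2)[OF Sh V \<sigma>] e)
      then show "t \<in> counit L V ` carrier (Sec ?I V)" using \<sigma> by blast
    qed
  qed
qed

text \<open>Both composites are compared at the germs in each \<open>s\<close>, where they are
  evaluated on one section over a preimage that represents \<open>\<sigma> s\<close>.\<close>

lemma counit_natural:
  "natural_sheaf_iso (LC S :: (('a, 'g) presheaf, _) cat) S
     (\<lambda>L. inverse_image S X \<pi> (direct_image S \<pi> L))
     (\<lambda>L K \<phi>. inverse_image_map S X \<pi> (direct_image S \<pi> L) (direct_image S \<pi> K) (direct_image_map S X \<pi> \<phi>))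
     (\<lambda>L. L) (\<lambda>_ _ \<phi>. \<phi>) counit"
  unfolding natural_sheaf_iso_def LC_simps Ball_def
proof (intro conjI allI impI counit_iso)
  fix L K :: "('a, 'g) presheaf" and \<phi>
  assume "locally_constant_sheaf S L" "locally_constant_sheaf S K" and \<phi>: "\<phi> \<in> sheaf_hom S L K"
  then have L: "is_sheaf S L" and K: "is_sheaf S K" by (simp_all add: locally_constant_sheaf_is_sheaf)
  let ?dL = "direct_image S \<pi> L" and ?dK = "direct_image S \<pi> K" and ?d\<phi> = "direct_image_map S X \<pi> \<phi>"
  have PL: "is_presheaf S L" and PK: "is_presheaf S K" using L K by (simp_all add: sheaf_presheaf)
  have dL: "is_presheaf X ?dL" and dK: "is_presheaf X ?dK"
    using L K by (simp_all add: sheaf_presheaf direct_image_sheaf[OF _ cont])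
  have d\<phi>: "?d\<phi> \<in> sheaf_hom X ?dL ?dK" by (rule direct_image_map_hom[OF cont \<phi>])
  note i\<phi> = inverse_image_map_hom[OF dL dK cont d\<phi>]
  have I: "is_presheaf S (inverse_image S X \<pi> ?dL)" by (rule sheaf_presheaf[OF inverse_image_sheaf[OF dL cont]])
  show "sheaf_comp S (inverse_image S X \<pi> ?dL) (counit K) (inverse_image_map S X \<pi> ?dL ?dK ?d\<phi>) =
      sheaf_comp S (inverse_image S X \<pi> ?dL) \<phi> (counit L)"
  proof (rule sheaf_hom_eqI[OF sheaf_comp_hom[OF I i\<phi> counit_hom[OF K]] sheaf_comp_hom[OF I counit_hom[OF L] \<phi>]])
    fix V \<sigma> assume V: "openin S V" and \<sigma>: "\<sigma> \<in> carrier (Sec (inverse_image S X \<pi> ?dL) V)"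
    note i\<sigma> = sheaf_hom_closed[OF i\<phi> V \<sigma>]
    note c = counit_apply[OF L V \<sigma>]
    show "sheaf_comp S (inverse_image S X \<pi> ?dL) (counit K) (inverse_image_map S X \<pi> ?dL ?dK ?d\<phi>) V \<sigma> =
        sheaf_comp S (inverse_image S X \<pi> ?dL) \<phi> (counit L) V \<sigma>"
      unfolding sheaf_comp_apply[OF V \<sigma>]
    proof (rule sheaf_section_eqI[OF K V counit_apply(1)[OF K V i\<sigma>] sheaf_hom_closed[OF \<phi> V c(1)]])
      fix s assume s: "s \<in> V"
      have sS: "s \<in> topspace S" using openin_subset[OF V] s by blast
      obtain W t where W: "openin X W" "\<pi> s \<in> W" "t \<in> carrier (Sec ?dL W)" "\<sigma> s = germ X ?dL (\<pi> s) W t"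
        using inverse_image_mem[OF \<sigma> s] by (rule stalkE)
      have t: "t \<in> carrier (Sec L (preimg S \<pi> W))" using W(3) by simp
      have o: "openin S (preimg S \<pi> W)" by (rule openin_preimg[OF cont W(1)])
      have sW: "s \<in> preimg S \<pi> W" using sS W(2) by (simp add: mem_preimg)
      have "germ S K s V (counit K V (inverse_image_map S X \<pi> ?dL ?dK ?d\<phi> V \<sigma>)) =
          counit_stalk K s (stalk_map X ?dK ?d\<phi> (\<pi> s) (\<sigma> s))"
        unfolding counit_apply(2)[OF K V i\<sigma> s] unfolding inverse_image_map_apply[OF V \<sigma>] using s by simp
      also have "\<dots> = counit_stalk K s (germ X ?dK (\<pi> s) W (\<phi> (preimg S \<pi> W) t))"
        unfolding W(4) stalk_map_germ[OF dL dK d\<phi> W(1-3)] direct_image_map_apply[OF W(1)] ..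
      also have "\<dots> = germ S K s (preimg S \<pi> W) (\<phi> (preimg S \<pi> W) t)"
        by (rule counit_stalk_germ[OF K sS W(1,2) sheaf_hom_closed[OF \<phi> o t]])
      also have "\<dots> = stalk_map S K \<phi> s (germ S L s (preimg S \<pi> W) t)"
        by (rule stalk_map_germ[OF PL PK \<phi> o sW t, symmetric])
      also have "\<dots> = stalk_map S K \<phi> s (germ S L s V (counit L V \<sigma>))"
        unfolding c(2)[OF s] W(4) counit_stalk_germ[OF L sS W(1,2) t] ..
      also have "\<dots> = germ S K s V (\<phi> V (counit L V \<sigma>))"
        by (rule stalk_map_germ[OF PL PK \<phi> V s c(1)])
      finally show "germ S K s V (counit K V (inverse_image_map S X \<pi> ?dL ?dK ?d\<phi> V \<sigma>)) =
          germ S K s V (\<phi> V (counit L V \<sigma>))" .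
    qed
  qed
qed

theorem images_equivalence: "images_establish_equivalence S X \<pi> TYPE('g)"
  unfolding images_establish_equivalence_def
  using inverse_image_functor direct_image_functor unit_natural counit_natural by blast

end


section \<open>The induced map of fundamental groups\<close>

lemma loops_iff: "p \<in> loops X x \<longleftrightarrow> pathin X p \<and> p 0 = x \<and> p 1 = x"
  by (simp add: loops_def)

lemma loop_class_eq_iff:
  assumes "q \<in> loops X x"
  shows "loop_class X x p = loop_class X x q \<longleftrightarrow> path_homotopic X x x p q"
proof
  assume "loop_class X x p = loop_class X x q"
  moreover have "path_homotopic X x x q q"
    using assms path_homotopic_refl by (fastforce simp: loops_iff)
  ultimately show "path_homotopic X x x p q"
    by (auto simp: loop_class_eq)
next
  assume pq: "path_homotopic X x x p q"
  show "loop_class X x p = loop_class X x q"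
    unfolding loop_class_eq using path_homotopic_trans[OF pq] path_homotopic_trans[OF path_homotopic_sym[OF pq]]
    by blast
qed

lemma loop_class_mem: "p \<in> loops X x \<Longrightarrow> p \<in> loop_class X x p"
  using loop_class_eq_iff[of p X x p] by (simp add: loop_class_eq)

text \<open>Evaluates the unions in \<open>fundamental_group\<close> and
  \<open>fundamental_group_map\<close>, as \<open>UN_germ\<close> does for stalks.\<close>

lemma UN_const_nonempty: "a \<in> A \<Longrightarrow> (\<And>b. b \<in> A \<Longrightarrow> f b = c) \<Longrightarrow> (\<Union>b\<in>A. f b) = c"
  by auto

lemma loops_compose: "p \<in> loops X x \<Longrightarrow> continuous_map X Y f \<Longrightarrow> f \<circ> p \<in> loops Y (f x)"
  by (auto simp: loops_iff intro: pathin_compose)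

lemma loops_join: "p \<in> loops X x \<Longrightarrow> q \<in> loops X x \<Longrightarrow> loop_join p q \<in> loops X x"
  by (auto simp: loops_iff intro: pathin_join)

lemma fundamental_group_map_class:
  assumes p: "p \<in> loops X x" and f: "continuous_map X Y f"
  shows "fundamental_group_map Y f x (loop_class X x p) = loop_class Y (f x) (f \<circ> p)"
  unfolding fundamental_group_map_def
proof (rule UN_const_nonempty[OF loop_class_mem[OF p]])
  fix q assume "q \<in> loop_class X x p"
  then have "path_homotopic X x x q p" using path_homotopic_sym by (auto simp: loop_class_eq)
  then show "loop_class Y (f x) (f \<circ> q) = loop_class Y (f x) (f \<circ> p)"
    unfolding loop_class_eq_iff[OF loops_compose[OF p f]] using f by (rule path_homotopic_compose)
qed

lemma fundamental_group_simps [simp]: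
  "carrier (fundamental_group X x) = loop_class X x ` loops X x"
  "\<one>\<^bsub>fundamental_group X x\<^esub> = loop_class X x (\<lambda>_. x)"
  by (simp_all add: fundamental_group_def)

lemma fundamental_group_mult:
  assumes p: "p \<in> loops X x" and q: "q \<in> loops X x"
  shows "loop_class X x p \<otimes>\<^bsub>fundamental_group X x\<^esub> loop_class X x q = loop_class X x (loop_join p q)"
proof -
  have "(\<Union>p'\<in>loop_class X x p. \<Union>q'\<in>loop_class X x q. loop_class X x (loop_join p' q')) =
      loop_class X x (loop_join p q)"
  proof (rule UN_const_nonempty[OF loop_class_mem[OF p]], rule UN_const_nonempty[OF loop_class_mem[OF q]])
    fix p' q' assume "p' \<in> loop_class X x p" "q' \<in> loop_class X x q"
    then have "path_homotopic X x x p' p" "path_homotopic X x x q' q"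
      using path_homotopic_sym by (auto simp: loop_class_eq)
    then show "loop_class X x (loop_join p' q') = loop_class X x (loop_join p q)"
      unfolding loop_class_eq_iff[OF loops_join[OF p q]] by (rule path_homotopic_join)
  qed
  then show ?thesis by (simp add: fundamental_group_def)
qed

lemma fundamental_group_map_hom:
  assumes f: "continuous_map X Y f"
  shows "fundamental_group_map Y f x \<in> hom (fundamental_group X x) (fundamental_group Y (f x))"
proof (rule homI)
  fix A assume "A \<in> carrier (fundamental_group X x)"
  then obtain p where p: "p \<in> loops X x" "A = loop_class X x p" by auto
  show "fundamental_group_map Y f x A \<in> carrier (fundamental_group Y (f x))"
    unfolding p(2) fundamental_group_map_class[OF p(1) f] using loops_compose[OF p(1) f] by simp
  fix B assume "B \<in> carrier (fundamental_group X x)"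
  then obtain q where q: "q \<in> loops X x" "B = loop_class X x q" by auto
  show "fundamental_group_map Y f x (A \<otimes>\<^bsub>fundamental_group X x\<^esub> B) =
      fundamental_group_map Y f x A \<otimes>\<^bsub>fundamental_group Y (f x)\<^esub> fundamental_group_map Y f x B"
    unfolding p(2) q(2) fundamental_group_mult[OF p(1) q(1)] fundamental_group_map_class[OF p(1) f]
      fundamental_group_map_class[OF q(1) f] fundamental_group_map_class[OF loops_join[OF p(1) q(1)] f]
      fundamental_group_mult[OF loops_compose[OF p(1) f] loops_compose[OF q(1) f]] loop_join_comp ..
qed

text \<open>The constant path is the degenerate piece of \<open>p\<close> from time 1 to time
  1.\<close>

lemma path_homotopic_join_const:
  assumes "pathin X p" "p 0 = x" "p 1 = y"
  shows "path_homotopic X x y (loop_join p (\<lambda>_. y)) p"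
  using path_homotopic_subpath_join[OF assms(1), of 0 1 1] assms(2,3) by (simp add: subpath_of_def)

section \<open>Comparison of paths in \<open>S\<close> with paths in \<open>X\<close>\<close>

context minimal_neighbourhoods
begin

lemma path_in_Us:
  assumes x: "x \<in> topspace X" and ab: "a \<in> Us x" "b \<in> Us x"
  obtains k where "pathin S k" "k ` {0..1} \<subseteq> Us x" "k 0 = a" "k 1 = b"
proof -
  have "path_connected_space (subtopology S (Us x))" "Us x \<subseteq> topspace S"
    using Us_path_connected[OF x] unfolding path_connectedin_def by blast+
  then obtain k where k: "pathin (subtopology S (Us x)) k" "k 0 = a" "k 1 = b"
    using path_connected_spaceD[of "subtopology S (Us x)", unfolded topspace_subtopology_subset[OF \<open>Us x \<subseteq> topspace S\<close>], OF _ ab]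
    by blast
  then show ?thesis using that unfolding pathin_subtopology_iff by blast
qed

lemma path_homotopic_in_Us:
  assumes x: "x \<in> topspace X" and k: "pathin S k" "k ` {0..1} \<subseteq> Us x" "k 0 = a" "k 1 = b"
    and l: "pathin S l" "l ` {0..1} \<subseteq> Us x" "l 0 = a" "l 1 = b"
  shows "path_homotopic S a b k l"
  by (rule path_homotopic_subtopologyD[OF simply_connected_path_homotopic[OF Um_sc[OF x]]])
    (use k l in \<open>simp_all only: pathin_subtopology_iff simp_thms\<close>)

text \<open>The image of \<open>q\<close> is only homotopic to \<open>c\<close>, and in return both
  ends of \<open>q\<close> can be prescribed in their fibres. This freedom makes the pieces
  composable and lets loops lift to loops.\<close>

lemma path_lift_up_to_homotopy:
  assumes c: "pathin X c" and u: "u \<in> topspace S" "\<pi> u = c 0" and v: "v \<in> topspace S" "\<pi> v = c 1"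
  obtains q where "pathin S q" "q 0 = u" "q 1 = v" "path_homotopic X (c 0) (c 1) (\<pi> \<circ> q) c"
proof -
  define P where "P a b \<longleftrightarrow> 0 \<le> a \<and> a \<le> b \<and> b \<le> 1 \<longrightarrow>
    (\<forall>u\<in>topspace S. \<forall>v\<in>topspace S. \<pi> u = c a \<longrightarrow> \<pi> v = c b \<longrightarrow>
       (\<exists>q. pathin S q \<and> q 0 = u \<and> q 1 = v \<and> path_homotopic X (c a) (c b) (\<pi> \<circ> q) (subpath_of c a b)))"
    for a b :: real
  have "P 0 1"
  proof (rule Bolzano)
    fix a b d assume P: "P a b" "P b d" and le: "a \<le> b" "b \<le> d"
    show "P a d"
      unfolding P_def
    proof (intro impI ballI)
      fix u w assume ad: "0 \<le> a \<and> a \<le> d \<and> d \<le> 1" and u: "u \<in> topspace S" "\<pi> u = c a"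
        and w: "w \<in> topspace S" "\<pi> w = c d"
      have abd: "a \<in> {0..1}" "b \<in> {0..1}" "d \<in> {0..1}" using ad le by auto
      \<comment> \<open>Any point above the cutting point \<open>c b\<close> can serve as the common
        end of the two pieces.\<close>
      have "c b \<in> \<pi> ` topspace S" unfolding surj by (rule pathin_topspace[OF c abd(2)])
      then obtain v where v: "v \<in> topspace S" "\<pi> v = c b" by auto
      obtain q where q: "pathin S q" "q 0 = u" "q 1 = v"
        "path_homotopic X (c a) (c b) (\<pi> \<circ> q) (subpath_of c a b)"
        using P(1)[unfolded P_def, rule_format, OF _ u(1) v(1) u(2) v(2)] ad le by auto
      obtain q' where q': "pathin S q'" "q' 0 = v" "q' 1 = w"
        "path_homotopic X (c b) (c d) (\<pi> \<circ> q') (subpath_of c b d)"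
        using P(2)[unfolded P_def, rule_format, OF _ v(1) w(1) v(2) w(2)] ad le by auto
      have "path_homotopic X (c a) (c d) (\<pi> \<circ> loop_join q q') (subpath_of c a d)"
        unfolding loop_join_comp
        by (rule path_homotopic_trans[OF path_homotopic_join[OF q(4) q'(4)] path_homotopic_subpath_join[OF c abd]])
      then show "\<exists>q. pathin S q \<and> q 0 = u \<and> q 1 = w \<and> path_homotopic X (c a) (c d) (\<pi> \<circ> q) (subpath_of c a d)"
        using pathin_join[OF q(1) q'(1)] q q' by (intro exI[of _ "loop_join q q'"]) simp
    qed
  next
    fix t :: real assume "0 \<le> t" "t \<le> 1"
    then have t: "t \<in> {0..1}" by simp
    let ?x = "c t"
    have x: "?x \<in> topspace X" by (rule pathin_topspace[OF c t])
    obtain d where d: "d > 0" "\<And>w. w \<in> {0..1} \<Longrightarrow> \<bar>w - t\<bar> < d \<Longrightarrow> c w \<in> Um ?x"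
      by (rule pathin_nhds[OF c Um_open[OF x] t Um_mem[OF x]]) blast
    have "P a b" if ab: "a \<le> t" "t \<le> b" "b - a < d" for a b
      unfolding P_def
    proof (intro impI ballI)
      fix u v assume "0 \<le> a \<and> a \<le> b \<and> b \<le> 1" and u: "u \<in> topspace S" "\<pi> u = c a"
        and v: "v \<in> topspace S" "\<pi> v = c b"
      then have ab01: "a \<in> {0..1}" "b \<in> {0..1}" by auto
      have cU: "c w \<in> Um ?x" if "w \<in> {a..b}" for w
        using d(2)[of w] that ab ab01 by auto
      have "u \<in> Us ?x" "v \<in> Us ?x" using cU[of a] cU[of b] ab u v by (auto simp: mem_preimg)
      then obtain q where q: "pathin S q" "q ` {0..1} \<subseteq> Us ?x" "q 0 = u" "q 1 = v"
        by (rule path_in_Us[OF x])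
      \<comment> \<open>Both paths stay in \<open>Um ?x\<close> and have the same ends, so that
        smallness of \<open>Um ?x\<close> makes them homotopic.\<close>
      have "path_homotopic X ((\<pi> \<circ> q) 0) ((\<pi> \<circ> q) 1) (\<pi> \<circ> q) (subpath_of c a b)"
      proof (rule path_homotopic_in_minimal_open[OF x Um_min])
        show "pathin X (\<pi> \<circ> q)" by (rule pathin_compose[OF q(1) cont])
        show "(\<pi> \<circ> q) ` {0..1} \<subseteq> Um ?x" using q(2) by (auto simp: mem_preimg)
        show "pathin X (subpath_of c a b)" by (rule pathin_subpath_of[OF c ab01])
        show "subpath_of c a b ` {0..1} \<subseteq> Um ?x"
          unfolding subpath_of_def
          using linear_in_Icc[of a a b b] ab by (intro image_subsetI cU) auto
      qed (simp_all add: q u v)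
      then show "\<exists>q. pathin S q \<and> q 0 = u \<and> q 1 = v \<and> path_homotopic X (c a) (c b) (\<pi> \<circ> q) (subpath_of c a b)"
        using q u v by (intro exI[of _ q]) simp
    qed
    then show "\<exists>d>0. \<forall>a b. a \<le> t \<and> t \<le> b \<and> b - a < d \<longrightarrow> P a b"
      using d(1) by blast
  qed simp
  then obtain q where "pathin S q" "q 0 = u" "q 1 = v" "path_homotopic X (c 0) (c 1) (\<pi> \<circ> q) (subpath_of c 0 1)"
    unfolding P_def using u v by auto
  then show ?thesis using that by simp
qed

text \<open>Homotopy classes of paths in \<open>S\<close> that start in \<open>s0\<close> form a local system on \<open>X\<close>, the direct
  image of the universal covering of \<open>S\<close>. A path \<open>q\<close> in \<open>S\<close> gives a flat lift of \<open>\<pi> \<circ> q\<close>, so that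
  the monodromy theorem on \<open>X\<close> applies.\<close>

theorem path_homotopic_if_image:
  assumes p: "p \<in> loops S s0" and q: "q \<in> loops S s0"
    and pq: "path_homotopic X (\<pi> s0) (\<pi> s0) (\<pi> \<circ> p) (\<pi> \<circ> q)"
  shows "path_homotopic S s0 s0 p q"
proof -
  have s0: "s0 \<in> topspace S" using p pathin_topspace[of S p 0] by (simp add: loops_iff)
  \<comment> \<open>One point is chosen in each fibre, and \<open>s0\<close> itself in its own, so
    that over \<open>\<pi> s0\<close> the local system consists of classes of loops at
    \<open>s0\<close>.\<close>
  define r where "r x = (if x = \<pi> s0 then s0 else SOME s. s \<in> topspace S \<and> \<pi> s = x)" for x
  have r: "r x \<in> topspace S" "\<pi> (r x) = x" if x: "x \<in> topspace X" for x
  proof -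
    have "x \<in> \<pi> ` topspace S" using x unfolding surj .
    then obtain s where "s \<in> topspace S \<and> \<pi> s = x" by blast
    then have "(SOME s. s \<in> topspace S \<and> \<pi> s = x) \<in> topspace S \<and> \<pi> (SOME s. s \<in> topspace S \<and> \<pi> s = x) = x"
      by (rule someI)
    then show "r x \<in> topspace S" "\<pi> (r x) = x"
      using s0 by (cases "x = \<pi> s0"; simp add: r_def)+
  qed
  define B where "B = Um ` topspace X"
  have BX: "V \<subseteq> topspace X" if "V \<in> B" for V
    using that openin_subset[OF Um_open] unfolding B_def by blast
  define link where "link V u v k \<longleftrightarrow> pathin S k \<and> k ` {0..1} \<subseteq> preimg S \<pi> V \<and> k 0 = u \<and> k 1 = v" for V u v k
  have link_ex: "\<exists>k. link V u v k" if V: "V \<in> B" and uv: "u \<in> preimg S \<pi> V" "v \<in> preimg S \<pi> V" for V u v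
  proof -
    obtain x where x: "x \<in> topspace X" "V = Um x" using V unfolding B_def by blast
    obtain k where "pathin S k" "k ` {0..1} \<subseteq> Us x" "k 0 = u" "k 1 = v"
      using path_in_Us[OF x(1)] uv unfolding x(2) by blast
    then show ?thesis unfolding link_def x(2) by blast
  qed
  have link_homotopic: "path_homotopic S u v k l" if V: "V \<in> B" and kl: "link V u v k" "link V u v l" for V u v k l
  proof -
    obtain x where x: "x \<in> topspace X" "V = Um x" using V unfolding B_def by blast
    show ?thesis
      by (rule path_homotopic_in_Us[OF x(1)]) (use kl in \<open>simp_all add: link_def x(2)\<close>)
  qed
  have link_join: "link V u w (loop_join k l)" if "link V u v k" "link V v w l" for V u v w k l
  proof -
    have "loop_join k l t \<in> preimg S \<pi> V" if t: "t \<in> {0..1}" for t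
    proof (cases "t \<le> 1/2")
      case True
      then have "2 * t \<in> {0..1}" using t by auto
      then show ?thesis using \<open>link V u v k\<close> True by (auto simp: link_def loop_join_def)
    next
      case False
      then have "2 * t - 1 \<in> {0..1}" using t by auto
      then show ?thesis using \<open>link V v w l\<close> False by (auto simp: link_def loop_join_def)
    qed
    then show ?thesis using that pathin_join[of S k l] by (auto simp: link_def)
  qed
  have link_mono: "link V u v k" if "N \<subseteq> V" "link N u v k" for N V u v k
    using that preimg_mono[OF that(1), of S \<pi>] by (auto simp: link_def)
  have link_path: "pathin S k" "k 0 = u" "k 1 = v" if "link V u v k" for V u v k
    using that by (simp_all add: link_def)
  have rV: "r x \<in> preimg S \<pi> V" if "V \<in> B" "x \<in> V" for V x
    using r[of x] BX[OF that(1)] that(2) by (auto simp: mem_preimg)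
  define path where "path y k \<longleftrightarrow> pathin S k \<and> k 0 = s0 \<and> k 1 = y" for y k
  define cls where "cls y k = {l. path_homotopic S s0 y k l}" for y k
  have cls_eq: "cls y k = cls y l" if "path_homotopic S s0 y k l" for y k l
    unfolding cls_def using path_homotopic_trans[OF that] path_homotopic_trans[OF path_homotopic_sym[OF that]] by blast
  have path_refl: "path_homotopic S s0 y k k" if "path y k" for y k
    using that path_homotopic_refl[of S k] by (simp add: path_def)
  have path_join: "path v (loop_join k l)" if "path u k" "link V u v l" for u v V k l
    using that pathin_join[of S k l] by (simp add: path_def link_def)
  define F where "F x = cls (r x) ` {k. path (r x) k}" for x
  \<comment> \<open>Transport prolongs a path by one above \<open>V\<close>. All members of the
    class and all links are taken at once; they yield a single class because links with the same
    ends are homotopic.\<close>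
  define \<tau> where "\<tau> V x y A = {l. \<exists>k\<in>A. \<exists>m. link V (r x) (r y) m \<and> path_homotopic S s0 (r y) (loop_join k m) l}"
    for V x y A
  have \<tau>_cls: "\<tau> V x y (cls (r x) k) = cls (r y) (loop_join k m)"
    if V: "V \<in> B" and k: "path (r x) k" and m: "link V (r x) (r y) m" for V x y k m
  proof (rule subset_antisym; rule subsetI)
    fix l assume "l \<in> \<tau> V x y (cls (r x) k)"
    then obtain k' m' where *: "path_homotopic S s0 (r x) k k'" "link V (r x) (r y) m'"
      "path_homotopic S s0 (r y) (loop_join k' m') l"
      unfolding \<tau>_def cls_def by blast
    show "l \<in> cls (r y) (loop_join k m)"
      unfolding cls_def mem_Collect_eq
      by (rule path_homotopic_trans[OF path_homotopic_join[OF *(1) link_homotopic[OF V m *(2)]] *(3)])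
  next
    fix l assume "l \<in> cls (r y) (loop_join k m)"
    then show "l \<in> \<tau> V x y (cls (r x) k)"
      unfolding \<tau>_def cls_def using path_refl[OF k] m by blast
  qed
  have assoc: "path_homotopic S s0 w (loop_join (loop_join k l) m) (loop_join k (loop_join l m))"
    if "path u k" "link V u v l" "link V' v w m" for u v w V V' k l m
    by (rule path_homotopic_assoc) (use that in \<open>auto simp: path_def link_def\<close>)
  interpret L: local_system X B F \<tau>
  proof (unfold_locales, goal_cases)
    case (1 V)
    then show ?case using Um_open by (auto simp: B_def)
  next
    case (2 W y)
    then have y: "y \<in> topspace X" using openin_subset by blast
    show ?case
      using Um_mem[OF y] Um_min[OF 2] y by (intro bexI[of _ "Um y"]) (simp_all add: B_def)
  next
    case (3 V x y f)
    obtain k where k: "path (r x) k" "f = cls (r x) k" using 3(4) unfolding F_def by blast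
    obtain m where m: "link V (r x) (r y) m" using link_ex[OF 3(1) rV[OF 3(1,2)] rV[OF 3(1,3)]] by blast
    show ?case
      unfolding k(2) \<tau>_cls[OF 3(1) k(1) m] F_def using path_join[OF k(1) m] by blast
  next
    case (4 V x f)
    obtain k where k: "path (r x) k" "f = cls (r x) k" using 4(3) unfolding F_def by blast
    have m: "link V (r x) (r x) (\<lambda>_. r x)"
      using rV[OF 4(1,2)] by (auto simp: link_def mem_preimg pathin_const)
    show ?case
      unfolding k(2) \<tau>_cls[OF 4(1) k(1) m]
      by (rule cls_eq[OF path_homotopic_join_const]) (use k(1) in \<open>simp_all add: path_def\<close>)
  next
    case (5 V x y z f)
    obtain k where k: "path (r x) k" "f = cls (r x) k" using 5(5) unfolding F_def by blast
    obtain m where m: "link V (r x) (r y) m" using link_ex[OF 5(1) rV[OF 5(1,2)] rV[OF 5(1,3)]] by blast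
    obtain n where n: "link V (r y) (r z) n" using link_ex[OF 5(1) rV[OF 5(1,3)] rV[OF 5(1,4)]] by blast
    show ?case
      unfolding k(2) \<tau>_cls[OF 5(1) k(1) m] \<tau>_cls[OF 5(1) path_join[OF k(1) m] n] \<tau>_cls[OF 5(1) k(1) link_join[OF m n]]
      by (rule cls_eq[OF assoc[OF k(1) m n]])
  next
    case (6 V N x y f)
    obtain k where k: "path (r x) k" "f = cls (r x) k" using 6(6) unfolding F_def by blast
    obtain m where m: "link N (r x) (r y) m" using link_ex[OF 6(2) rV[OF 6(2,4)] rV[OF 6(2,5)]] by blast
    show ?case
      unfolding k(2) \<tau>_cls[OF 6(2) k(1) m] \<tau>_cls[OF 6(1) k(1) link_mono[OF 6(3) m]] ..
  qed
  \<comment> \<open>A point of \<open>S\<close> need not be the chosen one in its fibre;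
    \<open>h s\<close> leads from it to the chosen point without leaving the smallest
    \<open>Us\<close>.\<close>
  define h where "h s = (SOME k. link (Um (\<pi> s)) s (r (\<pi> s)) k)" for s
  have h: "link (Um (\<pi> s)) s (r (\<pi> s)) (h s)" if s: "s \<in> topspace S" for s
  proof -
    have x: "\<pi> s \<in> topspace X" by (rule pi_topspace[OF s])
    then have V: "Um (\<pi> s) \<in> B" by (simp add: B_def)
    show ?thesis unfolding h_def
      by (rule someI_ex[OF link_ex[OF V mem_Us[OF s] rV[OF V Um_mem[OF x]]]])
  qed
  \<comment> \<open>The lift at time \<open>t\<close> is the class of \<open>c\<close> up to that
    time, completed to the chosen point of the fibre.\<close>
  define e where "e c t = cls (r (\<pi> (c t))) (loop_join (subpath_of c 0 t) (h (c t)))" for c :: "real \<Rightarrow> 'a" and t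
  have flat: "L.flat (\<pi> \<circ> c) (e c) 0 1" if c: "pathin S c" "c 0 = s0" for c
    unfolding L.flat_def
  proof (intro ballI conjI impI)
    fix t :: real assume t: "t \<in> {0..1}"
    have ct: "c t \<in> topspace S" by (rule pathin_topspace[OF c(1) t])
    have st: "path (c u) (subpath_of c 0 u)" if "u \<in> {0..1}" for u
      using pathin_subpath_of[OF c(1) _ that, of 0] c(2) by (simp add: path_def)
    show "e c t \<in> F ((\<pi> \<circ> c) t)"
      unfolding e_def F_def comp_def using path_join[OF st[OF t] h[OF ct]] by blast
    fix V assume V: "V \<in> B" "(\<pi> \<circ> c) t \<in> V"
    have oV: "openin X V" by (rule L.base_open[OF V(1)])
    obtain d where d: "d > 0" "\<And>u. u \<in> {0..1} \<Longrightarrow> \<bar>u - t\<bar> < d \<Longrightarrow> (\<pi> \<circ> c) u \<in> V"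
      by (rule pathin_nhds[OF pathin_compose[OF c(1) cont] oV t V(2)]) blast
    have "(\<pi> \<circ> c) u \<in> V \<and> e c u = \<tau> V ((\<pi> \<circ> c) t) ((\<pi> \<circ> c) u) (e c t)" if u: "u \<in> {0..1}" "\<bar>u - t\<bar> < d" for u
    proof
      show uV: "(\<pi> \<circ> c) u \<in> V" by (rule d(2)[OF u])
      have cu: "c u \<in> topspace S" by (rule pathin_topspace[OF c(1) u(1)])
      have sub: "link V (c t) (c u) (subpath_of c t u)"
        unfolding link_def
      proof (intro conjI image_subsetI)
        fix w :: real assume w: "w \<in> {0..1}"
        define z where "z = t + (u - t) * w"
        have z: "z \<in> {0..1}" unfolding z_def by (rule linear_in_Icc[OF t u(1) w])
        have "\<bar>z - t\<bar> \<le> \<bar>u - t\<bar>"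
          using w by (auto simp: z_def abs_mult intro: mult_left_le)
        then have "(\<pi> \<circ> c) z \<in> V" using d(2)[OF z] u(2) by linarith
        then show "subpath_of c t u w \<in> preimg S \<pi> V"
          using pathin_topspace[OF c(1) z] by (simp add: subpath_of_def z_def mem_preimg)
      qed (simp_all add: pathin_subpath_of[OF c(1) t u(1)])
      have ht: "link V (c t) (r (\<pi> (c t))) (h (c t))"
        using link_mono[OF Um_min[OF oV] h[OF ct]] V(2) by simp
      have hu: "link V (c u) (r (\<pi> (c u))) (h (c u))"
        using link_mono[OF Um_min[OF oV] h[OF cu]] uV by simp
      obtain k where k: "link V (r (\<pi> (c t))) (r (\<pi> (c u))) k"
        using link_ex[OF V(1) rV[OF V(1), of "\<pi> (c t)"] rV[OF V(1), of "\<pi> (c u)"]] V(2) uV by auto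
      have 1: "path_homotopic S s0 (c u) (subpath_of c 0 u) (loop_join (subpath_of c 0 t) (subpath_of c t u))"
        using path_homotopic_sym[OF path_homotopic_subpath_join[OF c(1) _ t u(1), of 0]] c(2) by simp
      \<comment> \<open>Both routes from \<open>c t\<close> to the chosen point above
        \<open>c u\<close> stay above \<open>V\<close>, whose preimage is simply connected.\<close>
      have 2: "path_homotopic S (c t) (r (\<pi> (c u))) (loop_join (subpath_of c t u) (h (c u))) (loop_join (h (c t)) k)"
        by (rule link_homotopic[OF V(1) link_join[OF sub hu] link_join[OF ht k]])
      have "path_homotopic S (c u) (r (\<pi> (c u))) (h (c u)) (h (c u))"
        by (rule link_homotopic[OF V(1) hu hu])
      from path_homotopic_join[OF 1 this]
      have "path_homotopic S s0 (r (\<pi> (c u))) (loop_join (subpath_of c 0 u) (h (c u)))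
          (loop_join (loop_join (subpath_of c 0 t) (subpath_of c t u)) (h (c u)))" .
      also have "path_homotopic S s0 (r (\<pi> (c u))) \<dots>
          (loop_join (subpath_of c 0 t) (loop_join (subpath_of c t u) (h (c u))))"
        by (rule assoc[OF st[OF t] sub hu])
      also have "path_homotopic S s0 (r (\<pi> (c u))) \<dots> (loop_join (subpath_of c 0 t) (loop_join (h (c t)) k))"
        by (rule path_homotopic_join[OF path_refl[OF st[OF t]] 2])
      also have "path_homotopic S s0 (r (\<pi> (c u))) \<dots> (loop_join (loop_join (subpath_of c 0 t) (h (c t))) k)"
        by (rule path_homotopic_sym[OF assoc[OF st[OF t] ht k]])
      finally have hom: "path_homotopic S s0 (r (\<pi> (c u))) (loop_join (subpath_of c 0 u) (h (c u)))
          (loop_join (loop_join (subpath_of c 0 t) (h (c t))) k)" .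
      show "e c u = \<tau> V ((\<pi> \<circ> c) t) ((\<pi> \<circ> c) u) (e c t)"
        unfolding e_def comp_def \<tau>_cls[OF V(1) path_join[OF st[OF t] ht] k] by (rule cls_eq[OF hom])
    qed
    then show "\<exists>d>0. \<forall>u\<in>{0..1}. \<bar>u - t\<bar> < d \<longrightarrow> (\<pi> \<circ> c) u \<in> V \<and>
        e c u = \<tau> V ((\<pi> \<circ> c) t) ((\<pi> \<circ> c) u) (e c t)"
      using d(1) by (intro exI[of _ d]) simp
  qed
  have p': "pathin S p" "p 0 = s0" "p 1 = s0" and q': "pathin S q" "q 0 = s0" "q 1 = s0"
    using p q by (simp_all add: loops_iff)
  have "e p 0 = e q 0" using p' q' by (simp add: e_def subpath_of_def)
  from L.monodromy[OF pq flat[OF p'(1,2)] flat[OF q'(1,2)] this]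
  have "cls s0 (loop_join p (h s0)) = cls s0 (loop_join q (h s0))"
    using p' q' by (simp add: e_def r_def)
  moreover have hs: "link (Um (\<pi> s0)) s0 s0 (h s0)"
    using h[OF s0] by (simp add: r_def)
  then have "path s0 (loop_join q (h s0))"
    using q' by (intro path_join[of s0]) (simp_all add: path_def)
  then have "loop_join q (h s0) \<in> cls s0 (loop_join q (h s0))"
    unfolding cls_def using path_refl by blast
  ultimately have hom: "path_homotopic S s0 s0 (loop_join p (h s0)) (loop_join q (h s0))"
    by (auto simp: cls_def)
  have B0: "Um (\<pi> s0) \<in> B" using pi_topspace[OF s0] by (simp add: B_def)
  have "link (Um (\<pi> s0)) s0 s0 (\<lambda>_. s0)"
    using s0 mem_Us[OF s0] by (auto simp: link_def pathin_const)
  from link_homotopic[OF B0 hs this] have hc: "path_homotopic S s0 s0 (h s0) (\<lambda>_. s0)" .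
  have join_h: "path_homotopic S s0 s0 (loop_join c (h s0)) c" if "pathin S c" "c 0 = s0" "c 1 = s0" for c
  proof -
    have "path_homotopic S s0 s0 c c" using path_homotopic_refl[OF that(1)] that by simp
    from path_homotopic_trans[OF path_homotopic_join[OF this hc] path_homotopic_join_const[OF that]]
    show ?thesis .
  qed
  show ?thesis
    by (rule path_homotopic_trans[OF path_homotopic_sym[OF join_h[OF p']] path_homotopic_trans[OF hom join_h[OF q']]])
qed

theorem fundamental_group_map_iso:
  assumes s: "s \<in> topspace S"
  shows "fundamental_group_map X \<pi> s \<in> iso (fundamental_group S s) (fundamental_group X (\<pi> s))"
  unfolding iso_def mem_Collect_eq bij_betw_def
proof (intro conjI inj_onI)
  show "fundamental_group_map X \<pi> s \<in> hom (fundamental_group S s) (fundamental_group X (\<pi> s))"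
    by (rule fundamental_group_map_hom[OF cont])
  fix A B assume "A \<in> carrier (fundamental_group S s)" "B \<in> carrier (fundamental_group S s)"
    and eq: "fundamental_group_map X \<pi> s A = fundamental_group_map X \<pi> s B"
  then obtain p q where p: "p \<in> loops S s" "A = loop_class S s p" and q: "q \<in> loops S s" "B = loop_class S s q"
    by auto
  have "path_homotopic X (\<pi> s) (\<pi> s) (\<pi> \<circ> p) (\<pi> \<circ> q)"
    using eq unfolding p(2) q(2) fundamental_group_map_class[OF p(1) cont] fundamental_group_map_class[OF q(1) cont]
      loop_class_eq_iff[OF loops_compose[OF q(1) cont]] .
  then show "A = B"
    unfolding p(2) q(2) loop_class_eq_iff[OF q(1)] by (rule path_homotopic_if_image[OF p(1) q(1)])
next
  show "fundamental_group_map X \<pi> s ` carrier (fundamental_group S s) = carrier (fundamental_group X (\<pi> s))"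
  proof (rule subset_antisym; rule subsetI)
    show "A \<in> carrier (fundamental_group X (\<pi> s))"
      if "A \<in> fundamental_group_map X \<pi> s ` carrier (fundamental_group S s)" for A
      using that hom_in_carrier[OF fundamental_group_map_hom[OF cont]] by blast
    fix A assume "A \<in> carrier (fundamental_group X (\<pi> s))"
    then obtain c where c: "c \<in> loops X (\<pi> s)" "A = loop_class X (\<pi> s) c" by auto
    then have c': "pathin X c" "c 0 = \<pi> s" "c 1 = \<pi> s" by (simp_all add: loops_iff)
    obtain q where q: "pathin S q" "q 0 = s" "q 1 = s" "path_homotopic X (c 0) (c 1) (\<pi> \<circ> q) c"
      by (rule path_lift_up_to_homotopy[OF c'(1) s _ s]) (simp_all add: c')
    have ql: "q \<in> loops S s" using q by (simp add: loops_iff)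
    have "fundamental_group_map X \<pi> s (loop_class S s q) = A"
      unfolding fundamental_group_map_class[OF ql cont] c(2) loop_class_eq_iff[OF c(1)] using q(4) c' by simp
    then show "A \<in> fundamental_group_map X \<pi> s ` carrier (fundamental_group S s)"
      using ql by auto
  qed
qed

end


section \<open>The finite space associated to a covering\<close>

lemma openin_T0_quotient:
  "openin (T0_quotient T) V \<longleftrightarrow>
     V \<subseteq> T0_class T ` topspace T \<and> openin T {s \<in> topspace T. T0_class T s \<in> V}"
proof -
  have "istopology (\<lambda>V. V \<subseteq> T0_class T ` topspace T \<and> openin T {s \<in> topspace T. T0_class T s \<in> V})"
    unfolding istopology_def
  proof (intro conjI allI impI)
    fix V W
    assume "V \<subseteq> T0_class T ` topspace T \<and> openin T {s \<in> topspace T. T0_class T s \<in> V}"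
      and "W \<subseteq> T0_class T ` topspace T \<and> openin T {s \<in> topspace T. T0_class T s \<in> W}"
    moreover have "{s \<in> topspace T. T0_class T s \<in> V \<inter> W} =
        {s \<in> topspace T. T0_class T s \<in> V} \<inter> {s \<in> topspace T. T0_class T s \<in> W}" by blast
    ultimately show "V \<inter> W \<subseteq> T0_class T ` topspace T" "openin T {s \<in> topspace T. T0_class T s \<in> V \<inter> W}"
      by auto
  next
    fix \<K> assume K: "\<forall>V\<in>\<K>. V \<subseteq> T0_class T ` topspace T \<and> openin T {s \<in> topspace T. T0_class T s \<in> V}"
    then show "\<Union>\<K> \<subseteq> T0_class T ` topspace T" by blast
    have "{s \<in> topspace T. T0_class T s \<in> \<Union>\<K>} = (\<Union>V\<in>\<K>. {s \<in> topspace T. T0_class T s \<in> V})" by blast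
    then show "openin T {s \<in> topspace T. T0_class T s \<in> \<Union>\<K>}" using K by auto
  qed
  then show ?thesis by (simp add: T0_quotient_def topology_inverse')
qed

lemma topspace_T0_quotient: "topspace (T0_quotient T) = T0_class T ` topspace T"
proof (rule subset_antisym)
  show "topspace (T0_quotient T) \<subseteq> T0_class T ` topspace T"
    using openin_topspace[of "T0_quotient T"] unfolding openin_T0_quotient by blast
  have "{s \<in> topspace T. T0_class T s \<in> T0_class T ` topspace T} = topspace T" by blast
  then have "openin (T0_quotient T) (T0_class T ` topspace T)" by (simp add: openin_T0_quotient)
  then show "T0_class T ` topspace T \<subseteq> topspace (T0_quotient T)" by (rule openin_subset)
qed

section \<open>Least neighbourhoods of a finite covering and their images in the quotient\<close>

locale finite_cover =
  fixes S :: "'a topology" and \<U> :: "'a set set"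
  assumes lpc: "locally_path_connected_space S"
    and cover: "finite_open_covering S \<U>"
    and sc: "locally_simply_connected_covering S \<U>"
begin

abbreviation T :: "'a topology" where "T \<equiv> topology_generated_by \<U>"

definition least_nbhd :: "'a \<Rightarrow> 'a set" where "least_nbhd s = \<Inter>{U \<in> \<U>. s \<in> U}"

lemma topspace_T: "topspace T = topspace S"
  using cover by (simp add: finite_open_covering_def topology_generated_by_topspace)

lemma least_nbhd_mem: "s \<in> least_nbhd s"
  by (simp add: least_nbhd_def)

lemma least_nbhd_open:
  assumes "s \<in> topspace S"
  shows "openin T (least_nbhd s)"
  unfolding least_nbhd_def
proof (rule openin_Inter)
  \<comment> \<open>Finiteness makes the intersection open. The family is nonempty because
    \<open>\<U>\<close> covers \<open>S\<close>; an empty intersection would be the whole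
    type.\<close>
  show "finite {U \<in> \<U>. s \<in> U}" "{U \<in> \<U>. s \<in> U} \<noteq> {}"
    using cover assms by (auto simp: finite_open_covering_def)
  show "openin T U" if "U \<in> {U \<in> \<U>. s \<in> U}" for U
    using that by (simp add: topology_generated_by_Basis)
qed

text \<open>Induction on the generation of \<open>W\<close>, with all points of \<open>W\<close>
  treated at once so that each step can apply its hypothesis at the same point.\<close>

lemma least_nbhd_minimal:
  assumes "openin T W" "s \<in> W"
  shows "least_nbhd s \<subseteq> W"
proof -
  have "generate_topology_on \<U> W"
    using assms(1) by (simp add: openin_topology_generated_by_iff)
  then have "\<forall>s\<in>W. least_nbhd s \<subseteq> W"
  proof induction
    case (UN K)
    show ?case
    proof
      fix s assume "s \<in> \<Union>K"
      then obtain V where V: "V \<in> K" "s \<in> V" by blast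
      from UN.IH[OF V(1)] V show "least_nbhd s \<subseteq> \<Union>K" by blast
    qed
  qed (auto simp: least_nbhd_def)
  then show ?thesis using assms(2) by blast
qed

lemma openin_T_imp: "openin T W \<Longrightarrow> openin S W"
proof -
  assume "openin T W"
  then have "generate_topology_on \<U> W"
    by (simp add: openin_topology_generated_by_iff)
  then show "openin S W"
  proof induction
    case (Basis U)
    then show ?case using cover by (simp add: finite_open_covering_def)
  qed auto
qed

lemma T0_class_eq_iff:
  assumes s: "s \<in> topspace S" and t: "t \<in> topspace S"
  shows "T0_class T s = T0_class T t \<longleftrightarrow> s \<in> least_nbhd t \<and> t \<in> least_nbhd s"
proof -
  \<comment> \<open>To test whether \<open>y\<close> lies in a closure, its least neighbourhood
    suffices.\<close>
  have cl: "y \<in> T closure_of {u} \<longleftrightarrow> u \<in> least_nbhd y" if "y \<in> topspace S" for y u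
    unfolding in_closure_of topspace_T
    using that least_nbhd_open[OF that] least_nbhd_mem[of y] least_nbhd_minimal by blast
  have "T0_class T s = T0_class T t \<longleftrightarrow> T closure_of {s} = T closure_of {t}"
    using s t unfolding T0_class_def topspace_T by blast
  also have "\<dots> \<longleftrightarrow> s \<in> least_nbhd t \<and> t \<in> least_nbhd s"
  proof
    assume "T closure_of {s} = T closure_of {t}"
    then show "s \<in> least_nbhd t \<and> t \<in> least_nbhd s"
      using cl[OF s] cl[OF t] least_nbhd_mem by blast
  next
    assume st: "s \<in> least_nbhd t \<and> t \<in> least_nbhd s"
    have "y \<in> T closure_of {s} \<longleftrightarrow> y \<in> T closure_of {t}" for y
    proof (cases "y \<in> topspace S")
      case True
      have "least_nbhd s \<subseteq> least_nbhd y" if "s \<in> least_nbhd y" using least_nbhd_minimal[OF least_nbhd_open[OF True] that] .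
      moreover have "least_nbhd t \<subseteq> least_nbhd y" if "t \<in> least_nbhd y" using least_nbhd_minimal[OF least_nbhd_open[OF True] that] .
      ultimately show ?thesis unfolding cl[OF True] using st by blast
    next
      case False
      then show ?thesis using closure_of_subset_topspace[of T] unfolding topspace_T by blast
    qed
    then show "T closure_of {s} = T closure_of {t}" by blast
  qed
  finally show ?thesis .
qed

abbreviation X :: "'a set topology" where "X \<equiv> associated_space \<U>"
abbreviation \<pi> :: "'a \<Rightarrow> 'a set" where "\<pi> \<equiv> associated_map \<U>"

lemma openin_X: "openin X V \<longleftrightarrow> V \<subseteq> \<pi> ` topspace S \<and> openin T (preimg S \<pi> V)"
  unfolding associated_space_def associated_map_def openin_T0_quotient preimg_def topspace_T ..

lemma topspace_X: "topspace X = \<pi> ` topspace S"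
  unfolding associated_space_def associated_map_def topspace_T0_quotient topspace_T ..

lemma pi_eq_iff: "s \<in> topspace S \<Longrightarrow> t \<in> topspace S \<Longrightarrow> \<pi> s = \<pi> t \<longleftrightarrow> s \<in> least_nbhd t \<and> t \<in> least_nbhd s"
  unfolding associated_map_def by (rule T0_class_eq_iff)

lemma least_nbhd_subset: "s \<in> topspace S \<Longrightarrow> least_nbhd s \<subseteq> topspace S"
  using openin_subset[OF least_nbhd_open] unfolding topspace_T .

text \<open>Least neighbourhoods are saturated: an open set of \<open>T\<close> that contains a
  point contains all points equivalent to it. Their images are therefore open in the
  quotient.\<close>

lemma preimg_image_least_nbhd:
  assumes s: "s \<in> topspace S"
  shows "preimg S \<pi> (\<pi> ` least_nbhd s) = least_nbhd s"
proof (rule subset_antisym; rule subsetI)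
  fix t assume "t \<in> preimg S \<pi> (\<pi> ` least_nbhd s)"
  then obtain u where u: "t \<in> topspace S" "u \<in> least_nbhd s" "\<pi> t = \<pi> u" by (auto simp: preimg_def)
  then have "t \<in> least_nbhd u" using pi_eq_iff[OF u(1)] least_nbhd_subset[OF s] by blast
  then show "t \<in> least_nbhd s" using least_nbhd_minimal[OF least_nbhd_open[OF s] u(2)] by blast
next
  fix t assume "t \<in> least_nbhd s"
  then show "t \<in> preimg S \<pi> (\<pi> ` least_nbhd s)" using least_nbhd_subset[OF s] by (auto simp: preimg_def)
qed

text \<open>The choice is harmless, since equivalent points lie in each other's least
  neighbourhoods, which are then equal.\<close>

definition Um :: "'a set \<Rightarrow> 'a set set" where
  "Um x = \<pi> ` least_nbhd (SOME s. s \<in> topspace S \<and> \<pi> s = x)"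

lemma UmE:
  assumes "x \<in> topspace X"
  obtains s where "s \<in> topspace S" "\<pi> s = x" "Um x = \<pi> ` least_nbhd s"
proof -
  have "\<exists>s. s \<in> topspace S \<and> \<pi> s = x" using assms unfolding topspace_X by blast
  from someI_ex[OF this] show ?thesis using that unfolding Um_def by blast
qed

text \<open>The preimage of \<open>Um x\<close> is a least neighbourhood, that is, one of the
  intersections that the hypothesis on the covering makes simply connected.\<close>

sublocale minimal_neighbourhoods S X \<pi> Um
proof (unfold_locales, goal_cases)
  case 1
  show ?case by (rule lpc)
next
  case 2
  have "\<pi> \<in> topspace S \<rightarrow> topspace X" by (auto simp: topspace_X)
  moreover have "openin S {s \<in> topspace S. \<pi> s \<in> V}" if "openin X V" for V
    using that openin_T_imp unfolding openin_X preimg_def by blast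
  ultimately show ?case by (simp add: continuous_map_def)
next
  case 3
  show ?case by (simp add: topspace_X)
next
  case (4 x)
  obtain s where s: "s \<in> topspace S" "\<pi> s = x" "Um x = \<pi> ` least_nbhd s" using UmE[OF 4] .
  show ?case unfolding s(3) openin_X preimg_image_least_nbhd[OF s(1)] using least_nbhd_open[OF s(1)] least_nbhd_subset[OF s(1)] by blast
next
  case (5 x)
  obtain s where s: "s \<in> topspace S" "\<pi> s = x" "Um x = \<pi> ` least_nbhd s" using UmE[OF 5] .
  show ?case unfolding s(3) using s(2) least_nbhd_mem[of s] by blast
next
  case (6 W x)
  then have "x \<in> topspace X" using openin_subset by blast
  then obtain s where s: "s \<in> topspace S" "\<pi> s = x" "Um x = \<pi> ` least_nbhd s" by (rule UmE)
  have "least_nbhd s \<subseteq> preimg S \<pi> W"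
    by (rule least_nbhd_minimal) (use 6 s in \<open>auto simp: openin_X preimg_def\<close>)
  then show ?case unfolding s(3) preimg_def by blast
next
  case (7 x)
  obtain s where s: "s \<in> topspace S" "\<pi> s = x" "Um x = \<pi> ` least_nbhd s" using UmE[OF 7] .
  show ?case
    unfolding s(3) preimg_image_least_nbhd[OF s(1)] unfolding least_nbhd_def
    using sc s(1) by (simp add: locally_simply_connected_covering_def)
qed

end

theorem theorem2p19:
  fixes S :: "'a topology" and \<U> :: "'a set set"
  assumes "path_connected_space S"
    and "locally_path_connected_space S"
    and "locally_simply_connected_space S"
    and "finite_open_covering S \<U>"
    and "locally_simply_connected_covering S \<U>"
  defines "X \<equiv> associated_space \<U>" and "\<pi> \<equiv> associated_map \<U>"
  shows "(\<forall>L :: ('a, 'g) presheaf.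
            locally_constant_sheaf S L \<longrightarrow> locally_constant_sheaf X (direct_image S \<pi> L)) \<and>
         images_establish_equivalence S X \<pi> TYPE('g) \<and>
         (\<forall>s\<in>topspace S. fundamental_group_map X \<pi> s
            \<in> iso (fundamental_group S s) (fundamental_group X (\<pi> s)))"
proof -
  interpret finite_cover S \<U>
    using assms(2,4,5) by unfold_locales
  show ?thesis
    unfolding X_def \<pi>_def
    by (intro conjI allI impI ballI direct_image_locally_constant images_equivalence
        fundamental_group_map_iso)
qed

end
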